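(* Let $\mathfrak{g}$ be a complex semisimple Lie algebra, $\mathfrak{q}=\mathfrak{m}+\mathfrak{n}\neq\mathfrak{g}$ a proper standard parabolic subalgebra with standard Levi factor $\mathfrak{m}$ and nilradical $\mathfrak{n}$, $\mathfrak{t}=\mathrm{cent}\,\mathfrak{m}$, and $\ell(\mathfrak{t})=\dim\mathfrak{t}$. Let $\alpha_1,\ldots,\alpha_{\ell(\mathfrak{t})}$ be the simple roots of $\mathfrak{g}$ that are not roots of $\mathfrak{m}$, and let $\beta_j=\alpha_j|_{\mathfrak{t}}$ for $j=1,\ldots,\ell(\mathfrak{t})$. Then $$R_{\mathrm{simp}}=\{\beta_1,\ldots,\beta_{\ell(\mathfrak{t})}\},$$ so that $R_{\mathrm{simp}}$ is a basis of $\mathfrak{t}^*_{\mathbb{R}}$, and $(\beta_i,\beta_j)\le 0$ for $i\neq j$. Furthermore, for every $\nu\in R_+$ one has $$\nu=\sum_{j=1}^{\ell(\mathfrak{t})}n_j(\nu)\,\beta_j .$$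
   Context: Fix a Cartan subalgebra $\mathfrak{h}$ of $\mathfrak{g}$, with roots $\Delta$, positive roots $\Delta_+$, simple roots $\Pi$, and the corresponding Borel subalgebra $\mathfrak{b}$ (spanned by $\mathfrak{h}$ and the positive root vectors). A standard parabolic subalgebra is a Lie subalgebra $\mathfrak{q}\supset\mathfrak{b}$; $\mathfrak{m}$ is its unique Levi factor containing $\mathfrak{h}$. There are exactly $\ell(\mathfrak{t})$ simple roots that are not roots of $\mathfrak{m}$. For $\varphi\in\Delta$ write $\varphi=\sum_{\alpha\in\Pi}n_\alpha(\varphi)\alpha$ with $n_\alpha(\varphi)\in\mathbb{Z}$. For $\nu\in\mathfrak{t}^*$ put $\mathfrak{g}_\nu=\{z\in\mathfrak{g}\mid [x,z]=\nu(x)z\ \text{for all }x\in\mathfrak{t}\}$; a $\mathfrak{t}$-root is a nonzero $\nu\in\mathfrak{t}^*$ with $\mathfrak{g}_\nu\neq0$, and $R$ is the set of $\mathfrak{t}$-roots. $R_+=\{\nu\in R\mid\mathfrak{g}_\nu\subset\mathfrak{n}\}$, so that $R$ is the disjoint union of $R_+$ and $-R_+$. $R_{\mathrm{simp}}$ is the set of simple $\mathfrak{t}$-roots, i.e. those $\nu\in R_+$ that cannot be written $\nu=\nu_1+\nu_2$ with $\nu_1,\nu_2\in R_+$. For $\nu\in R$, $n_j(\nu)=n_{\alpha_j}(\varphi)$ where $\varphi\in\Delta$ is any root with $\varphi|_{\mathfrak{t}}=\nu$ (this is independent of the choice of $\varphi$). $\mathfrak{t}^*_{\mathbb{R}}$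 is the real span of $R$, a real form of $\mathfrak{t}^*$. The form $(\cdot,\cdot)$ on $\mathfrak{t}^*$ is dual to the restriction to $\mathfrak{t}$ of the Killing form; it is positive definite on $\mathfrak{t}^*_{\mathbb{R}}$. *)

theory Defs
  imports Complex_Main "HOL-Library.Function_Algebras"
begin

section \<open>Finite-dimensional complex Lie algebras\<close>

text \<open>The Lie algebra is the whole type; subalgebras, ideals, etc. are subsets of it.\<close>

class complex_lie_algebra = ab_group_add +
  fixes scaleC :: "complex \<Rightarrow> 'a \<Rightarrow> 'a" (infixr "*\<^sub>C" 75)
    and bracket :: "'a \<Rightarrow> 'a \<Rightarrow> 'a"
  assumes scaleC_add_right: "c *\<^sub>C (x + y) = c *\<^sub>C x + c *\<^sub>C y"
    and scaleC_add_left: "(c + d) *\<^sub>C x = c *\<^sub>C x + d *\<^sub>C x"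
    and scaleC_scaleC: "c *\<^sub>C d *\<^sub>C x = (c * d) *\<^sub>C x"
    and scaleC_one: "1 *\<^sub>C x = x"
    and finite_dim: "\<exists>B. finite B \<and> (\<forall>x. \<exists>c. x = (\<Sum>b\<in>B. c b *\<^sub>C b))"
    and bracket_add_left: "bracket (x + y) z = bracket x z + bracket y z"
    and bracket_add_right: "bracket x (y + z) = bracket x y + bracket x z"
    and bracket_scaleC_left: "bracket (c *\<^sub>C x) y = c *\<^sub>C bracket x y"
    and bracket_scaleC_right: "bracket x (c *\<^sub>C y) = c *\<^sub>C bracket x y"
    and bracket_self: "bracket x x = 0"
    and jacobi: "bracket x (bracket y z) + bracket y (bracket z x) + bracket z (bracket x y) = 0"

global_interpretation lie: vector_space "scaleC :: complex \<Rightarrow> 'a \<Rightarrow> 'a::complex_lie_algebra"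
  by unfold_locales (simp_all add: scaleC_add_right scaleC_add_left scaleC_scaleC scaleC_one)

definition lie_basis :: "'a::complex_lie_algebra set" where
  "lie_basis = (SOME B. finite B \<and> lie.independent B \<and> lie.span B = UNIV)"

lemma lie_basis: "finite (lie_basis :: 'a::complex_lie_algebra set)"
  "lie.independent (lie_basis :: 'a set)" "lie.span (lie_basis :: 'a set) = UNIV"
proof -
  obtain B :: "'a set" where B: "finite B" "\<forall>x. \<exists>c. x = (\<Sum>b\<in>B. c b *\<^sub>C b)"
    using finite_dim by blast
  have span: "x \<in> lie.span B" for x
  proof -
    obtain c where "x = (\<Sum>b\<in>B. c b *\<^sub>C b)" using B(2) by blast
    then show ?thesis
      by (simp add: lie.span_sum lie.span_scale lie.span_base)
  qed
  obtain B' where B': "B' \<subseteq> B" "lie.independent B'" "B \<subseteq> lie.span B'"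
    using lie.maximal_independent_subset by blast
  have "lie.span B \<subseteq> lie.span B'"
    using B'(3) by (simp add: lie.span_minimal)
  then have "finite B' \<and> lie.independent B' \<and> lie.span B' = UNIV"
    using B B' span finite_subset by auto
  then have "finite (lie_basis :: 'a set) \<and> lie.independent (lie_basis :: 'a set)
      \<and> lie.span (lie_basis :: 'a set) = UNIV"
    unfolding lie_basis_def by (rule someI)
  then show "finite (lie_basis :: 'a set)" "lie.independent (lie_basis :: 'a set)"
    "lie.span (lie_basis :: 'a set) = UNIV" by auto
qed

global_interpretation lie: finite_dimensional_vector_space
  "scaleC :: complex \<Rightarrow> 'a \<Rightarrow> 'a::complex_lie_algebra" lie_basis
  by unfold_locales (rule lie_basis)+

definition endo_trace :: "('a::complex_lie_algebra \<Rightarrow> 'a) \<Rightarrow> complex" where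
  "endo_trace f = (\<Sum>b\<in>lie_basis. lie.representation lie_basis (f b) b)"

definition killing_form :: "'a::complex_lie_algebra \<Rightarrow> 'a \<Rightarrow> complex" where
  "killing_form x y = endo_trace (\<lambda>z. bracket x (bracket y z))"

definition lie_subalgebra :: "'a::complex_lie_algebra set \<Rightarrow> bool" where
  "lie_subalgebra s \<longleftrightarrow> lie.subspace s \<and> (\<forall>x\<in>s. \<forall>y\<in>s. bracket x y \<in> s)"

definition lie_ideal :: "'a::complex_lie_algebra set \<Rightarrow> 'a set \<Rightarrow> bool" where
  "lie_ideal I s \<longleftrightarrow> lie.subspace I \<and> I \<subseteq> s \<and> (\<forall>x\<in>s. \<forall>y\<in>I. bracket x y \<in> I)"

definition bracket_span :: "'a::complex_lie_algebra set \<Rightarrow> 'a set \<Rightarrow> 'a set" where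
  "bracket_span A B = lie.span {bracket x y | x y. x \<in> A \<and> y \<in> B}"

primrec derived_series :: "'a::complex_lie_algebra set \<Rightarrow> nat \<Rightarrow> 'a set" where
  "derived_series s 0 = s"
| "derived_series s (Suc k) = bracket_span (derived_series s k) (derived_series s k)"

primrec lower_central_series :: "'a::complex_lie_algebra set \<Rightarrow> nat \<Rightarrow> 'a set" where
  "lower_central_series s 0 = s"
| "lower_central_series s (Suc k) = bracket_span s (lower_central_series s k)"

definition lie_solvable :: "'a::complex_lie_algebra set \<Rightarrow> bool" where
  "lie_solvable s \<longleftrightarrow> (\<exists>k. derived_series s k = {0})"

definition lie_nilpotent :: "'a::complex_lie_algebra set \<Rightarrow> bool" where
  "lie_nilpotent s \<longleftrightarrow> (\<exists>k. lower_central_series s k = {0})"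

definition lie_abelian :: "'a::complex_lie_algebra set \<Rightarrow> bool" where
  "lie_abelian s \<longleftrightarrow> (\<forall>x\<in>s. \<forall>y\<in>s. bracket x y = 0)"

definition lie_center :: "'a::complex_lie_algebra set \<Rightarrow> 'a set" where
  "lie_center s = {x \<in> s. \<forall>y\<in>s. bracket x y = 0}"

definition lie_semisimple :: "'a::complex_lie_algebra set \<Rightarrow> bool" where
  "lie_semisimple s \<longleftrightarrow> (\<forall>I. lie_ideal I s \<and> lie_solvable I \<longrightarrow> I = {0})"

text \<open>The adjoint representation is completely reducible.\<close>

definition lie_reductive :: "'a::complex_lie_algebra set \<Rightarrow> bool" where
  "lie_reductive s \<longleftrightarrow>
     (\<forall>I. lie_ideal I s \<longrightarrow>
        (\<exists>J. lie_ideal J s \<and> I \<inter> J = {0} \<and> s = {x + y | x y. x \<in> I \<and> y \<in> J}))"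

text \<open>The sum of all nilpotent ideals, i.e. the largest nilpotent ideal.\<close>

definition nilradical :: "'a::complex_lie_algebra set \<Rightarrow> 'a set" where
  "nilradical s = lie.span (\<Union>{I. lie_ideal I s \<and> lie_nilpotent I})"

section \<open>Weights of abelian subalgebras\<close>

text \<open>The dual of a subspace \<open>V\<close>. A functional on \<open>V\<close> is encoded as a function on
  the whole type that vanishes outside \<open>V\<close>, so that equality and the vector space operations
  of the dual are the pointwise ones.\<close>

definition dual_on :: "'a::complex_lie_algebra set \<Rightarrow> ('a \<Rightarrow> complex) set" where
  "dual_on V = {f. (\<forall>x\<in>V. \<forall>y\<in>V. f (x + y) = f x + f y) \<and>
                   (\<forall>c. \<forall>x\<in>V. f (c *\<^sub>C x) = c * f x) \<and>
                   (\<forall>x. x \<notin> V \<longrightarrow> f x = 0)}"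

definition restrict_to :: "'a set \<Rightarrow> ('a \<Rightarrow> complex) \<Rightarrow> 'a \<Rightarrow> complex" where
  "restrict_to V f = (\<lambda>x. if x \<in> V then f x else 0)"

definition weight_space :: "'a::complex_lie_algebra set \<Rightarrow> ('a \<Rightarrow> complex) \<Rightarrow> 'a set" where
  "weight_space V \<nu> = {z. \<forall>x\<in>V. bracket x z = \<nu> x *\<^sub>C z}"

text \<open>For a Cartan subalgebra \<open>V\<close> these are the roots; for the centre of a Levi factor they
  are the restricted roots.\<close>

definition roots :: "'a::complex_lie_algebra set \<Rightarrow> ('a \<Rightarrow> complex) set" where
  "roots V = {\<nu> \<in> dual_on V. \<nu> \<noteq> 0 \<and> weight_space V \<nu> \<noteq> {0}}"

text \<open>The form on the dual of \<open>V\<close> that is dual to the restriction of the Killing form to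
  \<open>V\<close>, via the element of \<open>V\<close> representing a functional. Meaningful when the restriction
  is nondegenerate.\<close>

definition killing_representative ::
    "'a::complex_lie_algebra set \<Rightarrow> ('a \<Rightarrow> complex) \<Rightarrow> 'a" where
  "killing_representative V \<nu> = (THE y. y \<in> V \<and> (\<forall>x\<in>V. killing_form y x = \<nu> x))"

definition dual_form ::
    "'a::complex_lie_algebra set \<Rightarrow> ('a \<Rightarrow> complex) \<Rightarrow> ('a \<Rightarrow> complex) \<Rightarrow> complex" where
  "dual_form V \<mu> \<nu> = killing_form (killing_representative V \<mu>) (killing_representative V \<nu>)"

definition real_scale :: "real \<Rightarrow> ('a \<Rightarrow> complex) \<Rightarrow> 'a \<Rightarrow> complex" where
  "real_scale r f = (\<lambda>x. complex_of_real r * f x)"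

global_interpretation dual_real: vector_space "real_scale :: real \<Rightarrow> ('a \<Rightarrow> complex) \<Rightarrow> 'a \<Rightarrow> complex"
  by unfold_locales (simp_all add: real_scale_def fun_eq_iff algebra_simps)

section \<open>Cartan subalgebras, positive roots, parabolic subalgebras\<close>

definition ad_diagonalizable :: "'a::complex_lie_algebra \<Rightarrow> bool" where
  "ad_diagonalizable x \<longleftrightarrow> lie.span {z. \<exists>c. bracket x z = c *\<^sub>C z} = UNIV"

text \<open>The usual definition inside a complex semisimple Lie algebra (as in Helgason):
  a maximal abelian subalgebra all of whose elements are ad-semisimple.\<close>

definition cartan_subalgebra :: "'a::complex_lie_algebra set \<Rightarrow> bool" where
  "cartan_subalgebra h \<longleftrightarrow>
     lie_subalgebra h \<and> lie_abelian h \<and>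
     (\<forall>s. lie_subalgebra s \<and> lie_abelian s \<and> h \<subseteq> s \<longrightarrow> s = h) \<and>
     (\<forall>x\<in>h. ad_diagonalizable x)"

definition positive_system ::
    "'a::complex_lie_algebra set \<Rightarrow> ('a \<Rightarrow> complex) set \<Rightarrow> bool" where
  "positive_system h P \<longleftrightarrow>
     P \<subseteq> roots h \<and>
     (\<forall>\<phi>\<in>roots h. \<phi> \<in> P \<longleftrightarrow> - \<phi> \<notin> P) \<and>
     (\<forall>\<phi>\<in>P. \<forall>\<psi>\<in>P. \<phi> + \<psi> \<in> roots h \<longrightarrow> \<phi> + \<psi> \<in> P)"

text \<open>The simple elements of a set of positive (possibly restricted) roots.\<close>

definition simple_of :: "('a \<Rightarrow> complex) set \<Rightarrow> ('a \<Rightarrow> complex) set" where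
  "simple_of P = {\<nu> \<in> P. \<not> (\<exists>\<nu>\<^sub>1\<in>P. \<exists>\<nu>\<^sub>2\<in>P. \<nu> = \<nu>\<^sub>1 + \<nu>\<^sub>2)}"

definition borel :: "'a::complex_lie_algebra set \<Rightarrow> ('a \<Rightarrow> complex) set \<Rightarrow> 'a set" where
  "borel h P = lie.span (h \<union> (\<Union>\<phi>\<in>P. weight_space h \<phi>))"

definition standard_parabolic ::
    "'a::complex_lie_algebra set \<Rightarrow> ('a \<Rightarrow> complex) set \<Rightarrow> 'a set \<Rightarrow> bool" where
  "standard_parabolic h P q \<longleftrightarrow> lie_subalgebra q \<and> borel h P \<subseteq> q"

text \<open>Levi factor in the sense of parabolic subalgebras: a reductive complement of the
  nilradical.\<close>

definition levi_factor :: "'a::complex_lie_algebra set \<Rightarrow> 'a set \<Rightarrow> bool" where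
  "levi_factor m q \<longleftrightarrow>
     lie_subalgebra m \<and> lie_reductive m \<and>
     m \<inter> nilradical q = {0} \<and> q = {x + y | x y. x \<in> m \<and> y \<in> nilradical q}"

definition roots_in :: "'a::complex_lie_algebra set \<Rightarrow> 'a set \<Rightarrow> ('a \<Rightarrow> complex) set" where
  "roots_in h m = {\<phi> \<in> roots h. weight_space h \<phi> \<inter> m \<noteq> {0}}"

text \<open>The integer coefficient of \<open>\<alpha>\<close> in the expansion of \<open>\<phi>\<close> in the simple roots
  \<open>simple_of P\<close>.\<close>

definition root_coeff ::
    "('a \<Rightarrow> complex) set \<Rightarrow> ('a \<Rightarrow> complex) \<Rightarrow> ('a \<Rightarrow> complex) \<Rightarrow> int" where
  "root_coeff P \<phi> =
     (THE c. (\<forall>\<alpha>. \<alpha> \<notin> simple_of P \<longrightarrow> c \<alpha> = 0) \<and>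
             \<phi> = (\<lambda>x. \<Sum>\<alpha>\<in>simple_of P. of_int (c \<alpha>) * \<alpha> x))"

text \<open>The common value of the coefficient of \<open>\<alpha>\<close> in all roots restricting to \<open>\<nu>\<close>
  on \<open>t\<close>.\<close>

definition restricted_coeff ::
    "'a::complex_lie_algebra set \<Rightarrow> ('a \<Rightarrow> complex) set \<Rightarrow> 'a set \<Rightarrow>
     ('a \<Rightarrow> complex) \<Rightarrow> ('a \<Rightarrow> complex) \<Rightarrow> int" where
  "restricted_coeff h P t \<alpha> \<nu> =
     (THE k. \<exists>\<phi>\<in>roots h. restrict_to t \<phi> = \<nu> \<and> k = root_coeff P \<phi> \<alpha>)"

end

theory Submission
  imports Defs
begin

text \<open>The trace of a commutator vanishes. Applied to \<open>[e, f]\<close> acting on a sum of root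
  spaces stable under root vectors \<open>e\<close> and \<open>f\<close> for \<open>\<plusminus>\<phi>\<close>, this takes the
  place of the representation theory of \<open>sl\<^sub>2\<close>: it yields the reality of the root form,
  one-dimensionality of root spaces, \<open>\<phi> + \<psi> \<in> \<Delta> \<union> {0}\<close> whenever
  \<open>(\<phi>, \<psi>) < 0\<close>, and \<open>(\<delta>, \<alpha>) > 0\<close> for simple \<open>\<alpha>\<close> and the sum
  \<open>\<delta>\<close> of the positive roots. The Killing form is nondegenerate because opposite root vectors
  one of which lies in its radical commute, so that the root vectors in the radical span an ideal
  to which Engel's theorem applies.

  For the parabolic, \<open>\<qq> = \<mm> + \<nn>\<close> forces the roots of \<open>\<mm>\<close> to be exactly those
  supported on simple roots of \<open>\<mm>\<close>. A positive root outside \<open>\<mm>\<close> that is not simple is a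
  sum of two positive roots; either both lie outside \<open>\<mm>\<close>, and its restriction decomposes, or
  one of them restricts to zero and the other has the same restriction. Hence the simple
  \<open>t\<close>-roots are the \<open>\<beta>\<^sub>j\<close>. They are orthogonal projections of an obtuse system along part of
  that system, hence again obtuse.\<close>

section \<open>Brackets and traces\<close>

text \<open>The trace identity says that the values \<chi>([e, f]), weighted by dimensions, sum to
  zero over the weights \<chi> of a stable sum. Along the \<phi>-string through a root \<psi> it
  reads S \<psi>([e, f]) + N \<phi>([e, f]) = 0 with integers S > 0 and N, which is the source of
  reality. Cutting the string where e or f acts by zero turns the same identity into sign
  conditions. An obstacle is that a positive system is given combinatorially, as one half of the
  roots closed under sums; no ordering and no functional positive on it is at hand. So even the
  termination of splitting into simple roots needs an argument, and the usual proof that obtuse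
  vectors in an open half-space are independent needs a substitute for the half-space: this is the
  purpose of \<delta>. One-dimensionality turns \<open>h\<close>-stable subspaces into sets of
  roots, since a subspace containing one root vector contains its root space. Nonvanishing of
  brackets of root vectors, when the sum is a root, then carries membership in \<open>m\<close> or
  \<open>n\<close> along sums of roots.\<close>

lemma bracket_zero_left [simp]: "bracket 0 y = (0 :: 'a::complex_lie_algebra)"
  using bracket_add_left[of 0 0 y] by simp

lemma bracket_zero_right [simp]: "bracket x 0 = (0 :: 'a::complex_lie_algebra)"
  using bracket_add_right[of x 0 0] by simp

lemma bracket_minus_right: "bracket x (- y) = - bracket x (y :: 'a::complex_lie_algebra)"
  using bracket_add_right[of x y "- y"] by (simp add: eq_neg_iff_add_eq_0 add.commute)

lemma bracket_diff_right: "bracket x (y - z) = bracket x y - bracket x (z :: 'a::complex_lie_algebra)"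
  using bracket_add_right[of x y "- z"] by (simp add: bracket_minus_right)

lemma bracket_sum_right: "bracket x (\<Sum>i\<in>I. f i) = (\<Sum>i\<in>I. bracket x (f i :: 'a::complex_lie_algebra))"
  by (induction I rule: infinite_finite_induct) (simp_all add: bracket_add_right)

lemma bracket_skew: "bracket x y = - bracket y (x :: 'a::complex_lie_algebra)"
proof -
  have "bracket x y + bracket y x = bracket (x + y) (x + y)"
    unfolding bracket_add_left bracket_add_right by (simp add: bracket_self)
  then show ?thesis by (simp add: bracket_self eq_neg_iff_add_eq_0)
qed

lemma bracket_bracket_left:
  "bracket (bracket x y) z = bracket x (bracket y z) - bracket y (bracket x (z :: 'a::complex_lie_algebra))"
proof -
  have "bracket x (bracket y z) + bracket y (bracket z x) + bracket z (bracket x y) = 0"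
    by (rule jacobi)
  moreover have "bracket y (bracket z x) = - bracket y (bracket x z)"
    by (subst bracket_skew[of z x]) (rule bracket_minus_right)
  moreover have "bracket z (bracket x y) = - bracket (bracket x y) z"
    by (rule bracket_skew)
  ultimately show ?thesis by (simp add: algebra_simps)
qed

lemma bracket_span_left:
  assumes "lie.subspace U" "\<And>a. a \<in> A \<Longrightarrow> bracket a y \<in> U" "x \<in> lie.span A"
  shows "bracket x (y :: 'a::complex_lie_algebra) \<in> U"
  using assms(3)
  by (induction rule: lie.span_induct_alt)
    (use assms(1,2) in \<open>auto simp: bracket_add_left bracket_scaleC_left
       intro: lie.subspace_0 lie.subspace_add lie.subspace_scale\<close>)

lemma bracket_span_right:
  assumes "lie.subspace U" "\<And>a. a \<in> A \<Longrightarrow> bracket y a \<in> U" "x \<in> lie.span A"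
  shows "bracket y (x :: 'a::complex_lie_algebra) \<in> U"
  using assms(3)
  by (induction rule: lie.span_induct_alt)
    (use assms(1,2) in \<open>auto simp: bracket_add_right bracket_scaleC_right
       intro: lie.subspace_0 lie.subspace_add lie.subspace_scale\<close>)

text \<open>The trace of the restriction of \<open>f\<close> to the span of \<open>B\<close>,
  meaningful when \<open>B\<close> is independent and \<open>f\<close> maps it into its span. Traces
  on stable subspaces are needed, while \<open>endo_trace\<close> refers to the whole
  algebra.\<close>

definition trace_on :: "'a::complex_lie_algebra set \<Rightarrow> ('a \<Rightarrow> 'a) \<Rightarrow> complex" where
  "trace_on B f = (\<Sum>b\<in>B. lie.representation B (f b) b)"

text \<open>The product rule for matrix entries, with source basis \<open>C\<close> and target basis
  \<open>B\<close> kept apart: \<open>C = B\<close> serves for the trace of a product, different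
  bases for independence of the basis.\<close>

lemma representation_linear_sum:
  fixes f :: "'a::complex_lie_algebra \<Rightarrow> 'a"
  assumes B: "lie.independent B" and C: "finite C" "lie.independent C" and v: "v \<in> lie.span C"
    and f: "Vector_Spaces.linear scaleC scaleC f" "\<And>c. c \<in> C \<Longrightarrow> f c \<in> lie.span B"
  shows "lie.representation B (f v) b = (\<Sum>c\<in>C. lie.representation C v c * lie.representation B (f c) b)"
proof -
  interpret f: Vector_Spaces.linear scaleC scaleC f by (rule f(1))
  have "v = (\<Sum>c\<in>C. lie.representation C v c *\<^sub>C c)"
    using lie.sum_representation_eq[of C v C] C v by simp
  then have "f v = (\<Sum>c\<in>C. lie.representation C v c *\<^sub>C f c)"
    by (metis (no_types, lifting) f.scale f.sum sum.cong)
  moreover have "lie.representation B (\<Sum>c\<in>C. lie.representation C v c *\<^sub>C f c) b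
      = (\<Sum>c\<in>C. lie.representation B (lie.representation C v c *\<^sub>C f c) b)"
    by (simp add: lie.representation_sum[OF B] f(2) lie.span_scale)
  ultimately show ?thesis
    by (simp add: lie.representation_scale[OF B] f(2))
qed

lemma trace_on_commute:
  fixes f g :: "'a::complex_lie_algebra \<Rightarrow> 'a"
  assumes B: "finite B" "lie.independent B"
    and f: "Vector_Spaces.linear scaleC scaleC f" "\<And>b. b \<in> B \<Longrightarrow> f b \<in> lie.span B"
    and g: "Vector_Spaces.linear scaleC scaleC g" "\<And>b. b \<in> B \<Longrightarrow> g b \<in> lie.span B"
  shows "trace_on B (\<lambda>z. f (g z)) = trace_on B (\<lambda>z. g (f z))"
proof -
  let ?r = "lie.representation B"
  have "trace_on B (\<lambda>z. f (g z)) = (\<Sum>b\<in>B. \<Sum>c\<in>B. ?r (g b) c * ?r (f c) b)"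
    unfolding trace_on_def
    by (rule sum.cong[OF refl], rule representation_linear_sum) (use B f g in auto)
  also have "\<dots> = (\<Sum>c\<in>B. \<Sum>b\<in>B. ?r (f c) b * ?r (g b) c)"
    by (subst sum.swap) (simp add: mult.commute)
  also have "\<dots> = trace_on B (\<lambda>z. g (f z))"
    unfolding trace_on_def
    by (rule sum.cong[OF refl], rule representation_linear_sum[symmetric]) (use B f g in auto)
  finally show ?thesis .
qed

lemma trace_on_basis_change:
  fixes f :: "'a::complex_lie_algebra \<Rightarrow> 'a"
  assumes B: "finite B" "lie.independent B" "lie.span B = UNIV"
    and C: "finite C" "lie.independent C" "lie.span C = UNIV"
    and f: "Vector_Spaces.linear scaleC scaleC f"
  shows "trace_on B f = trace_on C f"
proof -
  have "trace_on B f = (\<Sum>b\<in>B. \<Sum>c\<in>C. lie.representation C b c * lie.representation B (f c) b)"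
    unfolding trace_on_def
    by (rule sum.cong[OF refl], rule representation_linear_sum) (use B C f in auto)
  also have "\<dots> = (\<Sum>c\<in>C. \<Sum>b\<in>B. lie.representation B (f c) b * lie.representation C b c)"
    by (subst sum.swap) (simp add: mult.commute)
  also have "\<dots> = trace_on C f"
    unfolding trace_on_def
  proof (rule sum.cong[OF refl])
    fix c
    \<comment> \<open>The sum over \<open>b\<close> is the product rule for the identity map at the
      vector \<open>f c\<close>: passing through \<open>B\<close> and on to \<open>C\<close> gives
      the coordinates in \<open>C\<close>.\<close>
    have "Vector_Spaces.linear scaleC scaleC (\<lambda>z :: 'a. z)"
      by (rule lie.linear_ident)
    from representation_linear_sum[OF C(2) B(1,2) _ this, of "f c" c] B C
    show "(\<Sum>b\<in>B. lie.representation B (f c) b * lie.representation C b c) = lie.representation C (f c) c"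
      by simp
  qed
  finally show ?thesis .
qed

lemma linear_bracket: "Vector_Spaces.linear scaleC scaleC (bracket (x :: 'a::complex_lie_algebra))"
  by unfold_locales (simp_all add: bracket_add_right bracket_scaleC_right)

lemma linear_bracket_bracket:
  "Vector_Spaces.linear scaleC scaleC (\<lambda>z. bracket x (bracket y (z :: 'a::complex_lie_algebra)))"
  by unfold_locales (simp_all add: bracket_add_right bracket_scaleC_right)

lemma endo_trace_eq: "endo_trace f = trace_on lie_basis f"
  by (simp add: endo_trace_def trace_on_def)

lemma killing_form_trace_on:
  fixes B :: "'a::complex_lie_algebra set"
  assumes "finite B" "lie.independent B" "lie.span B = UNIV"
  shows "killing_form x y = trace_on B (\<lambda>z. bracket x (bracket y z))"
  unfolding killing_form_def endo_trace_eq
  by (rule trace_on_basis_change) (use assms lie_basis linear_bracket_bracket in auto)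

lemma endo_trace_commute:
  fixes f g :: "'a::complex_lie_algebra \<Rightarrow> 'a"
  assumes "Vector_Spaces.linear scaleC scaleC f" "Vector_Spaces.linear scaleC scaleC g"
  shows "endo_trace (\<lambda>z. f (g z)) = endo_trace (\<lambda>z. g (f z))"
  unfolding endo_trace_eq
  by (rule trace_on_commute) (use assms lie_basis in auto)

lemma endo_trace_add: "endo_trace (\<lambda>z. f z + g z) = endo_trace f + endo_trace g"
  by (simp add: endo_trace_def lie.representation_add lie_basis sum.distrib)

lemma endo_trace_diff: "endo_trace (\<lambda>z. f z - g z) = endo_trace f - endo_trace g"
  by (simp add: endo_trace_def lie.representation_diff lie_basis sum_subtractf)

lemma endo_trace_scale: "endo_trace (\<lambda>z. c *\<^sub>C f z) = c * endo_trace f"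
  by (simp add: endo_trace_def lie.representation_scale lie_basis sum_distrib_left)

section \<open>The Killing form as an invariant symmetric bilinear form\<close>

lemma killing_form_commute: "killing_form x y = killing_form y x"
  unfolding killing_form_def by (rule endo_trace_commute[OF linear_bracket linear_bracket])

lemma killing_form_add_left: "killing_form (x + y) z = killing_form x z + killing_form y z"
  by (simp add: killing_form_def bracket_add_left endo_trace_add)

lemma killing_form_scale_left: "killing_form (c *\<^sub>C x) z = c * killing_form x z"
  by (simp add: killing_form_def bracket_scaleC_left endo_trace_scale)

lemma killing_form_add_right: "killing_form z (x + y) = killing_form z x + killing_form z y"
  by (metis killing_form_add_left killing_form_commute)

lemma killing_form_scale_right: "killing_form z (c *\<^sub>C x) = c * killing_form z x"
  by (metis killing_form_scale_left killing_form_commute)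

lemma killing_form_zero_left [simp]: "killing_form 0 z = 0"
  using killing_form_scale_left[of 0 0 z] by simp

lemma killing_form_zero_right [simp]: "killing_form z 0 = 0"
  using killing_form_commute[of z 0] by simp

lemma killing_form_diff_left: "killing_form (x - y) z = killing_form x z - killing_form y z"
  using killing_form_add_left[of "x - y" y z] by simp

lemma killing_form_sum_left: "killing_form (\<Sum>i\<in>I. f i) z = (\<Sum>i\<in>I. killing_form (f i) z)"
  by (induction I rule: infinite_finite_induct) (simp_all add: killing_form_add_left)

lemma killing_form_sum_right: "killing_form z (\<Sum>i\<in>I. f i) = (\<Sum>i\<in>I. killing_form z (f i))"
  by (induction I rule: infinite_finite_induct) (simp_all add: killing_form_add_right)

text \<open>Expanding the brackets leaves tr(ad x ad y ad z) on both sides; the other two terms,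
  tr(ad y ad x ad z) and tr(ad x ad z ad y), agree by cyclicity.\<close>

lemma killing_form_invariant: "killing_form (bracket x y) z = killing_form x (bracket y z)"
proof -
  have "endo_trace (\<lambda>u. bracket y (bracket x (bracket z u)))
      = endo_trace (\<lambda>u. bracket x (bracket z (bracket y u)))"
    by (rule endo_trace_commute[OF linear_bracket linear_bracket_bracket])
  then show ?thesis
    by (simp add: killing_form_def bracket_bracket_left bracket_diff_right endo_trace_diff)
qed

section \<open>Weight spaces\<close>

lemma subspace_weight_space: "lie.subspace (weight_space V \<phi>)"
  by (auto simp: lie.subspace_def weight_space_def bracket_add_right bracket_scaleC_right
      scaleC_add_right scaleC_scaleC mult.commute)

lemma weight_spaceD: "z \<in> weight_space V \<phi> \<Longrightarrow> x \<in> V \<Longrightarrow> bracket x z = \<phi> x *\<^sub>C z"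
  by (simp add: weight_space_def)

lemma bracket_weight_space:
  assumes "x \<in> weight_space V \<phi>" "y \<in> weight_space V \<psi>"
  shows "bracket x y \<in> weight_space V (\<phi> + \<psi>)"
  unfolding weight_space_def
proof safe
  fix v assume v: "v \<in> V"
  have "bracket v (bracket x y) = bracket (bracket v x) y + bracket x (bracket v y)"
    by (simp add: bracket_bracket_left)
  also have "\<dots> = (\<phi> + \<psi>) v *\<^sub>C bracket x y"
    using assms v by (simp add: weight_spaceD bracket_scaleC_left bracket_scaleC_right scaleC_add_left)
  finally show "bracket v (bracket x y) = (\<phi> + \<psi>) v *\<^sub>C bracket x y" .
qed

text \<open>Applying ad x - \<psi>(x) deletes the component of weight \<psi> and multiplies that of
  weight \<phi> by \<phi>(x) - \<psi>(x), which is nonzero for a suitable x. The choice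
  \<open>W = {0}\<close> gives independence of weight vectors; general \<open>W\<close> shows that
  stable subspaces are sums of their weight parts.\<close>

lemma weight_components:
  fixes w :: "('a::complex_lie_algebra \<Rightarrow> complex) \<Rightarrow> 'a"
  assumes "finite F"
    and "\<And>\<phi> \<psi>. \<phi> \<in> F \<Longrightarrow> \<psi> \<in> F \<Longrightarrow> \<phi> \<noteq> \<psi> \<Longrightarrow> \<exists>x\<in>V. \<phi> x \<noteq> \<psi> x"
    and "\<And>\<phi>. \<phi> \<in> F \<Longrightarrow> w \<phi> \<in> weight_space V \<phi>"
    and W: "lie.subspace W" "\<And>x z. x \<in> V \<Longrightarrow> z \<in> W \<Longrightarrow> bracket x z \<in> W"
    and "(\<Sum>\<phi>\<in>F. w \<phi>) \<in> W" "\<phi> \<in> F"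
  shows "w \<phi> \<in> W"
  using assms(1-3,6,7)
proof (induction F arbitrary: w \<phi> rule: finite_induct)
  case empty
  then show ?case by simp
next
  case (insert \<psi> F)
  let ?z = "\<Sum>\<phi>\<in>insert \<psi> F. w \<phi>"
  have F: "w \<phi> \<in> W" if "\<phi> \<in> F" for \<phi>
  proof -
    obtain x where x: "x \<in> V" "\<phi> x \<noteq> \<psi> x"
      using insert.prems(1)[of \<phi> \<psi>] insert.hyps \<open>\<phi> \<in> F\<close> by auto
    let ?w = "\<lambda>\<phi>. (\<phi> x - \<psi> x) *\<^sub>C w \<phi>"
    have "bracket x ?z = (\<Sum>\<phi>\<in>insert \<psi> F. \<phi> x *\<^sub>C w \<phi>)"
      by (subst bracket_sum_right, rule sum.cong)
        (use insert.prems(2) x weight_spaceD in blast)+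
    then have "bracket x ?z - \<psi> x *\<^sub>C ?z = (\<Sum>\<phi>\<in>F. ?w \<phi>)"
      using insert.hyps by (simp add: lie.scale_left_diff_distrib lie.scale_right_distrib
          lie.scale_sum_right sum_subtractf)
    moreover have "bracket x ?z - \<psi> x *\<^sub>C ?z \<in> W"
      using W x(1) insert.prems(3) by (intro lie.subspace_diff lie.subspace_scale)
    ultimately have "(\<Sum>\<phi>\<in>F. ?w \<phi>) \<in> W" by simp
    then have "?w \<phi> \<in> W"
      by (intro insert.IH[where w = ?w])
        (use insert.prems that in \<open>auto intro: lie.subspace_scale[OF subspace_weight_space]\<close>)
    then have "inverse (\<phi> x - \<psi> x) *\<^sub>C ?w \<phi> \<in> W"
      by (rule lie.subspace_scale[OF W(1)])
    then show ?thesis using x by simp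
  qed
  have "?z - (\<Sum>\<phi>\<in>F. w \<phi>) \<in> W"
    using F by (intro lie.subspace_diff[OF W(1)] lie.subspace_sum[OF W(1)] insert.prems)
  then have "w \<psi> \<in> W" using insert.hyps by simp
  then show ?case using F insert.prems(4) by auto
qed

text \<open>The family \<open>w\<close> vanishes off \<open>F\<close>, so that sums arising in the
  induction can be taken over a common larger index set. The finite \<open>F\<close> is part of the
  conclusion because the weights are not yet known to be finite in number.\<close>

lemma span_UN_subspaces:
  fixes W :: "'i \<Rightarrow> 'a::complex_lie_algebra set"
  assumes "z \<in> lie.span (\<Union>i\<in>I. W i)" "\<And>i. i \<in> I \<Longrightarrow> lie.subspace (W i)"
  shows "\<exists>F w. finite F \<and> F \<subseteq> I \<and> (\<forall>i. w i \<in> (if i \<in> F then W i else {0})) \<and> z = (\<Sum>i\<in>F. w i)"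
  using assms(1)
proof (induction rule: lie.span_induct_alt)
  case base
  show ?case by (intro exI[of _ "{}"] exI[of _ "\<lambda>_. 0"]) simp
next
  case (step c x y)
  obtain i where i: "i \<in> I" "x \<in> W i" using step.hyps by blast
  obtain F w where w: "finite F" "F \<subseteq> I" "\<And>i. w i \<in> (if i \<in> F then W i else {0})" "y = (\<Sum>i\<in>F. w i)"
    using step.IH by blast
  have W: "w i \<in> W i" if "i \<in> I" for i
    using w(3)[of i] assms(2)[OF that] by (auto split: if_splits intro: lie.subspace_0)
  let ?w = "w(i := c *\<^sub>C x + w i)"
  have "y = (\<Sum>j\<in>insert i F. w j)"
    unfolding w(4) by (rule sum.mono_neutral_left) (use w(1) w(3)[of i] in auto)
  then have y: "y = w i + (\<Sum>j\<in>F - {i}. w j)"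
    using w(1) by (simp add: sum.insert_remove)
  have "(\<Sum>j\<in>insert i F. ?w j) = ?w i + (\<Sum>j\<in>F - {i}. ?w j)"
    using w(1) by (simp add: sum.insert_remove)
  also have "\<dots> = c *\<^sub>C x + y" using y by (simp add: add.assoc)
  finally have "c *\<^sub>C x + y = (\<Sum>j\<in>insert i F. ?w j)" by simp
  moreover have "?w j \<in> (if j \<in> insert i F then W j else {0})" for j
    using i W[OF i(1)] w(3)[of j] assms(2)[OF i(1)]
    by (auto intro!: lie.subspace_add lie.subspace_scale)
  ultimately show ?case using w i by (intro exI[of _ "insert i F"] exI[of _ ?w]) auto
qed

section \<open>The root space decomposition\<close>

lemma eigenvalues_on_span:
  assumes "\<And>x. x \<in> S \<Longrightarrow> \<exists>c. bracket x z = c *\<^sub>C z" "x \<in> lie.span S"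
  shows "\<exists>c. bracket x (z :: 'a::complex_lie_algebra) = c *\<^sub>C z"
  using assms(2)
proof (induction rule: lie.span_induct_alt)
  case base
  show ?case by (intro exI[of _ 0]) simp
next
  case (step c x y)
  then obtain a b where "bracket x z = a *\<^sub>C z" "bracket y z = b *\<^sub>C z"
    using assms(1) by blast
  then have "bracket (c *\<^sub>C x + y) z = (c * a + b) *\<^sub>C z"
    by (simp add: bracket_add_left bracket_scaleC_left scaleC_add_left)
  then show ?case by blast
qed

locale cartan =
  fixes h :: "'g::complex_lie_algebra set"
  assumes cartan: "cartan_subalgebra h"
begin

abbreviation root_space ("\<gg>") where "\<gg> \<equiv> weight_space h"

lemma subspace_h: "lie.subspace h"
  using cartan by (simp add: cartan_subalgebra_def lie_subalgebra_def)

lemma bracket_h_h: "x \<in> h \<Longrightarrow> y \<in> h \<Longrightarrow> bracket x y = 0"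
  using cartan by (simp add: cartan_subalgebra_def lie_abelian_def)

text \<open>By maximality of \<open>h\<close>, since adjoining \<open>x\<close> again spans an
  abelian subalgebra. Hence \<open>h\<close> is its own weight space of weight 0.\<close>

lemma centralizer_h:
  assumes "\<And>y. y \<in> h \<Longrightarrow> bracket y x = 0"
  shows "x \<in> h"
proof -
  let ?s = "lie.span (insert x h)"
  have xh: "bracket a b = 0" if "a \<in> insert x h" "b \<in> insert x h" for a b
    using that assms[of b] assms[of a] bracket_h_h[of a b] bracket_skew[of a b] by (auto simp: bracket_self)
  have "bracket a b \<in> {0}" if "a \<in> ?s" "b \<in> insert x h" for a b
    by (rule bracket_span_left[OF _ _ that(1)]) (use xh that(2) in auto)
  then have "bracket a b \<in> {0}" if "a \<in> ?s" "b \<in> ?s" for a b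
    by (intro bracket_span_right[OF _ _ that(2)]) (use that(1) in auto)
  then have "lie_subalgebra ?s" "lie_abelian ?s"
    by (auto simp: lie_subalgebra_def lie_abelian_def lie.span_zero)
  moreover have "h \<subseteq> ?s" "x \<in> ?s" by (auto intro: lie.span_base)
  ultimately show ?thesis
    using cartan unfolding cartan_subalgebra_def by blast
qed

lemma weight_space_0: "\<gg> 0 = h"
  using centralizer_h bracket_h_h by (auto simp: weight_space_def)

text \<open>Simultaneous diagonalization, one operator at a time. Since ad x commutes with ad s for
  s in \<open>S\<close>, the space \<open>weight_space S \<nu>\<close> is stable under ad x and
  therefore contains the eigencomponents of its elements.\<close>

lemma joint_eigenvectors_span:
  assumes "finite S" "S \<subseteq> h"
  shows "z \<in> lie.span (\<Union>\<nu>. weight_space S \<nu>)"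
  using assms
proof (induction S arbitrary: z rule: finite_induct)
  case empty
  show ?case by (rule lie.span_base) (simp add: weight_space_def)
next
  case (insert x S)
  have "weight_space S \<nu> \<subseteq> lie.span (\<Union>\<mu>. weight_space (insert x S) \<mu>)" for \<nu>
  proof
    fix z assume z: "z \<in> weight_space S \<nu>"
    \<comment> \<open>Eigenvalues of the single operator ad x are encoded as constant functions, so
      that distinct indices differ at \<open>x\<close> and the lemmas on weight spaces apply to
      \<open>{x}\<close>.\<close>
    let ?E = "\<lambda>\<mu> :: 'g \<Rightarrow> complex. weight_space {x} \<mu>" and ?I = "range (\<lambda>c :: complex. \<lambda>_ :: 'g. c)"
    have "{z. \<exists>c. bracket x z = c *\<^sub>C z} = (\<Union>\<mu>\<in>?I. ?E \<mu>)"
      by (auto simp: weight_space_def)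
    moreover have "ad_diagonalizable x"
      using cartan insert.prems by (simp add: cartan_subalgebra_def)
    ultimately have "z \<in> lie.span (\<Union>\<mu>\<in>?I. ?E \<mu>)"
      unfolding ad_diagonalizable_def by (metis UNIV_I)
    from span_UN_subspaces[OF this subspace_weight_space] obtain F w where
      w: "finite F" "F \<subseteq> ?I" "\<And>\<mu>. w \<mu> \<in> (if \<mu> \<in> F then ?E \<mu> else {0})" "z = (\<Sum>\<mu>\<in>F. w \<mu>)"
      by blast
    have wS: "w \<mu> \<in> weight_space S \<nu>" if "\<mu> \<in> F" for \<mu>
    proof (rule weight_components[OF w(1), where V = "{x}"])
      show "\<exists>x\<in>{x}. \<phi> x \<noteq> \<psi> x" if "\<phi> \<in> F" "\<psi> \<in> F" "\<phi> \<noteq> \<psi>" for \<phi> \<psi>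
      proof -
        have "\<phi> \<in> ?I" "\<psi> \<in> ?I" using w(2) that by blast+
        then obtain c d where "\<phi> = (\<lambda>_. c)" "\<psi> = (\<lambda>_. d)" by blast
        then show ?thesis using that(3) by auto
      qed
      show "w \<phi> \<in> weight_space {x} \<phi>" if "\<phi> \<in> F" for \<phi>
        using w(3)[of \<phi>] that by simp
      show "lie.subspace (weight_space S \<nu>)" by (rule subspace_weight_space)
      show "sum w F \<in> weight_space S \<nu>" using z w(4) by simp
      show "\<mu> \<in> F" by fact
      show "bracket x' z \<in> weight_space S \<nu>" if x': "x' \<in> {x}" and z: "z \<in> weight_space S \<nu>" for x' z
        unfolding weight_space_def
      proof safe
        fix s assume s: "s \<in> S"
        have "bracket s (bracket x z) = bracket (bracket s x) z + bracket x (bracket s z)"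
          by (simp add: bracket_bracket_left)
        also have "\<dots> = \<nu> s *\<^sub>C bracket x z"
          using s insert.prems bracket_h_h[of s x] weight_spaceD[OF z s]
          by (auto simp: bracket_scaleC_right)
        finally show "bracket s (bracket x' z) = \<nu> s *\<^sub>C bracket x' z" using x' by simp
      qed
    qed
    have "w \<mu> \<in> (\<Union>\<mu>. weight_space (insert x S) \<mu>)" if "\<mu> \<in> F" for \<mu>
    proof -
      have "w \<mu> \<in> weight_space (insert x S) (\<nu>(x := \<mu> x))"
        using wS[OF that] w(3)[of \<mu>] that insert.hyps(2)
        by (auto simp: weight_space_def)
      then show ?thesis by blast
    qed
    then show "z \<in> lie.span (\<Union>\<mu>. weight_space (insert x S) \<mu>)"
      unfolding w(4) by (intro lie.span_sum lie.span_base)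
  qed
  then have "lie.span (\<Union>\<nu>. weight_space S \<nu>) \<subseteq> lie.span (\<Union>\<mu>. weight_space (insert x S) \<mu>)"
    by (intro lie.span_minimal) auto
  then show ?case using insert.IH[of z] insert.prems by auto
qed

text \<open>Zero is included so that \<open>h\<close> itself is one of the summands of the
  decomposition. It is the only member whose weight space may be trivial.\<close>

definition weights :: "('g \<Rightarrow> complex) set" where
  "weights = insert 0 (roots h)"

lemma weights_dual: "\<phi> \<in> weights \<Longrightarrow> \<phi> \<in> dual_on h"
  by (auto simp: weights_def roots_def dual_on_def)

lemma dual_on_add: "\<phi> \<in> dual_on h \<Longrightarrow> x \<in> h \<Longrightarrow> y \<in> h \<Longrightarrow> \<phi> (x + y) = \<phi> x + \<phi> y"
  and dual_on_scale: "\<phi> \<in> dual_on h \<Longrightarrow> x \<in> h \<Longrightarrow> \<phi> (c *\<^sub>C x) = c * \<phi> x"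
  and dual_on_outside: "\<phi> \<in> dual_on h \<Longrightarrow> x \<notin> h \<Longrightarrow> \<phi> x = 0"
  by (auto simp: dual_on_def)

lemma dual_on_sum:
  assumes \<phi>: "\<phi> \<in> dual_on h" and "\<And>i. i \<in> I \<Longrightarrow> x i \<in> h"
  shows "\<phi> (\<Sum>i\<in>I. x i) = (\<Sum>i\<in>I. \<phi> (x i))"
proof -
  have "\<phi> 0 = 0" using dual_on_scale[OF \<phi>, of 0 0] lie.subspace_0[OF subspace_h] by simp
  then show ?thesis
    using assms(2)
    by (induction I rule: infinite_finite_induct)
      (simp_all add: dual_on_add[OF \<phi>] lie.subspace_sum[OF subspace_h])
qed

lemma dual_on_eqI:
  assumes "\<phi> \<in> dual_on h" "\<psi> \<in> dual_on h" "\<And>x. x \<in> h \<Longrightarrow> \<phi> x = \<psi> x"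
  shows "\<phi> = \<psi>"
  using assms dual_on_outside by (metis ext)

lemma weights_separate:
  assumes "\<phi> \<in> weights" "\<psi> \<in> weights" "\<phi> \<noteq> \<psi>"
  shows "\<exists>x\<in>h. \<phi> x \<noteq> \<psi> x"
  using dual_on_eqI[of \<phi> \<psi>] assms weights_dual by blast

text \<open>A joint eigenvector for a basis of \<open>h\<close> is one for all of \<open>h\<close>.
  Uniqueness of the eigenvalue on a nonzero vector makes it depend linearly on the element of
  \<open>h\<close>, so it is a weight.\<close>

lemma weight_spaces_span: "lie.span (\<Union>\<phi>\<in>weights. \<gg> \<phi>) = UNIV"
proof -
  obtain S where S: "S \<subseteq> h" "lie.independent S" "h \<subseteq> lie.span S"
    using lie.maximal_independent_subset by blast
  have "finite S" using S(2) by (rule lie.finiteI_independent)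
  have "weight_space S \<nu> \<subseteq> (\<Union>\<phi>\<in>weights. \<gg> \<phi>)" for \<nu>
  proof
    fix z assume z: "z \<in> weight_space S \<nu>"
    show "z \<in> (\<Union>\<phi>\<in>weights. \<gg> \<phi>)"
    proof (cases "z = 0")
      case True
      then show ?thesis by (auto simp: weights_def weight_space_def)
    next
      case False
      have ev: "\<exists>c. bracket x z = c *\<^sub>C z" if "x \<in> h" for x
        using eigenvalues_on_span[of S z x] S that weight_spaceD[OF z] by blast
      define \<phi> where "\<phi> = (\<lambda>x. if x \<in> h then SOME c. bracket x z = c *\<^sub>C z else 0)"
      have \<phi>: "bracket x z = \<phi> x *\<^sub>C z" if "x \<in> h" for x
        using someI_ex[OF ev[OF that]] that by (simp add: \<phi>_def)
      have inj: "c = d" if "c *\<^sub>C z = d *\<^sub>C z" for c d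
        using that False by simp
      have "\<phi> \<in> dual_on h"
        unfolding dual_on_def
      proof safe
        fix x y assume xy: "x \<in> h" "y \<in> h"
        then have "x + y \<in> h" by (rule lie.subspace_add[OF subspace_h])
        with xy have "\<phi> (x + y) *\<^sub>C z = (\<phi> x + \<phi> y) *\<^sub>C z"
          by (simp add: \<phi>[symmetric] bracket_add_left scaleC_add_left)
        then show "\<phi> (x + y) = \<phi> x + \<phi> y" by (rule inj)
      next
        fix c x assume x: "x \<in> h"
        then have "c *\<^sub>C x \<in> h" by (rule lie.subspace_scale[OF subspace_h])
        with x have "\<phi> (c *\<^sub>C x) *\<^sub>C z = (c * \<phi> x) *\<^sub>C z"
          unfolding scaleC_scaleC[symmetric] by (simp add: \<phi>[symmetric] bracket_scaleC_left)
        then show "\<phi> (c *\<^sub>C x) = c * \<phi> x" by (rule inj)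
      qed (simp add: \<phi>_def)
      moreover have "z \<in> \<gg> \<phi>" using \<phi> by (simp add: weight_space_def)
      ultimately show ?thesis
        using False by (auto simp: weights_def roots_def)
    qed
  qed
  then have "lie.span (\<Union>\<nu>. weight_space S \<nu>) \<subseteq> lie.span (\<Union>\<phi>\<in>weights. \<gg> \<phi>)"
    by (intro lie.span_mono) blast
  then show ?thesis using joint_eigenvectors_span[OF \<open>finite S\<close> S(1)] by blast
qed

lemma stable_components:
  assumes "finite F" "F \<subseteq> weights" "\<And>\<phi>. \<phi> \<in> F \<Longrightarrow> w \<phi> \<in> \<gg> \<phi>"
    and "lie.subspace W" "\<And>x z. x \<in> h \<Longrightarrow> z \<in> W \<Longrightarrow> bracket x z \<in> W"
    and "(\<Sum>\<phi>\<in>F. w \<phi>) \<in> W" "\<phi> \<in> F"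
  shows "w \<phi> \<in> W"
  by (rule weight_components[OF assms(1) _ assms(3-7)]) (use weights_separate assms(2) in blast)+

lemma weight_vectors_independent:
  assumes "finite F" "F \<subseteq> weights" "\<And>\<phi>. \<phi> \<in> F \<Longrightarrow> w \<phi> \<in> \<gg> \<phi>"
    and "(\<Sum>\<phi>\<in>F. w \<phi>) = 0" "\<phi> \<in> F"
  shows "w \<phi> = 0"
  using stable_components[where W = "{0}", OF assms(1-3)] assms(4,5) by simp

lemma weight_space_unique:
  assumes "\<phi> \<in> weights" "\<psi> \<in> weights" "z \<in> \<gg> \<phi>" "z \<in> \<gg> \<psi>" "z \<noteq> 0"
  shows "\<phi> = \<psi>"
proof (rule ccontr)
  assume "\<phi> \<noteq> \<psi>"
  then obtain x where "x \<in> h" "\<phi> x \<noteq> \<psi> x" using weights_separate assms by blast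
  moreover have "bracket x z = \<phi> x *\<^sub>C z" "bracket x z = \<psi> x *\<^sub>C z"
    using weight_spaceD assms(3,4) \<open>x \<in> h\<close> by blast+
  ultimately show False using assms(5) by simp
qed

lemma finite_independent_UN:
  assumes F: "finite F" "F \<subseteq> weights"
    and B: "\<And>\<phi>. \<phi> \<in> F \<Longrightarrow> B \<phi> \<subseteq> \<gg> \<phi>" "\<And>\<phi>. \<phi> \<in> F \<Longrightarrow> lie.independent (B \<phi>)"
  shows "lie.independent (\<Union>\<phi>\<in>F. B \<phi>)"
    and "\<phi> \<in> F \<Longrightarrow> \<psi> \<in> F \<Longrightarrow> \<phi> \<noteq> \<psi> \<Longrightarrow> B \<phi> \<inter> B \<psi> = {}"
proof -
  have disj: "B \<phi> \<inter> B \<psi> = {}" if "\<phi> \<in> F" "\<psi> \<in> F" "\<phi> \<noteq> \<psi>" for \<phi> \<psi>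
  proof (rule ccontr)
    assume "B \<phi> \<inter> B \<psi> \<noteq> {}"
    then obtain b where b: "b \<in> B \<phi>" "b \<in> B \<psi>" by blast
    then have "b \<noteq> 0" using B(2)[OF that(1)] lie.dependent_zero by auto
    then show False using weight_space_unique[of \<phi> \<psi> b] b that B(1) F(2) by blast
  qed
  then show "\<phi> \<in> F \<Longrightarrow> \<psi> \<in> F \<Longrightarrow> \<phi> \<noteq> \<psi> \<Longrightarrow> B \<phi> \<inter> B \<psi> = {}" .
  have finB: "finite (B \<phi>)" if "\<phi> \<in> F" for \<phi>
    using B(2)[OF that] by (rule lie.finiteI_independent)
  show "lie.independent (\<Union>\<phi>\<in>F. B \<phi>)"
  proof (rule lie.independent_if_scalars_zero)
    show "finite (\<Union>\<phi>\<in>F. B \<phi>)" using F finB by blast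
    fix u x assume u: "(\<Sum>x\<in>(\<Union>\<phi>\<in>F. B \<phi>). u x *\<^sub>C x) = 0" and x: "x \<in> (\<Union>\<phi>\<in>F. B \<phi>)"
    then obtain \<phi> where \<phi>: "\<phi> \<in> F" "x \<in> B \<phi>" by blast
    have "(\<Sum>\<phi>\<in>F. \<Sum>x\<in>B \<phi>. u x *\<^sub>C x) = 0"
      using u by (subst (asm) sum.UNION_disjoint) (use F finB disj in auto)
    then have "(\<Sum>x\<in>B \<phi>. u x *\<^sub>C x) = 0"
      by (rule weight_vectors_independent[OF F, where w = "\<lambda>\<phi>. \<Sum>x\<in>B \<phi>. u x *\<^sub>C x", rotated])
        (use \<phi> B(1) in \<open>auto intro!: lie.subspace_sum lie.subspace_scale subspace_weight_space\<close>)
    then show "u x = 0"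
      using lie.independentD[OF B(2)[OF \<phi>(1)] finB[OF \<phi>(1)] subset_refl _ \<phi>(2)] by blast
  qed
qed

text \<open>Root vectors, one for each root, are independent, so the dimension bounds the size of
  every finite set of roots.\<close>

lemma finite_roots: "finite (roots h)"
proof -
  have "\<exists>z. z \<in> \<gg> \<phi> \<and> z \<noteq> 0" if "\<phi> \<in> roots h" for \<phi>
    using that lie.subspace_0[OF subspace_weight_space, of h \<phi>] by (auto simp: roots_def)
  then obtain z where z: "\<And>\<phi>. \<phi> \<in> roots h \<Longrightarrow> z \<phi> \<in> \<gg> \<phi> \<and> z \<phi> \<noteq> 0"
    by metis
  have inj: "inj_on z (roots h)"
  proof (rule inj_onI)
    fix \<phi> \<psi> assume "\<phi> \<in> roots h" "\<psi> \<in> roots h" "z \<phi> = z \<psi>"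
    then show "\<phi> = \<psi>"
      using weight_space_unique[of \<phi> \<psi> "z \<phi>"] z[of \<phi>] z[of \<psi>] by (simp add: weights_def)
  qed
  have "card F \<le> lie.dim (UNIV :: 'g set)" if F: "finite F" "F \<subseteq> roots h" for F
  proof -
    have "lie.independent (\<Union>\<phi>\<in>F. {z \<phi>})"
      by (rule finite_independent_UN) (use F z in \<open>auto simp: weights_def\<close>)
    moreover have "(\<Union>\<phi>\<in>F. {z \<phi>}) = z ` F" by blast
    ultimately have "card (z ` F) \<le> lie.dim (UNIV :: 'g set)"
      by (intro lie.independent_card_le_dim) auto
    moreover have "card (z ` F) = card F" using inj F(2) by (metis card_image inj_on_subset)
    ultimately show ?thesis by simp
  qed
  then show ?thesis
    by (meson finite_if_finite_subsets_card_bdd)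
qed

lemma finite_weights: "finite weights"
  by (simp add: weights_def finite_roots)

lemma weight_decomposition:
  "\<exists>w. (\<forall>\<phi>\<in>weights. w \<phi> \<in> \<gg> \<phi>) \<and> z = (\<Sum>\<phi>\<in>weights. w \<phi>)"
proof -
  have "z \<in> lie.span (\<Union>\<phi>\<in>weights. \<gg> \<phi>)" using weight_spaces_span by simp
  from span_UN_subspaces[OF this subspace_weight_space] obtain F w where
    w: "finite F" "F \<subseteq> weights" "\<And>\<phi>. w \<phi> \<in> (if \<phi> \<in> F then \<gg> \<phi> else {0})" "z = (\<Sum>\<phi>\<in>F. w \<phi>)"
    by blast
  have "w \<phi> \<in> \<gg> \<phi>" for \<phi>
    using w(3)[of \<phi>] lie.subspace_0[OF subspace_weight_space] by (auto split: if_splits)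
  moreover have "w \<phi> = 0" if "\<phi> \<notin> F" for \<phi> using w(3)[of \<phi>] that by simp
  then have "(\<Sum>\<phi>\<in>F. w \<phi>) = (\<Sum>\<phi>\<in>weights. w \<phi>)"
    by (intro sum.mono_neutral_left) (use w(2) finite_weights in auto)
  ultimately show ?thesis using w(4) by blast
qed

lemma weight_decomposition_stable:
  assumes "lie.subspace W" "\<And>x z. x \<in> h \<Longrightarrow> z \<in> W \<Longrightarrow> bracket x z \<in> W" "z \<in> W"
  shows "\<exists>w. (\<forall>\<phi>\<in>weights. w \<phi> \<in> \<gg> \<phi> \<inter> W) \<and> z = (\<Sum>\<phi>\<in>weights. w \<phi>)"
proof -
  obtain w where w: "\<forall>\<phi>\<in>weights. w \<phi> \<in> \<gg> \<phi>" "z = (\<Sum>\<phi>\<in>weights. w \<phi>)"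
    using weight_decomposition by blast
  then have "w \<phi> \<in> W" if "\<phi> \<in> weights" for \<phi>
    by (intro stable_components[where w = w, OF finite_weights subset_refl _ assms(1,2) _ that])
      (use assms(3) in simp_all)
  with w show ?thesis by blast
qed

text \<open>\<open>U \<phi>\<close> may be a proper subspace of the weight space; this freedom is
  used when the space of a negative root is replaced by a line. The last conclusion computes the
  trace of any operator acting by a scalar on each \<open>U \<phi>\<close>.\<close>

lemma weight_basis:
  assumes F: "finite F" "F \<subseteq> weights"
    and U: "\<And>\<phi>. \<phi> \<in> F \<Longrightarrow> U \<phi> \<subseteq> \<gg> \<phi>" "\<And>\<phi>. \<phi> \<in> F \<Longrightarrow> lie.subspace (U \<phi>)"
  obtains C where "finite C" "lie.independent C" "C \<subseteq> (\<Union>\<phi>\<in>F. U \<phi>)" "(\<Union>\<phi>\<in>F. U \<phi>) \<subseteq> lie.span C"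
    and "\<And>T a. (\<And>\<phi> u. \<phi> \<in> F \<Longrightarrow> u \<in> U \<phi> \<Longrightarrow> T u = a \<phi> *\<^sub>C u) \<Longrightarrow>
      trace_on C T = (\<Sum>\<phi>\<in>F. a \<phi> * of_nat (lie.dim (U \<phi>)))"
proof -
  have "\<exists>B. B \<subseteq> U \<phi> \<and> lie.independent B \<and> lie.span B = U \<phi> \<and> card B = lie.dim (U \<phi>)" if "\<phi> \<in> F" for \<phi>
    using lie.basis_exists[of "U \<phi>"] U(2)[OF that] by (metis lie.span_subspace)
  then obtain B where B: "\<And>\<phi>. \<phi> \<in> F \<Longrightarrow> B \<phi> \<subseteq> U \<phi>" "\<And>\<phi>. \<phi> \<in> F \<Longrightarrow> lie.independent (B \<phi>)"
    "\<And>\<phi>. \<phi> \<in> F \<Longrightarrow> lie.span (B \<phi>) = U \<phi>" "\<And>\<phi>. \<phi> \<in> F \<Longrightarrow> card (B \<phi>) = lie.dim (U \<phi>)"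
    by metis
  define C where "C = (\<Union>\<phi>\<in>F. B \<phi>)"
  have finB: "finite (B \<phi>)" if "\<phi> \<in> F" for \<phi>
    using B(2)[OF that] by (rule lie.finiteI_independent)
  have BU: "B \<phi> \<subseteq> \<gg> \<phi>" if "\<phi> \<in> F" for \<phi> using B(1) U(1) that by blast
  have C: "finite C" "lie.independent C"
    unfolding C_def using finB F finite_independent_UN(1)[OF F BU B(2)] by auto
  show thesis
  proof
    show "finite C" "lie.independent C" by fact+
    show "C \<subseteq> (\<Union>\<phi>\<in>F. U \<phi>)" unfolding C_def using B(1) by blast
    have "U \<phi> \<subseteq> lie.span C" if "\<phi> \<in> F" for \<phi>
      using B(3)[OF that] that unfolding C_def by (metis UN_upper lie.span_mono)
    then show "(\<Union>\<phi>\<in>F. U \<phi>) \<subseteq> lie.span C" by blast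
    fix T and a :: "('g \<Rightarrow> complex) \<Rightarrow> complex"
    assume T: "\<And>\<phi> u. \<phi> \<in> F \<Longrightarrow> u \<in> U \<phi> \<Longrightarrow> T u = a \<phi> *\<^sub>C u"
    have "trace_on C T = (\<Sum>\<phi>\<in>F. \<Sum>b\<in>B \<phi>. lie.representation C (T b) b)"
      unfolding trace_on_def unfolding C_def
      by (rule sum.UNION_disjoint) (use F finB finite_independent_UN(2)[OF F BU B(2)] in auto)
    also have "\<dots> = (\<Sum>\<phi>\<in>F. a \<phi> * of_nat (lie.dim (U \<phi>)))"
    proof (rule sum.cong[OF refl])
      fix \<phi> assume \<phi>: "\<phi> \<in> F"
      have "lie.representation C (T b) b = a \<phi>" if b: "b \<in> B \<phi>" for b
      proof -
        have "T b = a \<phi> *\<^sub>C b" using T[OF \<phi>] B(1)[OF \<phi>] b by blast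
        moreover have "b \<in> C" using \<phi> b by (auto simp: C_def)
        ultimately show ?thesis
          using C(2) by (simp add: lie.representation_scale lie.representation_basis lie.span_base)
      qed
      then show "(\<Sum>b\<in>B \<phi>. lie.representation C (T b) b) = a \<phi> * of_nat (lie.dim (U \<phi>))"
        by (simp add: B(4)[OF \<phi>] mult.commute)
    qed
    finally show "trace_on C T = (\<Sum>\<phi>\<in>F. a \<phi> * of_nat (lie.dim (U \<phi>)))" .
  qed
qed

text \<open>On the span, ad [e, f] is a commutator of two operators that preserve it, hence has
  trace zero; as [e, f] lies in \<open>h\<close>, it acts on \<open>U \<phi>\<close> by the scalar
  \<phi>([e, f]). Later uses differ only in the choice of the stable span.\<close>

lemma trace_zero:
  assumes F: "finite F" "F \<subseteq> weights"
    and U: "\<And>\<phi>. \<phi> \<in> F \<Longrightarrow> U \<phi> \<subseteq> \<gg> \<phi>" "\<And>\<phi>. \<phi> \<in> F \<Longrightarrow> lie.subspace (U \<phi>)"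
    and e: "\<And>\<phi> u. \<phi> \<in> F \<Longrightarrow> u \<in> U \<phi> \<Longrightarrow> bracket e u \<in> lie.span (\<Union>\<phi>\<in>F. U \<phi>)"
    and f: "\<And>\<phi> u. \<phi> \<in> F \<Longrightarrow> u \<in> U \<phi> \<Longrightarrow> bracket f u \<in> lie.span (\<Union>\<phi>\<in>F. U \<phi>)"
    and ef: "bracket e f \<in> h"
  shows "(\<Sum>\<phi>\<in>F. \<phi> (bracket e f) * of_nat (lie.dim (U \<phi>))) = 0"
proof -
  obtain C where C: "finite C" "lie.independent C" "C \<subseteq> (\<Union>\<phi>\<in>F. U \<phi>)" "(\<Union>\<phi>\<in>F. U \<phi>) \<subseteq> lie.span C"
    and tr: "\<And>T a. (\<And>\<phi> u. \<phi> \<in> F \<Longrightarrow> u \<in> U \<phi> \<Longrightarrow> T u = a \<phi> *\<^sub>C u) \<Longrightarrow>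
      trace_on C T = (\<Sum>\<phi>\<in>F. a \<phi> * of_nat (lie.dim (U \<phi>)))"
    by (rule weight_basis[OF F U]) blast+
  have "lie.span (\<Union>\<phi>\<in>F. U \<phi>) \<subseteq> lie.span C" using C(4) by (rule lie.span_minimal) simp
  then have stable: "bracket x b \<in> lie.span C" if "b \<in> C" "x \<in> {e, f}" for x b
    using that e f C(3) by blast
  have s: "bracket x (bracket y b) \<in> lie.span C" if "b \<in> C" "x \<in> {e, f}" "y \<in> {e, f}" for x y b
    by (rule bracket_span_right[of _ C]) (use stable that in auto)
  have "trace_on C (bracket (bracket e f)) = trace_on C (\<lambda>z. bracket e (bracket f z)) - trace_on C (\<lambda>z. bracket f (bracket e z))"
    unfolding trace_on_def bracket_bracket_left sum_subtractf[symmetric]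
    by (rule sum.cong[OF refl]) (use s C(2) in \<open>simp add: lie.representation_diff\<close>)
  also have "\<dots> = 0"
    using trace_on_commute[OF C(1,2) linear_bracket _ linear_bracket] stable by simp
  finally have "trace_on C (bracket (bracket e f)) = 0" .
  moreover have "bracket (bracket e f) u = \<phi> (bracket e f) *\<^sub>C u" if "\<phi> \<in> F" "u \<in> U \<phi>" for \<phi> u
    using U(1) that ef weight_spaceD by blast
  ultimately show ?thesis using tr[of "bracket (bracket e f)" "\<lambda>\<phi>. \<phi> (bracket e f)"] by simp
qed

lemma killing_form_h:
  assumes "x \<in> h" "y \<in> h"
  shows "killing_form x y = (\<Sum>\<phi>\<in>weights. \<phi> x * \<phi> y * of_nat (lie.dim (\<gg> \<phi>)))"
proof -
  let ?U = "\<gg>"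
  obtain C where C: "finite C" "lie.independent C" "C \<subseteq> (\<Union>\<phi>\<in>weights. ?U \<phi>)"
    "(\<Union>\<phi>\<in>weights. ?U \<phi>) \<subseteq> lie.span C"
    and tr: "\<And>T a. (\<And>\<phi> u. \<phi> \<in> weights \<Longrightarrow> u \<in> ?U \<phi> \<Longrightarrow> T u = a \<phi> *\<^sub>C u) \<Longrightarrow>
      trace_on C T = (\<Sum>\<phi>\<in>weights. a \<phi> * of_nat (lie.dim (?U \<phi>)))"
    by (rule weight_basis[OF finite_weights subset_refl subset_refl subspace_weight_space]) blast+
  have "lie.span (\<Union>\<phi>\<in>weights. ?U \<phi>) \<subseteq> lie.span C" using C(4) by (rule lie.span_minimal) simp
  then have "lie.span C = UNIV" using weight_spaces_span by auto
  with C have "killing_form x y = trace_on C (\<lambda>z. bracket x (bracket y z))"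
    by (intro killing_form_trace_on)
  also have "\<dots> = (\<Sum>\<phi>\<in>weights. \<phi> x * \<phi> y * of_nat (lie.dim (?U \<phi>)))"
    by (rule tr) (use assms in \<open>simp add: weight_spaceD bracket_scaleC_right mult.commute\<close>)
  finally show ?thesis .
qed

lemma killing_form_orthogonal:
  assumes "x \<in> \<gg> \<phi>" "y \<in> \<gg> \<psi>" "v \<in> h" "\<phi> v + \<psi> v \<noteq> 0"
  shows "killing_form x y = 0"
proof -
  have "killing_form (bracket v x) y = - killing_form x (bracket v y)"
    using killing_form_invariant[of x v y] bracket_skew[of v x] killing_form_diff_left[of 0 "bracket x v" y]
    by simp
  then have "(\<phi> v + \<psi> v) * killing_form x y = 0"
    using assms by (simp add: weight_spaceD killing_form_scale_left killing_form_scale_right algebra_simps)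
  then show ?thesis using assms(4) by simp
qed

end

section \<open>Nondegeneracy of the Killing form\<close>

text \<open>Here \<open>\<Omega>\<close> is a set closed under brackets, in the manner of Jacobson's
  theorem on weakly closed sets: nilpotency is then asked of root vectors and not of their sums.
  \<open>X\<close> and \<open>U\<close> stand for the quotient X/U, in which \<open>v\<close> is a
  nonzero vector annihilated by \<open>\<Omega>\<close>.\<close>

lemma engel:
  fixes \<Omega> X U :: "'a::complex_lie_algebra set"
  assumes "\<And>a b. a \<in> \<Omega> \<Longrightarrow> b \<in> \<Omega> \<Longrightarrow> bracket a b \<in> \<Omega>"
    and "\<And>a z. a \<in> \<Omega> \<Longrightarrow> \<exists>k. (bracket a ^^ k) z = 0"
    and "\<And>a x. a \<in> \<Omega> \<Longrightarrow> x \<in> X \<Longrightarrow> bracket a x \<in> X"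
    and "lie.subspace U" "\<And>a x. a \<in> \<Omega> \<Longrightarrow> x \<in> U \<Longrightarrow> bracket a x \<in> U"
    and "\<not> X \<subseteq> U"
  shows "\<exists>v\<in>X - U. \<forall>a\<in>\<Omega>. bracket a v \<in> U"
  using assms
proof (induction "lie.dim \<Omega>" arbitrary: \<Omega> X U rule: less_induct)
  case less
  note closed = less.prems(1) and nil = less.prems(2) and X = less.prems(3)
    and U = less.prems(4,5) and XU = less.prems(6)
  show ?case
  proof (cases "\<Omega> \<subseteq> {0}")
    case True
    then have "bracket a x \<in> U" if "a \<in> \<Omega>" for a x
      using that lie.subspace_0[OF U(1)] by auto
    then show ?thesis using XU by blast
  next
    case False
    \<comment> \<open>A closed subset of largest dimension below that of \<open>\<Omega>\<close>
      plays the part of a maximal proper subalgebra.\<close>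
    define P where "P = (\<lambda>\<Omega>'. \<Omega>' \<subseteq> \<Omega> \<and> (\<forall>a\<in>\<Omega>'. \<forall>b\<in>\<Omega>'. bracket a b \<in> \<Omega>') \<and> lie.dim \<Omega>' < lie.dim \<Omega>)"
    have "lie.dim \<Omega> \<noteq> 0"
      using False by (metis lie.dim_eq_0)
    then have "P {}" by (simp add: P_def del: lie.dim_eq_0)
    moreover have "\<forall>\<Omega>'. P \<Omega>' \<longrightarrow> lie.dim \<Omega>' < lie.dim \<Omega>" by (simp add: P_def)
    ultimately have "\<exists>\<Omega>'. P \<Omega>' \<and> (\<forall>\<Omega>''. P \<Omega>'' \<longrightarrow> lie.dim \<Omega>'' \<le> lie.dim \<Omega>')"
      by (rule Lattices_Big.ex_has_greatest_nat)
    then obtain \<Omega>' where \<Omega>': "P \<Omega>'" "\<And>\<Omega>''. P \<Omega>'' \<Longrightarrow> lie.dim \<Omega>'' \<le> lie.dim \<Omega>'"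
      by blast
    let ?A = "lie.span \<Omega>'"
    have sub: "\<Omega>' \<subseteq> \<Omega>" and cl': "\<And>a b. a \<in> \<Omega>' \<Longrightarrow> b \<in> \<Omega>' \<Longrightarrow> bracket a b \<in> \<Omega>'"
      and dim': "lie.dim \<Omega>' < lie.dim \<Omega>"
      using \<Omega>'(1) by (auto simp: P_def)
    have A_stable: "bracket a x \<in> ?A" if "a \<in> \<Omega>'" "x \<in> ?A" for a x
      by (rule bracket_span_right[OF _ _ that(2)]) (use cl' that(1) in \<open>auto intro: lie.span_base\<close>)
    have "\<not> \<Omega> \<subseteq> ?A"
    proof
      assume "\<Omega> \<subseteq> ?A"
      then have "lie.dim \<Omega> \<le> lie.dim ?A" by (rule lie.dim_subset)
      then show False using dim' by simp
    qed
    \<comment> \<open>The induction hypothesis for the action of \<open>\<Omega>'\<close> on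
      \<open>\<Omega>\<close> modulo its span yields an element normalizing that span.\<close>
    then have "\<exists>v\<in>\<Omega> - ?A. \<forall>a\<in>\<Omega>'. bracket a v \<in> ?A"
      by (intro less.hyps dim') (use sub cl' nil closed A_stable in auto)
    then obtain v where v: "v \<in> \<Omega>" "v \<notin> ?A" "\<And>a. a \<in> \<Omega>' \<Longrightarrow> bracket a v \<in> ?A" by blast
    let ?A' = "lie.span (insert v \<Omega>')"
    have AA': "?A \<subseteq> ?A'" by (rule lie.span_mono) blast
    have gen: "bracket a b \<in> ?A'" if "a \<in> insert v \<Omega>'" "b \<in> insert v \<Omega>'" for a b
    proof -
      have "bracket a v \<in> ?A'" if "a \<in> \<Omega>'" for a using v(3)[OF that] AA' by blast
      moreover from this have "bracket v a \<in> ?A'" if "a \<in> \<Omega>'" for a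
        using that by (subst bracket_skew) (simp add: lie.span_neg)
      moreover have "bracket a b \<in> ?A'" if "a \<in> \<Omega>'" "b \<in> \<Omega>'" for a b
        using cl'[OF that] by (simp add: lie.span_base)
      ultimately show ?thesis using that by (auto simp: bracket_self lie.span_zero)
    qed
    have "bracket a b \<in> ?A'" if "a \<in> ?A'" "b \<in> insert v \<Omega>'" for a b
      by (rule bracket_span_left[OF _ _ that(1)]) (use gen that(2) in auto)
    then have A'_closed: "bracket a b \<in> ?A'" if "a \<in> ?A'" "b \<in> ?A'" for a b
      by (intro bracket_span_right[OF _ _ that(2)]) (use that(1) in auto)
    \<comment> \<open>By maximality, \<open>v\<close> and \<open>\<Omega>'\<close> together span
      \<open>\<Omega>\<close>. So once \<open>\<Omega>'\<close> acts by zero modulo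
      \<open>U\<close>, only the action of \<open>v\<close> is left to treat.\<close>
    have \<Omega>A': "\<Omega> \<subseteq> ?A'"
    proof -
      let ?\<Omega> = "\<Omega> \<inter> ?A'"
      have "insert v \<Omega>' \<subseteq> ?\<Omega>" using v(1) sub by (auto intro: lie.span_base)
      then have "lie.dim (insert v \<Omega>') \<le> lie.dim ?\<Omega>" by (rule lie.dim_subset)
      then have "lie.dim \<Omega>' < lie.dim ?\<Omega>" using v(2) by (simp add: lie.dim_insert)
      then have "\<not> P ?\<Omega>" using \<Omega>'(2)[of ?\<Omega>] by auto
      then have "lie.dim \<Omega> \<le> lie.dim ?\<Omega>" using closed A'_closed by (auto simp: P_def)
      then have "lie.span ?\<Omega> = lie.span \<Omega>" by (intro lie.dim_eq_span) auto
      moreover have "lie.span ?\<Omega> \<subseteq> ?A'" by (rule lie.span_minimal) auto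
      ultimately show ?thesis using lie.span_superset by blast
    qed
    have "\<exists>y\<in>X - U. \<forall>a\<in>\<Omega>'. bracket a y \<in> U"
      by (intro less.hyps dim') (use sub cl' nil X U XU in auto)
    then obtain y where y: "y \<in> X" "y \<notin> U" "\<And>a. a \<in> \<Omega>' \<Longrightarrow> bracket a y \<in> U" by blast
    have iter: "(bracket v ^^ j) y \<in> X \<and> (\<forall>a\<in>\<Omega>'. bracket a ((bracket v ^^ j) y) \<in> U)" for j
    proof (induction j)
      case 0
      then show ?case using y by simp
    next
      case (Suc j)
      let ?z = "(bracket v ^^ j) y"
      have "bracket a (bracket v ?z) \<in> U" if a: "a \<in> \<Omega>'" for a
      proof -
        have "bracket a (bracket v ?z) = bracket (bracket a v) ?z + bracket v (bracket a ?z)"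
          by (simp add: bracket_bracket_left)
        moreover have "bracket (bracket a v) ?z \<in> U"
          by (rule bracket_span_left[OF U(1) _ v(3)[OF a]]) (use Suc in auto)
        moreover have "bracket v (bracket a ?z) \<in> U" using Suc a v(1) U by auto
        ultimately show ?thesis using lie.subspace_add[OF U(1)] by simp
      qed
      then show ?case using Suc X v(1) by auto
    qed
    have "\<exists>k. (bracket v ^^ k) y \<in> U"
      using nil[OF v(1), of y] lie.subspace_0[OF U(1)] by metis
    \<comment> \<open>The first power of ad v that carries \<open>y\<close> into \<open>U\<close>;
      the vector sought is the iterate just before it.\<close>
    define k where "k = (LEAST k. (bracket v ^^ k) y \<in> U)"
    have k: "(bracket v ^^ k) y \<in> U"
      unfolding k_def by (rule LeastI_ex) fact
    then obtain j where j: "k = Suc j" using y(2) by (cases k) auto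
    let ?z = "(bracket v ^^ j) y"
    have "?z \<notin> U" using not_less_Least[of j "\<lambda>k. (bracket v ^^ k) y \<in> U"] j unfolding k_def by simp
    moreover have "bracket a ?z \<in> U" if "a \<in> \<Omega>" for a
      by (rule bracket_span_left[of _ "insert v \<Omega>'"])
        (use U(1) iter[of j] k j that \<Omega>A' in auto)
    ultimately show ?thesis using iter[of j] by blast
  qed
qed

context cartan
begin

section \<open>Root strings and traces along them\<close>

lemma weight_space_trivial: "\<phi> \<in> dual_on h \<Longrightarrow> \<phi> \<notin> weights \<Longrightarrow> \<gg> \<phi> = {0}"
  by (auto simp: weights_def roots_def)

lemma dual_on_closed:
  assumes "\<phi> \<in> dual_on V" "\<psi> \<in> dual_on V"
  shows "\<phi> + \<psi> \<in> dual_on V" "- \<phi> \<in> dual_on V" "(\<lambda>x. c * \<phi> x) \<in> dual_on V"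
  using assms by (auto simp: dual_on_def algebra_simps)

lemma roots_weights: "\<phi> \<in> roots h \<Longrightarrow> \<phi> \<in> weights"
  by (simp add: weights_def)

lemma root_nonzero: "\<phi> \<in> roots h \<Longrightarrow> \<exists>x\<in>h. \<phi> x \<noteq> 0"
  using weights_separate[of \<phi> 0] by (auto simp: weights_def roots_def)

lemma bracket_opposite:
  "e \<in> \<gg> \<phi> \<Longrightarrow> f \<in> \<gg> (- \<phi>) \<Longrightarrow> bracket e f \<in> h"
  using bracket_weight_space[of e h \<phi> f "- \<phi>"] weight_space_0 by simp

definition root_string :: "('g \<Rightarrow> complex) \<Rightarrow> ('g \<Rightarrow> complex) \<Rightarrow> int \<Rightarrow> 'g \<Rightarrow> complex" where
  "root_string \<psi> \<phi> k = (\<lambda>x. \<psi> x + of_int k * \<phi> x)"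

lemma root_string_0 [simp]: "root_string \<psi> \<phi> 0 = \<psi>"
  by (simp add: root_string_def)

lemma root_string_add: "\<phi> + root_string \<psi> \<phi> k = root_string \<psi> \<phi> (k + 1)"
  and root_string_diff: "- \<phi> + root_string \<psi> \<phi> k = root_string \<psi> \<phi> (k - 1)"
  by (auto simp: root_string_def algebra_simps fun_eq_iff)

lemma root_string_dual: "\<psi> \<in> dual_on h \<Longrightarrow> \<phi> \<in> dual_on h \<Longrightarrow> root_string \<psi> \<phi> k \<in> dual_on h"
  by (auto simp: root_string_def dual_on_def algebra_simps)

lemma root_string_inj: "\<phi> \<in> roots h \<Longrightarrow> root_string \<psi> \<phi> j = root_string \<psi> \<phi> k \<Longrightarrow> j = k"
  using root_nonzero[of \<phi>] by (auto simp: root_string_def fun_eq_iff)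

lemma finite_root_string: "\<phi> \<in> roots h \<Longrightarrow> finite {k. root_string \<psi> \<phi> k \<in> weights}"
  using finite_vimageI[OF finite_weights, of "root_string \<psi> \<phi>"] root_string_inj[of \<phi> \<psi>]
  by (auto simp: vimage_def inj_def)

text \<open>\<open>K\<close> may be a truncated string, provided that \<open>e\<close> and
  \<open>f\<close> do not lead out of it; the sign arguments below cut strings where one of them
  acts by zero.\<close>

lemma root_string_trace:
  assumes \<phi>: "\<phi> \<in> roots h" and e: "e \<in> \<gg> \<phi>" and f: "f \<in> \<gg> (- \<phi>)"
    and K: "finite K" "\<And>k. k \<in> K \<Longrightarrow> root_string \<psi> \<phi> k \<in> weights"
    and up: "\<And>k z. k \<in> K \<Longrightarrow> k + 1 \<notin> K \<Longrightarrow> z \<in> \<gg> (root_string \<psi> \<phi> k) \<Longrightarrow> bracket e z = 0"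
    and down: "\<And>k z. k \<in> K \<Longrightarrow> k - 1 \<notin> K \<Longrightarrow> z \<in> \<gg> (root_string \<psi> \<phi> k) \<Longrightarrow> bracket f z = 0"
  shows "(\<Sum>k\<in>K. (\<psi> (bracket e f) + of_int k * \<phi> (bracket e f)) *
            of_nat (lie.dim (\<gg> (root_string \<psi> \<phi> k)))) = 0"
proof -
  let ?s = "root_string \<psi> \<phi>"
  have "(\<Sum>\<chi>\<in>?s ` K. \<chi> (bracket e f) * of_nat (lie.dim (\<gg> \<chi>))) = 0"
  proof (rule trace_zero)
    show "lie.subspace (\<gg> \<chi>)" for \<chi> by (rule subspace_weight_space)
    show "bracket e f \<in> h" using bracket_opposite e f by blast
    fix \<chi> u assume "\<chi> \<in> ?s ` K" and u: "u \<in> \<gg> \<chi>"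
    then obtain k where k: "k \<in> K" "\<chi> = ?s k" by blast
    have "bracket e u \<in> \<gg> (?s (k + 1))" "bracket f u \<in> \<gg> (?s (k - 1))"
      using bracket_weight_space[OF e u] bracket_weight_space[OF f u]
      unfolding k(2) root_string_add root_string_diff by auto
    moreover have "bracket e u = 0" if "k + 1 \<notin> K" using up[OF k(1) that] u k(2) by simp
    moreover have "bracket f u = 0" if "k - 1 \<notin> K" using down[OF k(1) that] u k(2) by simp
    ultimately show "bracket e u \<in> lie.span (\<Union>\<chi>\<in>?s ` K. \<gg> \<chi>)"
        "bracket f u \<in> lie.span (\<Union>\<chi>\<in>?s ` K. \<gg> \<chi>)"
      by (metis UN_I imageI lie.span_base lie.span_zero)+
  qed (use K in auto)
  then show ?thesis
    by (subst (asm) sum.reindex)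
      (use root_string_inj[OF \<phi>] in \<open>auto simp: inj_on_def root_string_def\<close>)
qed

lemma dim_weight_space_pos: "\<phi> \<in> roots h \<Longrightarrow> lie.dim (\<gg> \<phi>) > 0"
  using lie.dim_eq_0[of "\<gg> \<phi>"] lie.subspace_0[OF subspace_weight_space, of h \<phi>]
  by (auto simp: roots_def)

text \<open>The trace over the full string gives S \<psi>([e, f]) = - N \<phi>([e, f]), where S is
  the total dimension and N the sum of k times the k-th dimension. S is positive because a nonzero
  \<psi> itself contributes.\<close>

lemma real_ratio_on_brackets:
  assumes \<phi>: "\<phi> \<in> roots h" and e: "e \<in> \<gg> \<phi>" and f: "f \<in> \<gg> (- \<phi>)"
    and \<psi>: "\<psi> \<in> weights"
  shows "\<exists>r :: real. \<psi> (bracket e f) = of_real r * \<phi> (bracket e f)"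
proof (cases "\<psi> = 0")
  case True
  then show ?thesis by (intro exI[of _ 0]) simp
next
  case False
  let ?K = "{k. root_string \<psi> \<phi> k \<in> weights}"
  let ?d = "\<lambda>k. real (lie.dim (\<gg> (root_string \<psi> \<phi> k)))"
  have dual: "\<phi> \<in> dual_on h" "\<psi> \<in> dual_on h" using \<phi> \<psi> weights_dual roots_weights by auto
  have triv: "z = 0" if "k \<notin> ?K" "z \<in> \<gg> (root_string \<psi> \<phi> k)" for k z
    using weight_space_trivial[OF root_string_dual[OF dual(2,1)]] that by auto
  have "(\<Sum>k\<in>?K. (\<psi> (bracket e f) + of_int k * \<phi> (bracket e f)) * of_real (?d k)) = 0"
    unfolding of_real_of_nat_eq
  proof (rule root_string_trace[OF \<phi> e f finite_root_string[OF \<phi>]])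
    fix k z assume "z \<in> \<gg> (root_string \<psi> \<phi> k)"
    then have "bracket e z \<in> \<gg> (root_string \<psi> \<phi> (k + 1))"
      "bracket f z \<in> \<gg> (root_string \<psi> \<phi> (k - 1))"
      using bracket_weight_space[OF e] bracket_weight_space[OF f]
      by (metis root_string_add, metis root_string_diff)
    then show "k + 1 \<notin> ?K \<Longrightarrow> bracket e z = 0" "k - 1 \<notin> ?K \<Longrightarrow> bracket f z = 0"
      using triv by blast+
  qed auto
  then have "\<psi> (bracket e f) * of_real (sum ?d ?K)
      = - of_real (\<Sum>k\<in>?K. of_int k * ?d k) * \<phi> (bracket e f)"
    by (simp add: algebra_simps sum.distrib sum_distrib_left eq_neg_iff_add_eq_0)
  moreover have "sum ?d ?K \<noteq> 0"
  proof -
    have "0 \<in> ?K" using \<psi> by simp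
    moreover have "?d 0 > 0" using False \<psi> dim_weight_space_pos by (simp add: weights_def)
    ultimately have "sum ?d ?K > 0"
      by (intro sum_pos2[OF finite_root_string[OF \<phi>], of 0]) auto
    then show ?thesis by simp
  qed
  moreover have "a = of_real (- N / S) * b" if "a * of_real S = - of_real N * b" "S \<noteq> 0"
    for a b :: complex and N S
    using that by (simp add: field_simps)
  ultimately have "\<psi> (bracket e f) = of_real (- (\<Sum>k\<in>?K. of_int k * ?d k) / sum ?d ?K) * \<phi> (bracket e f)"
    by blast
  then show ?thesis by blast
qed

text \<open>Each application of ad e moves one step up a string, and strings are finite. The vectors
  annihilated by some power form a subspace, so weight vectors suffice.\<close>

lemma ad_nilpotent:
  assumes \<phi>: "\<phi> \<in> roots h" and e: "e \<in> \<gg> \<phi>"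
  shows "\<exists>k. (bracket e ^^ k) z = 0"
proof -
  have lin: "Vector_Spaces.linear scaleC scaleC (bracket e ^^ k)" for k
  proof (induction k)
    case 0
    then show ?case using lie.linear_id by (simp add: id_def)
  next
    case (Suc k)
    show ?case unfolding funpow.simps
      by (rule Vector_Spaces.linear_compose[OF Suc linear_bracket])
  qed
  have mono: "(bracket e ^^ (j + k)) z = 0" if "(bracket e ^^ k) z = 0" for j k z
    using that by (induction j) simp_all
  let ?N = "{z. \<exists>k. (bracket e ^^ k) z = 0}"
  have "lie.subspace ?N"
  proof (rule lie.subspaceI)
    show "0 \<in> ?N" by (auto intro: exI[of _ 0])
  next
    fix x y assume "x \<in> ?N" "y \<in> ?N"
    then obtain j k where "(bracket e ^^ j) x = 0" "(bracket e ^^ k) y = 0" by blast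
    then have "(bracket e ^^ (k + j)) x = 0" "(bracket e ^^ (k + j)) y = 0"
      using mono[of j x k] mono[of k y j] by (simp_all add: add.commute)
    then have "(bracket e ^^ (k + j)) (x + y) = 0"
      using lin[of "k + j"] by (simp add: Vector_Spaces.linear_iff)
    then show "x + y \<in> ?N" by blast
  next
    fix c x assume "x \<in> ?N"
    then obtain k where "(bracket e ^^ k) x = 0" by blast
    then have "(bracket e ^^ k) (c *\<^sub>C x) = 0"
      using lin[of k] by (simp add: Vector_Spaces.linear_iff)
    then show "c *\<^sub>C x \<in> ?N" by blast
  qed
  moreover have "\<gg> \<psi> \<subseteq> ?N" if \<psi>: "\<psi> \<in> weights" for \<psi>
  proof
    fix z assume z: "z \<in> \<gg> \<psi>"
    have "\<exists>k. int k \<notin> {k. root_string \<psi> \<phi> k \<in> weights}"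
      using finite_root_string[OF \<phi>, of \<psi>] infinite_UNIV_nat finite_vimageI[of _ int]
      by (metis UNIV_eq_I inj_of_nat vimage_eq)
    then obtain k where k: "root_string \<psi> \<phi> (int k) \<notin> weights" by blast
    have "(bracket e ^^ j) z \<in> \<gg> (root_string \<psi> \<phi> (int j))" for j
    proof (induction j)
      case 0
      then show ?case using z by simp
    next
      case (Suc j)
      show ?case using bracket_weight_space[OF e Suc] by (simp add: root_string_add add.commute)
    qed
    moreover have "\<gg> (root_string \<psi> \<phi> (int k)) = {0}"
      using k \<phi> \<psi> weights_dual roots_weights by (intro weight_space_trivial root_string_dual) auto
    ultimately show "z \<in> ?N" by blast
  qed
  ultimately have "lie.span (\<Union>\<psi>\<in>weights. \<gg> \<psi>) \<subseteq> ?N"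
    by (intro lie.span_minimal) auto
  then show ?thesis using weight_spaces_span by auto
qed

end

locale semisimple_cartan = cartan h for h :: "'g::complex_lie_algebra set" +
  assumes semisimple: "lie_semisimple (UNIV :: 'g set)"
begin

text \<open>The point of contact with the definition of semisimplicity: all later arguments use it
  as the absence of nonzero abelian ideals.\<close>

lemma abelian_ideal_trivial:
  assumes "lie_ideal I (UNIV :: 'g set)" "lie_abelian I"
  shows "I = {0}"
proof -
  have "0 \<in> I" using assms(1) by (simp add: lie_ideal_def lie.subspace_0)
  then have "{bracket x y |x y. x \<in> I \<and> y \<in> I} = {0}"
    using assms(2) by (auto simp: lie_abelian_def) (metis bracket_zero_left)
  then have "derived_series I 1 = {0}"
    by (simp add: bracket_span_def)
  then have "lie_solvable I" unfolding lie_solvable_def by blast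
  then show ?thesis using assms(1) semisimple by (simp add: lie_semisimple_def)
qed

lemma center_trivial:
  assumes "\<And>z. bracket x z = 0"
  shows "x = (0 :: 'g)"
proof -
  let ?Z = "{x :: 'g. \<forall>z. bracket x z = 0}"
  have "bracket y x = 0" if "x \<in> ?Z" for x y :: 'g
    using that bracket_skew[of y x] by simp
  then have "lie_ideal ?Z UNIV"
    by (auto simp: lie_ideal_def lie.subspace_def bracket_add_left bracket_scaleC_left)
  then have "?Z = {0}"
    by (rule abelian_ideal_trivial) (auto simp: lie_abelian_def)
  then show ?thesis using assms by blast
qed

text \<open>Such an \<open>x\<close> acts by zero on every weight space, hence is central.\<close>

lemma h_eq_0I:
  assumes x: "x \<in> h" and "\<And>\<phi>. \<phi> \<in> roots h \<Longrightarrow> \<phi> x = 0"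
  shows "x = 0"
proof (rule center_trivial)
  fix z
  have "bracket x z \<in> {0}"
  proof (rule bracket_span_right)
    show "z \<in> lie.span (\<Union>\<phi>\<in>weights. \<gg> \<phi>)" using weight_spaces_span by simp
    fix a assume "a \<in> (\<Union>\<phi>\<in>weights. \<gg> \<phi>)"
    then obtain \<phi> where "\<phi> \<in> weights" "a \<in> \<gg> \<phi>" by blast
    then show "bracket x a \<in> {0}"
      using assms by (auto simp: weight_spaceD weights_def)
  qed simp
  then show "bracket x z = 0" by simp
qed

lemma bracket_eq_0I:
  assumes "\<phi> \<in> roots h" "e \<in> \<gg> \<phi>" "f \<in> \<gg> (- \<phi>)" "\<phi> (bracket e f) = 0"
  shows "bracket e f = 0"
proof (rule h_eq_0I)
  show "bracket e f \<in> h" using assms bracket_opposite by blast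
  show "\<psi> (bracket e f) = 0" if "\<psi> \<in> roots h" for \<psi>
    using real_ratio_on_brackets[OF assms(1-3) roots_weights[OF that]] assms(4) by auto
qed

definition killing_radical :: "'g set" where
  "killing_radical = {x. \<forall>y. killing_form x y = 0}"

lemma subspace_killing_radical: "lie.subspace killing_radical"
  by (auto simp: lie.subspace_def killing_radical_def killing_form_add_left killing_form_scale_left)

lemma killing_radical_ideal: "x \<in> killing_radical \<Longrightarrow> bracket z x \<in> killing_radical"
  using killing_form_invariant[of x z] bracket_skew[of z x] killing_form_diff_left[of 0 "bracket x z"]
  by (simp add: killing_radical_def)

text \<open>Put x = [e, f]. The radical is an ideal, so \<open>killing_form x x = 0\<close>. Every
  weight takes at x a real multiple r of \<phi>(x), so this value is \<phi>(x) squared times the sum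
  of the squares of the r, weighted by dimensions. The weight \<phi> has r = 1, which forces
  \<phi>(x) = 0.\<close>

lemma bracket_killing_radical:
  assumes \<phi>: "\<phi> \<in> roots h" and e: "e \<in> \<gg> \<phi>" "e \<in> killing_radical"
    and f: "f \<in> \<gg> (- \<phi>)"
  shows "bracket e f = 0"
proof (rule bracket_eq_0I[OF \<phi> e(1) f], rule ccontr)
  let ?x = "bracket e f"
  assume nz: "\<phi> ?x \<noteq> 0"
  have xh: "?x \<in> h" using bracket_opposite e f by blast
  have "?x \<in> killing_radical"
    using killing_radical_ideal[OF e(2), of f] bracket_skew[of e f]
      lie.subspace_neg[OF subspace_killing_radical] by simp
  then have "killing_form ?x ?x = 0" by (simp add: killing_radical_def)
  moreover obtain r :: "('g \<Rightarrow> complex) \<Rightarrow> real" where r: "\<And>\<psi>. \<psi> \<in> weights \<Longrightarrow> \<psi> ?x = of_real (r \<psi>) * \<phi> ?x"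
    using real_ratio_on_brackets[OF \<phi> e(1) f] by metis
  let ?d = "\<lambda>\<psi>. real (lie.dim (\<gg> \<psi>))"
  have "killing_form ?x ?x = (\<phi> ?x)\<^sup>2 * of_real (\<Sum>\<psi>\<in>weights. (r \<psi>)\<^sup>2 * ?d \<psi>)"
    unfolding killing_form_h[OF xh xh] of_real_sum sum_distrib_left
    by (rule sum.cong) (simp_all add: r power2_eq_square)
  ultimately have "(\<Sum>\<psi>\<in>weights. (r \<psi>)\<^sup>2 * ?d \<psi>) = 0"
    using nz by (simp only: mult_eq_0_iff of_real_eq_0_iff power_eq_0_iff) simp
  then have "(r \<phi>)\<^sup>2 * ?d \<phi> = 0"
    using sum_nonneg_eq_0_iff[OF finite_weights, of "\<lambda>\<psi>. (r \<psi>)\<^sup>2 * ?d \<psi>"] roots_weights[OF \<phi>] by simp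
  moreover have "r \<phi> = 1" using r[OF roots_weights[OF \<phi>]] nz by simp
  ultimately show False using dim_weight_space_pos[OF \<phi>] by (simp del: lie.dim_eq_0)
qed

text \<open>If the claim failed, Engel would produce a nonzero element commuting with all root
  vectors in the radical; the centre of the ideal they span would then be a nonzero abelian
  ideal.\<close>

lemma killing_radical_root_part:
  assumes "\<phi> \<in> roots h" "x \<in> killing_radical" "x \<in> \<gg> \<phi>"
  shows "x = 0"
proof -
  \<comment> \<open>Only homogeneous elements of nonzero weight, and 0, so that each one is
    ad-nilpotent. Brackets never acquire a component in \<open>h\<close>, because those of opposite
    weights vanish by \<open>bracket_killing_radical\<close>.\<close>
  define \<Omega> where "\<Omega> = insert 0 (\<Union>\<phi>\<in>roots h. killing_radical \<inter> \<gg> \<phi>)"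
  have closed: "bracket z x \<in> \<Omega>" if z: "\<psi> \<in> weights" "z \<in> \<gg> \<psi>" and "x \<in> \<Omega>" for \<psi> z x
  proof (cases "x = 0")
    case True
    then show ?thesis by (simp add: \<Omega>_def)
  next
    case False
    then obtain \<phi> where x: "\<phi> \<in> roots h" "x \<in> killing_radical" "x \<in> \<gg> \<phi>"
      using \<open>x \<in> \<Omega>\<close> by (auto simp: \<Omega>_def)
    have zx: "bracket z x \<in> killing_radical" "bracket z x \<in> \<gg> (\<psi> + \<phi>)"
      using killing_radical_ideal[OF x(2)] bracket_weight_space[OF z(2) x(3)] by auto
    show ?thesis
    proof (cases "\<psi> + \<phi> \<in> roots h")
      case True
      then show ?thesis using zx by (auto simp: \<Omega>_def)
    next
      case nr: False
      show ?thesis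
      proof (cases "\<psi> + \<phi> = 0")
        case True
        then have "\<psi> = - \<phi>" by (simp only: eq_neg_iff_add_eq_0)
        then have "z \<in> \<gg> (- \<phi>)" using z(2) by simp
        then have "bracket x z = 0" by (rule bracket_killing_radical[OF x(1,3,2)])
        then show ?thesis using bracket_skew[of z x] by (simp add: \<Omega>_def)
      next
        case False
        then have "\<psi> + \<phi> \<notin> weights" using nr by (simp add: weights_def)
        moreover have "\<psi> + \<phi> \<in> dual_on h"
          using z(1) x(1) roots_weights weights_dual dual_on_closed(1) by blast
        ultimately have "bracket z x = 0" using weight_space_trivial zx by blast
        then show ?thesis by (simp add: \<Omega>_def)
      qed
    qed
  qed
  have homog: "\<exists>\<psi>\<in>roots h. z \<in> \<gg> \<psi>" if "z \<in> \<Omega>" "z \<noteq> 0" for z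
    using that by (auto simp: \<Omega>_def)
  have zero: "0 \<in> \<Omega>" by (simp add: \<Omega>_def)
  have closed': "bracket z x \<in> \<Omega>" if z: "z \<in> \<Omega>" and x: "x \<in> \<Omega>" for z x
  proof (cases "z = 0")
    case False
    then obtain \<psi> where "\<psi> \<in> roots h" "z \<in> \<gg> \<psi>" using homog z by blast
    then show ?thesis using closed roots_weights x by blast
  qed (simp add: zero)
  have ideal: "bracket z x \<in> lie.span \<Omega>" if "x \<in> lie.span \<Omega>" for z x
  proof (rule bracket_span_right[OF _ _ that])
    fix a assume a: "a \<in> \<Omega>"
    show "bracket z a \<in> lie.span \<Omega>"
      by (rule bracket_span_left[where A = "\<Union>\<phi>\<in>weights. \<gg> \<phi>"])
        (use weight_spaces_span closed a in \<open>auto intro: lie.span_base\<close>)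
  qed simp
  have "\<Omega> \<subseteq> {0}"
  proof (rule ccontr)
    assume "\<not> \<Omega> \<subseteq> {0}"
    have "\<exists>v\<in>\<Omega> - {0}. \<forall>a\<in>\<Omega>. bracket a v \<in> {0}"
    proof (rule engel)
      show "\<exists>k. (bracket a ^^ k) z = 0" if "a \<in> \<Omega>" for a z
      proof (cases "a = 0")
        case True
        then show ?thesis by (intro exI[of _ 1]) simp
      next
        case False
        then show ?thesis using homog[OF that] ad_nilpotent by blast
      qed
    qed (use closed' \<open>\<not> \<Omega> \<subseteq> {0}\<close> in auto)
    then obtain v where v: "v \<in> \<Omega>" "v \<noteq> 0" "\<And>a. a \<in> \<Omega> \<Longrightarrow> bracket a v = 0" by auto
    let ?Z = "{x \<in> lie.span \<Omega>. \<forall>a\<in>\<Omega>. bracket a x = 0}"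
    have Z: "bracket a x = 0" if "x \<in> ?Z" "a \<in> lie.span \<Omega>" for a x
    proof -
      have "bracket a x \<in> {0}" by (rule bracket_span_left[OF _ _ that(2)]) (use that(1) in auto)
      then show ?thesis by simp
    qed
    have "lie_ideal ?Z UNIV"
      unfolding lie_ideal_def
    proof (intro conjI ballI)
      show "lie.subspace ?Z"
        by (auto simp: lie.subspace_def bracket_add_right bracket_scaleC_right
            lie.span_zero lie.span_add lie.span_scale)
      fix z x assume x: "x \<in> ?Z"
      have "bracket a (bracket z x) = 0" if a: "a \<in> \<Omega>" for a
      proof -
        have "bracket a (bracket z x) = bracket (bracket a z) x + bracket z (bracket a x)"
          by (simp add: bracket_bracket_left)
        moreover have "bracket a z \<in> lie.span \<Omega>"
          using ideal[OF lie.span_base[OF a], of z] bracket_skew[of a z] by (simp add: lie.span_neg)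
        ultimately show ?thesis using Z[OF x] x a by auto
      qed
      then show "bracket z x \<in> ?Z" using ideal x by simp
    qed simp
    moreover have "lie_abelian ?Z" using Z by (auto simp: lie_abelian_def)
    ultimately have "?Z = {0}" by (rule abelian_ideal_trivial)
    moreover have "v \<in> ?Z" using v by (auto intro: lie.span_base)
    ultimately show False using v(2) by blast
  qed
  then show ?thesis using assms by (auto simp: \<Omega>_def)
qed

text \<open>The radical splits into weight parts, and those in root spaces vanish. For x in its part
  in \<open>h\<close>, the vector [x, e] = \<phi>(x) e lies in the radical and in a root space, so
  it is zero; hence every root vanishes at x.\<close>

theorem killing_form_nondegenerate:
  assumes "\<And>y. killing_form x y = 0"
  shows "x = (0 :: 'g)"
proof -
  have h: "x = 0" if x: "x \<in> killing_radical" "x \<in> h" for x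
  proof (rule h_eq_0I[OF x(2)])
    fix \<phi> assume \<phi>: "\<phi> \<in> roots h"
    then obtain e where e: "e \<in> \<gg> \<phi>" "e \<noteq> 0"
      using lie.subspace_0[OF subspace_weight_space, of h \<phi>] by (auto simp: roots_def)
    have "bracket x e = \<phi> x *\<^sub>C e" using e x by (simp add: weight_spaceD)
    moreover have "bracket x e \<in> killing_radical"
      using killing_radical_ideal[OF x(1), of e] bracket_skew[of x e]
        lie.subspace_neg[OF subspace_killing_radical] by simp
    ultimately have "\<phi> x *\<^sub>C e = 0"
      using killing_radical_root_part[OF \<phi>] lie.subspace_scale[OF subspace_weight_space e(1)] by metis
    then show "\<phi> x = 0" using e by simp
  qed
  have "x \<in> killing_radical" using assms by (simp add: killing_radical_def)
  then obtain w where w: "\<And>\<phi>. \<phi> \<in> weights \<Longrightarrow> w \<phi> \<in> \<gg> \<phi> \<inter> killing_radical" "x = (\<Sum>\<phi>\<in>weights. w \<phi>)"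
    using weight_decomposition_stable[OF subspace_killing_radical killing_radical_ideal] by blast
  have "w \<phi> = 0" if "\<phi> \<in> weights" for \<phi>
    using w(1)[OF that] that h[of "w \<phi>"] killing_radical_root_part[of \<phi> "w \<phi>"] weight_space_0
    by (auto simp: weights_def)
  then show ?thesis using w(2) by simp
qed

end

section \<open>Roots\<close>

context semisimple_cartan
begin

lemma killing_form_weight_orthogonal:
  assumes "\<phi> \<in> dual_on h" "\<psi> \<in> dual_on h" "\<psi> \<noteq> - \<phi>"
    and "x \<in> \<gg> \<phi>" "y \<in> \<gg> \<psi>"
  shows "killing_form x y = 0"
proof -
  have "- \<phi> \<in> dual_on h" using assms(1) by (rule dual_on_closed(2)[OF _ assms(1)])
  then obtain v where v: "v \<in> h" "\<psi> v \<noteq> - \<phi> v"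
    using dual_on_eqI[of \<psi> "- \<phi>"] assms(2,3) by auto
  then have "\<phi> v + \<psi> v \<noteq> 0" by (auto simp: add_eq_0_iff)
  then show ?thesis using killing_form_orthogonal assms(4,5) v(1) by blast
qed

text \<open>Only a component of weight -\<phi> can pair nontrivially with \<open>e\<close>. The case
  \<phi> = 0 is included and gives nondegeneracy on \<open>h\<close>.\<close>

lemma killing_form_pairing:
  assumes \<phi>: "\<phi> \<in> weights" and e: "e \<in> \<gg> \<phi>" "e \<noteq> 0"
  shows "- \<phi> \<in> weights \<and> (\<exists>f\<in>\<gg> (- \<phi>). killing_form e f = 1)"
proof -
  obtain y where y: "killing_form e y \<noteq> 0" using killing_form_nondegenerate e(2) by blast
  obtain w where w: "\<forall>\<psi>\<in>weights. w \<psi> \<in> \<gg> \<psi>" "y = (\<Sum>\<psi>\<in>weights. w \<psi>)"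
    using weight_decomposition by blast
  obtain \<psi> where \<psi>: "\<psi> \<in> weights" "killing_form e (w \<psi>) \<noteq> 0"
  proof (rule ccontr)
    assume "\<not> thesis"
    then have "\<And>\<psi>. \<psi> \<in> weights \<Longrightarrow> killing_form e (w \<psi>) = 0" using that by blast
    then show False using y by (simp add: w(2) killing_form_sum_right)
  qed
  then have "\<psi> = - \<phi>"
    using killing_form_weight_orthogonal[of \<phi> \<psi> e "w \<psi>"] \<phi> e(1) w(1) weights_dual by blast
  moreover have "(1 / killing_form e (w \<psi>)) *\<^sub>C w \<psi> \<in> \<gg> \<psi>"
    using w(1) \<psi>(1) lie.subspace_scale[OF subspace_weight_space] by blast
  moreover have "killing_form e ((1 / killing_form e (w \<psi>)) *\<^sub>C w \<psi>) = 1"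
    using \<psi>(2) by (simp add: killing_form_scale_right)
  ultimately show ?thesis using \<psi>(1) by blast
qed

lemma root_vector:
  assumes "\<phi> \<in> roots h"
  obtains e where "e \<in> \<gg> \<phi>" "e \<noteq> 0"
  using assms lie.subspace_0[OF subspace_weight_space, of h \<phi>] by (auto simp: roots_def)

lemma uminus_root: "\<phi> \<in> roots h \<Longrightarrow> - \<phi> \<in> roots h"
proof -
  assume \<phi>: "\<phi> \<in> roots h"
  then obtain e where "e \<in> \<gg> \<phi>" "e \<noteq> 0" by (rule root_vector)
  then have "- \<phi> \<in> weights" using killing_form_pairing roots_weights[OF \<phi>] by blast
  moreover have "- \<phi> \<noteq> 0" using \<phi> by (auto simp: roots_def)
  ultimately show "- \<phi> \<in> roots h" by (simp add: weights_def)
qed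

lemma killing_form_h_nondegenerate:
  assumes x: "x \<in> h" and "\<And>y. y \<in> h \<Longrightarrow> killing_form x y = 0"
  shows "x = 0"
proof (rule ccontr)
  assume "x \<noteq> 0"
  then obtain f where "f \<in> \<gg> (- 0)" "killing_form x f = 1"
    using killing_form_pairing[of 0 x] x weight_space_0 by (auto simp: weights_def)
  then show False using assms(2) weight_space_0 by simp
qed

lemma killing_form_bracket_h:
  assumes "e \<in> \<gg> \<phi>" "f \<in> \<gg> (- \<phi>)" "x \<in> h"
  shows "killing_form (bracket e f) x = killing_form e f * \<phi> x"
proof -
  have "bracket f x = \<phi> x *\<^sub>C f"
    using weight_spaceD[OF assms(2,3)] bracket_skew[of f x] by simp
  then show ?thesis by (simp add: killing_form_invariant killing_form_scale_right mult.commute)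
qed

text \<open>The representing element, usually written t with index \<phi>. Existence is established
  for roots, the witness being [e, f] for opposite root vectors with Killing pairing 1; no dimension
  count is involved.\<close>

definition root_dual :: "('g \<Rightarrow> complex) \<Rightarrow> 'g" where
  "root_dual \<phi> = (SOME y. y \<in> h \<and> (\<forall>x\<in>h. killing_form y x = \<phi> x))"

lemma root_pair:
  assumes \<phi>: "\<phi> \<in> roots h"
  obtains e f where "e \<in> \<gg> \<phi>" "f \<in> \<gg> (- \<phi>)" "killing_form e f = 1"
  using killing_form_pairing[OF roots_weights[OF \<phi>]] root_vector[OF \<phi>] by metis

lemma root_dual:
  assumes \<phi>: "\<phi> \<in> roots h"
  shows "root_dual \<phi> \<in> h" "x \<in> h \<Longrightarrow> killing_form (root_dual \<phi>) x = \<phi> x"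
proof -
  obtain e f where ef: "e \<in> \<gg> \<phi>" "f \<in> \<gg> (- \<phi>)" "killing_form e f = 1"
    using root_pair[OF \<phi>] .
  then have "bracket e f \<in> h \<and> (\<forall>x\<in>h. killing_form (bracket e f) x = \<phi> x)"
    using bracket_opposite killing_form_bracket_h by simp
  then have "root_dual \<phi> \<in> h \<and> (\<forall>x\<in>h. killing_form (root_dual \<phi>) x = \<phi> x)"
    unfolding root_dual_def by (rule someI)
  then show "root_dual \<phi> \<in> h" "x \<in> h \<Longrightarrow> killing_form (root_dual \<phi>) x = \<phi> x" by auto
qed

lemma bracket_root_vectors:
  assumes \<phi>: "\<phi> \<in> roots h" and "e \<in> \<gg> \<phi>" "f \<in> \<gg> (- \<phi>)"
  shows "bracket e f = killing_form e f *\<^sub>C root_dual \<phi>"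
proof -
  have "bracket e f - killing_form e f *\<^sub>C root_dual \<phi> = 0"
  proof (rule killing_form_h_nondegenerate)
    show "bracket e f - killing_form e f *\<^sub>C root_dual \<phi> \<in> h"
      using root_dual(1)[OF \<phi>] bracket_opposite[OF assms(2,3)] subspace_h
      by (intro lie.subspace_diff lie.subspace_scale)
    show "killing_form (bracket e f - killing_form e f *\<^sub>C root_dual \<phi>) y = 0" if "y \<in> h" for y
      using that killing_form_bracket_h[OF assms(2,3)] root_dual(2)[OF \<phi>]
      by (simp add: killing_form_diff_left killing_form_scale_left)
  qed
  then show ?thesis by simp
qed

text \<open>This is \<open>(\<phi>, \<psi>)\<close>: no information is lost by passing to the real part.\<close>

definition root_form :: "('g \<Rightarrow> complex) \<Rightarrow> ('g \<Rightarrow> complex) \<Rightarrow> real" where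
  "root_form \<phi> \<psi> = Re (\<psi> (root_dual \<phi>))"

text \<open>Let t = [e, f] represent \<phi> and let \<psi>(t) = r \<phi>(t) for each weight. The
  trace formula for the Killing form gives \<phi>(t) = s times \<phi>(t) squared, where s is the sum
  of the squares of the r weighted by dimensions. As \<phi>(t) is nonzero, it equals 1/s, a positive
  real, and the other values at t are real multiples of it.\<close>

lemma root_form:
  assumes \<phi>: "\<phi> \<in> roots h"
  shows "\<psi> \<in> weights \<Longrightarrow> \<psi> (root_dual \<phi>) = of_real (root_form \<phi> \<psi>)" and "root_form \<phi> \<phi> > 0"
proof -
  let ?t = "root_dual \<phi>" and ?d = "\<lambda>\<psi>. real (lie.dim (\<gg> \<psi>))"
  obtain e f where ef: "e \<in> \<gg> \<phi>" "f \<in> \<gg> (- \<phi>)" "killing_form e f = 1"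
    using root_pair[OF \<phi>] .
  have t: "bracket e f = ?t" using bracket_root_vectors[OF \<phi> ef(1,2)] ef(3) by simp
  obtain r :: "('g \<Rightarrow> complex) \<Rightarrow> real" where r: "\<And>\<psi>. \<psi> \<in> weights \<Longrightarrow> \<psi> ?t = of_real (r \<psi>) * \<phi> ?t"
    using real_ratio_on_brackets[OF \<phi> ef(1,2)] unfolding t by metis
  have th: "?t \<in> h" using root_dual(1)[OF \<phi>] .
  obtain x where "x \<in> h" "\<phi> x \<noteq> 0" using root_nonzero[OF \<phi>] by blast
  then have "?t \<noteq> 0" using root_dual(2)[OF \<phi>, of x] by auto
  then have nz: "\<phi> ?t \<noteq> 0" using bracket_eq_0I[OF \<phi> ef(1,2)] t by auto
  define s where "s = (\<Sum>\<psi>\<in>weights. (r \<psi>)\<^sup>2 * ?d \<psi>)"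
  have "\<phi> ?t = killing_form ?t ?t" using root_dual(2)[OF \<phi> th] by simp
  also have "\<dots> = (\<phi> ?t)\<^sup>2 * of_real s"
    unfolding killing_form_h[OF th th] s_def of_real_sum sum_distrib_left
    by (rule sum.cong) (simp_all add: r power2_eq_square)
  finally have "\<phi> ?t * of_real s = 1" using nz by (simp add: power2_eq_square)
  moreover from this have "of_real s \<noteq> (0 :: complex)" by auto
  ultimately have s: "\<phi> ?t = of_real (1 / s)" by (simp add: nonzero_eq_divide_eq)
  moreover have "s \<ge> 0" unfolding s_def by (intro sum_nonneg) auto
  ultimately have "s > 0" using nz by (cases "s = 0") auto
  then show "root_form \<phi> \<phi> > 0" using s by (simp add: root_form_def)
  show "\<psi> ?t = of_real (root_form \<phi> \<psi>)" if "\<psi> \<in> weights"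
    unfolding root_form_def r[OF that] s by (metis Re_complex_of_real of_real_mult)
qed

lemma root_form_commute:
  assumes "\<phi> \<in> roots h" "\<psi> \<in> roots h"
  shows "root_form \<phi> \<psi> = root_form \<psi> \<phi>"
  using root_dual[OF assms(1)] root_dual[OF assms(2)] killing_form_commute[of "root_dual \<phi>" "root_dual \<psi>"]
  by (simp add: root_form_def)

lemma root_dual_sum:
  assumes "S \<subseteq> roots h"
  shows "(\<Sum>\<alpha>\<in>S. of_real (c \<alpha>) *\<^sub>C root_dual \<alpha>) \<in> h"
    and "\<psi> \<in> weights \<Longrightarrow> \<psi> (\<Sum>\<alpha>\<in>S. of_real (c \<alpha>) *\<^sub>C root_dual \<alpha>) = of_real (\<Sum>\<alpha>\<in>S. c \<alpha> * root_form \<alpha> \<psi>)"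
proof -
  have h: "of_real (c \<alpha>) *\<^sub>C root_dual \<alpha> \<in> h" if "\<alpha> \<in> S" for \<alpha>
    using root_dual(1) assms that by (intro lie.subspace_scale[OF subspace_h]) blast
  then show "(\<Sum>\<alpha>\<in>S. of_real (c \<alpha>) *\<^sub>C root_dual \<alpha>) \<in> h" by (rule lie.subspace_sum[OF subspace_h])
  assume \<psi>: "\<psi> \<in> weights"
  have "\<psi> (\<Sum>\<alpha>\<in>S. of_real (c \<alpha>) *\<^sub>C root_dual \<alpha>) = (\<Sum>\<alpha>\<in>S. \<psi> (of_real (c \<alpha>) *\<^sub>C root_dual \<alpha>))"
    using h by (rule dual_on_sum[OF weights_dual[OF \<psi>]])
  also have "\<dots> = (\<Sum>\<alpha>\<in>S. of_real (c \<alpha>) * of_real (root_form \<alpha> \<psi>))"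
    using assms root_dual(1) root_form(1)[OF _ \<psi>] weights_dual[OF \<psi>]
    by (intro sum.cong) (auto simp: dual_on_scale)
  finally show "\<psi> (\<Sum>\<alpha>\<in>S. of_real (c \<alpha>) *\<^sub>C root_dual \<alpha>) = of_real (\<Sum>\<alpha>\<in>S. c \<alpha> * root_form \<alpha> \<psi>)"
    by simp
qed

text \<open>For y the combination of the \<open>root_dual\<close>s, the double sum is
  \<open>killing_form y y\<close>, a sum of squares of the real numbers \<psi>(y) weighted by
  dimensions. If it vanishes, all roots vanish at y, so y = 0. Since \<open>S\<close> may be
  dependent, definiteness is stated for the combined functional and not for the
  coefficients.\<close>

lemma root_form_definite:
  assumes S: "finite S" "S \<subseteq> roots h"
  shows "(\<Sum>\<alpha>\<in>S. \<Sum>\<beta>\<in>S. c \<alpha> * c \<beta> * root_form \<alpha> \<beta>) \<ge> 0"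
    and "(\<Sum>\<alpha>\<in>S. \<Sum>\<beta>\<in>S. c \<alpha> * c \<beta> * root_form \<alpha> \<beta>) \<le> 0 \<Longrightarrow> x \<in> h \<Longrightarrow> (\<Sum>\<alpha>\<in>S. of_real (c \<alpha>) * \<alpha> x) = 0"
proof -
  let ?Q = "\<Sum>\<alpha>\<in>S. \<Sum>\<beta>\<in>S. c \<alpha> * c \<beta> * root_form \<alpha> \<beta>" and ?d = "\<lambda>\<psi>. real (lie.dim (\<gg> \<psi>))"
  define y where "y = (\<Sum>\<alpha>\<in>S. of_real (c \<alpha>) *\<^sub>C root_dual \<alpha>)"
  have y: "y \<in> h"
    unfolding y_def by (rule root_dual_sum(1)[OF S(2)])
  have yx: "killing_form y x = (\<Sum>\<alpha>\<in>S. of_real (c \<alpha>) * \<alpha> x)" if "x \<in> h" for x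
    unfolding y_def killing_form_sum_left using S(2) root_dual(2)[OF _ that]
    by (intro sum.cong) (auto simp: killing_form_scale_left)
  have \<psi>y: "\<psi> y = of_real (\<Sum>\<alpha>\<in>S. c \<alpha> * root_form \<alpha> \<psi>)" if "\<psi> \<in> weights" for \<psi>
    unfolding y_def by (rule root_dual_sum(2)[OF S(2) that])
  have "of_real ?Q = killing_form y y"
  proof -
    have "killing_form y y = (\<Sum>\<beta>\<in>S. of_real (c \<beta>) * of_real (\<Sum>\<alpha>\<in>S. c \<alpha> * root_form \<alpha> \<beta>))"
      unfolding yx[OF y] by (rule sum.cong) (use \<psi>y S(2) roots_weights in auto)
    also have "\<dots> = of_real (\<Sum>\<beta>\<in>S. \<Sum>\<alpha>\<in>S. c \<alpha> * c \<beta> * root_form \<alpha> \<beta>)"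
      by (simp add: sum_distrib_left ac_simps)
    also have "\<dots> = of_real ?Q" by (subst sum.swap) simp
    finally show ?thesis by simp
  qed
  also have "\<dots> = of_real (\<Sum>\<psi>\<in>weights. (\<Sum>\<alpha>\<in>S. c \<alpha> * root_form \<alpha> \<psi>)\<^sup>2 * ?d \<psi>)"
    unfolding killing_form_h[OF y y] of_real_sum
    by (rule sum.cong) (simp_all add: \<psi>y power2_eq_square)
  finally have Q: "?Q = (\<Sum>\<psi>\<in>weights. (\<Sum>\<alpha>\<in>S. c \<alpha> * root_form \<alpha> \<psi>)\<^sup>2 * ?d \<psi>)"
    using of_real_eq_iff by blast
  show "?Q \<ge> 0" unfolding Q by (intro sum_nonneg) auto
  show "(\<Sum>\<alpha>\<in>S. of_real (c \<alpha>) * \<alpha> x) = 0" if "?Q \<le> 0" and x: "x \<in> h"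
  proof -
    have "(\<Sum>\<psi>\<in>weights. (\<Sum>\<alpha>\<in>S. c \<alpha> * root_form \<alpha> \<psi>)\<^sup>2 * ?d \<psi>) = 0"
      using that(1) unfolding Q by (intro antisym sum_nonneg) auto
    then have z: "(\<Sum>\<alpha>\<in>S. c \<alpha> * root_form \<alpha> \<psi>)\<^sup>2 * ?d \<psi> = 0" if "\<psi> \<in> weights" for \<psi>
      using that by (subst (asm) sum_nonneg_eq_0_iff[OF finite_weights]) auto
    have "y = 0"
    proof (rule h_eq_0I[OF y])
      fix \<psi> assume \<psi>: "\<psi> \<in> roots h"
      then have "?d \<psi> \<noteq> 0" using dim_weight_space_pos[OF \<psi>] by (simp del: lie.dim_eq_0)
      then have "(\<Sum>\<alpha>\<in>S. c \<alpha> * root_form \<alpha> \<psi>) = 0"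
        using z[OF roots_weights[OF \<psi>]] by (simp del: lie.dim_eq_0)
      then show "\<psi> y = 0" using \<psi>y[OF roots_weights[OF \<psi>]] by simp
    qed
    then show ?thesis using yx[OF x] by simp
  qed
qed

text \<open>The trace identity for a normalized pair; the boundary conditions concern only places
  where the string continues beyond \<open>K\<close>.\<close>

lemma root_string_trace_real:
  assumes \<phi>: "\<phi> \<in> roots h" and \<psi>: "\<psi> \<in> weights"
    and ef: "e \<in> \<gg> \<phi>" "f \<in> \<gg> (- \<phi>)" "killing_form e f = 1"
    and K: "K \<subseteq> {k. root_string \<psi> \<phi> k \<in> weights}"
    and up: "\<And>k z. k \<in> K \<Longrightarrow> k + 1 \<notin> K \<Longrightarrow> root_string \<psi> \<phi> (k + 1) \<in> weights \<Longrightarrow>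
      z \<in> \<gg> (root_string \<psi> \<phi> k) \<Longrightarrow> bracket e z = 0"
    and down: "\<And>k z. k \<in> K \<Longrightarrow> k - 1 \<notin> K \<Longrightarrow> root_string \<psi> \<phi> (k - 1) \<in> weights \<Longrightarrow>
      z \<in> \<gg> (root_string \<psi> \<phi> k) \<Longrightarrow> bracket f z = 0"
  shows "(\<Sum>k\<in>K. (root_form \<phi> \<psi> + of_int k * root_form \<phi> \<phi>) *
            real (lie.dim (\<gg> (root_string \<psi> \<phi> k)))) = 0"
proof -
  let ?d = "\<lambda>k. real (lie.dim (\<gg> (root_string \<psi> \<phi> k)))"
  have fin: "finite K" using finite_subset[OF K finite_root_string[OF \<phi>]] .
  have t: "bracket e f = root_dual \<phi>" using bracket_root_vectors[OF \<phi> ef(1,2)] ef(3) by simp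
  have triv: "z = 0" if "root_string \<psi> \<phi> k \<notin> weights" "z \<in> \<gg> (root_string \<psi> \<phi> k)" for k z
    using weight_space_trivial[OF root_string_dual that(1)] that(2) weights_dual \<psi> roots_weights[OF \<phi>] by auto
  have "(\<Sum>k\<in>K. (\<psi> (bracket e f) + of_int k * \<phi> (bracket e f)) * of_nat (lie.dim (\<gg> (root_string \<psi> \<phi> k)))) = 0"
  proof (rule root_string_trace[OF \<phi> ef(1,2) fin])
    fix k z assume k: "k \<in> K" and z: "z \<in> \<gg> (root_string \<psi> \<phi> k)"
    have "bracket e z \<in> \<gg> (root_string \<psi> \<phi> (k + 1))"
      "bracket f z \<in> \<gg> (root_string \<psi> \<phi> (k - 1))"
      using bracket_weight_space[OF ef(1) z] bracket_weight_space[OF ef(2) z]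
      unfolding root_string_add root_string_diff by auto
    then show "k + 1 \<notin> K \<Longrightarrow> bracket e z = 0" "k - 1 \<notin> K \<Longrightarrow> bracket f z = 0"
      using triv up[OF k _ _ z] down[OF k _ _ z] by blast+
  qed (use K in auto)
  then have "of_real (\<Sum>k\<in>K. (root_form \<phi> \<psi> + of_int k * root_form \<phi> \<phi>) * ?d k) = (0 :: complex)"
    unfolding t using root_form(1)[OF \<phi>] \<psi> roots_weights[OF \<phi>] by simp
  then show ?thesis using of_real_eq_0_iff by blast
qed

text \<open>As \<open>e\<close> annihilates the space of \<psi>, the lower part k \<le> 0 of the
  string is stable. If (\<phi>, \<psi>) were negative, every term of its trace would be nonpositive
  and the term k = 0 negative.\<close>

lemma root_form_nonneg:
  assumes \<phi>: "\<phi> \<in> roots h" and \<psi>: "\<psi> \<in> roots h"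
    and ef: "e \<in> \<gg> \<phi>" "f \<in> \<gg> (- \<phi>)" "killing_form e f = 1"
    and e\<psi>: "\<And>z. z \<in> \<gg> \<psi> \<Longrightarrow> bracket e z = 0"
  shows "(\<Sum>k\<in>{k. root_string \<psi> \<phi> k \<in> weights \<and> k \<le> 0}. (root_form \<phi> \<psi> + of_int k * root_form \<phi> \<phi>) *
            real (lie.dim (\<gg> (root_string \<psi> \<phi> k)))) = 0"
    and "root_form \<phi> \<psi> \<ge> 0"
proof -
  let ?K = "{k. root_string \<psi> \<phi> k \<in> weights \<and> k \<le> 0}"
  let ?t = "\<lambda>k. (root_form \<phi> \<psi> + of_int k * root_form \<phi> \<phi>) * real (lie.dim (\<gg> (root_string \<psi> \<phi> k)))"
  show sum0: "(\<Sum>k\<in>?K. ?t k) = 0"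
  proof (rule root_string_trace_real[OF \<phi> roots_weights[OF \<psi>] ef])
    fix k z assume "k \<in> ?K" "k + 1 \<notin> ?K" "root_string \<psi> \<phi> (k + 1) \<in> weights"
      "z \<in> \<gg> (root_string \<psi> \<phi> k)"
    moreover from this have "k = 0" by auto
    ultimately show "bracket e z = 0" using e\<psi> by simp
  qed auto
  show "root_form \<phi> \<psi> \<ge> 0"
  proof (rule ccontr)
    assume "\<not> ?thesis"
    then have neg: "root_form \<phi> \<psi> < 0" by simp
    have "finite ?K" by (rule finite_subset[OF _ finite_root_string[OF \<phi>]]) auto
    then have "(\<Sum>k\<in>?K. - ?t k) > 0"
    proof (rule sum_pos2[of _ 0])
      show "0 \<in> ?K" using roots_weights[OF \<psi>] by simp
      show "- ?t 0 > 0"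
        using neg dim_weight_space_pos[OF \<psi>] by (simp del: lie.dim_eq_0 add: mult_neg_pos)
      fix k assume "k \<in> ?K"
      then have "of_int k * root_form \<phi> \<phi> \<le> 0"
        using root_form(2)[OF \<phi>] by (intro mult_nonpos_nonneg) auto
      then have "?t k \<le> 0" using neg by (intro mult_nonpos_nonneg) auto
      then show "0 \<le> - ?t k" by simp
    qed
    then show False using sum0 by (simp add: sum_negf)
  qed
qed

text \<open>If the sum is not a weight, \<open>e\<close> annihilates the space of \<psi> and
  \<open>root_form_nonneg\<close> applies. The sum may be 0, hence \<open>weights\<close> in the
  conclusion.\<close>

lemma root_add:
  assumes \<phi>: "\<phi> \<in> roots h" and \<psi>: "\<psi> \<in> roots h" and neg: "root_form \<phi> \<psi> < 0"
  shows "\<phi> + \<psi> \<in> weights"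
proof (rule ccontr)
  assume nw: "\<phi> + \<psi> \<notin> weights"
  obtain e f where ef: "e \<in> \<gg> \<phi>" "f \<in> \<gg> (- \<phi>)" "killing_form e f = 1"
    using root_pair[OF \<phi>] .
  have "\<phi> + \<psi> \<in> dual_on h" using weights_dual roots_weights \<phi> \<psi> by (intro dual_on_closed) auto
  then have "\<gg> (\<phi> + \<psi>) = {0}" using nw by (rule weight_space_trivial)
  then have "bracket e z = 0" if "z \<in> \<gg> \<psi>" for z
    using bracket_weight_space[OF ef(1) that] by blast
  then show False using root_form_nonneg(2)[OF \<phi> \<psi> ef] neg by fastforce
qed

text \<open>The stable space consists of the line of \<open>f\<close>, of \<open>h\<close>, and of
  the spaces of k \<phi> for k \<ge> 1. After division by (\<phi>, \<phi>) its trace identity says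
  that the sum of k times the dimension over k \<ge> 1 equals 1, so the term k = 1 is at most
  1.\<close>

lemma dim_root_space:
  assumes \<phi>: "\<phi> \<in> roots h"
  shows "lie.dim (\<gg> \<phi>) = 1"
proof -
  obtain e f where ef: "e \<in> \<gg> \<phi>" "f \<in> \<gg> (- \<phi>)" "killing_form e f = 1"
    using root_pair[OF \<phi>] .
  have t: "bracket e f = root_dual \<phi>" using bracket_root_vectors[OF \<phi> ef(1,2)] ef(3) by simp
  let ?s = "root_string 0 \<phi>"
  \<comment> \<open>Position -1 is cut down to the line of \<open>f\<close>, so that its
    contribution to the trace is exactly -1. Stability survives because \<open>f\<close> commutes
    with itself and maps \<open>h\<close> into its own line.\<close>
  define U where "U = (\<lambda>\<chi>. if \<chi> = - \<phi> then lie.span {f} else \<gg> \<chi>)"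
  define K where "K = {k. k \<ge> -1 \<and> ?s k \<in> weights}"
  have zero: "0 \<in> weights" by (simp add: weights_def)
  have sm1: "?s (- 1) = - \<phi>" and s1: "?s 1 = \<phi>" by (auto simp: root_string_def)
  have finK: "finite K" unfolding K_def by (rule finite_subset[OF _ finite_root_string[OF \<phi>]]) auto
  have inK: "0 \<in> K" "1 \<in> K" "- 1 \<in> K"
    using zero roots_weights[OF \<phi>] roots_weights[OF uminus_root[OF \<phi>]] sm1 s1 by (auto simp: K_def)
  have U: "U (?s k) = \<gg> (?s k)" if "k \<noteq> -1" for k
    using root_string_inj[OF \<phi>, of 0 k "-1"] sm1 that by (auto simp: U_def)
  have Um1: "U (?s (- 1)) = lie.span {f}" using sm1 by (simp add: U_def)
  have triv: "z = 0" if "?s k \<notin> weights" "z \<in> \<gg> (?s k)" for k z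
    using weight_space_trivial[OF root_string_dual that(1)] that(2) weights_dual zero roots_weights[OF \<phi>] by auto
  have Usub: "U \<chi> \<subseteq> \<gg> \<chi>" for \<chi>
    unfolding U_def using ef(2) by (auto intro: lie.span_minimal[OF _ subspace_weight_space, THEN subsetD])
  have inV: "u \<in> lie.span (\<Union>\<chi>\<in>?s ` K. U \<chi>)" if "k \<in> K" "u \<in> U (?s k)" for u k
    using that by (intro lie.span_base) blast
  have z0: "0 \<in> lie.span (\<Union>\<chi>\<in>?s ` K. U \<chi>)" by (rule lie.span_zero)
  have "(\<Sum>\<chi>\<in>?s ` K. \<chi> (bracket e f) * of_nat (lie.dim (U \<chi>))) = 0"
  proof (rule trace_zero)
    show "bracket e f \<in> h" using t root_dual(1)[OF \<phi>] by simp
    show "lie.subspace (U \<chi>)" for \<chi> by (simp add: U_def subspace_weight_space)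
    fix \<chi> u assume "\<chi> \<in> ?s ` K" "u \<in> U \<chi>"
    then obtain k where k: "k \<in> K" "u \<in> U (?s k)" by blast
    have uw: "u \<in> \<gg> (?s k)" using Usub k(2) by blast
    have eu: "bracket e u \<in> \<gg> (?s (k + 1))"
      and fu: "bracket f u \<in> \<gg> (?s (k - 1))"
      using bracket_weight_space[OF ef(1) uw] bracket_weight_space[OF ef(2) uw]
      unfolding root_string_add root_string_diff by auto
    have "k \<ge> - 1" using k(1) by (simp add: K_def)
    show "bracket e u \<in> lie.span (\<Union>\<chi>\<in>?s ` K. U \<chi>)"
    proof (cases "k + 1 \<in> K")
      case True
      then show ?thesis using inV[of "k + 1"] eu U[of "k + 1"] \<open>k \<ge> - 1\<close> by simp
    next
      case False
      then have "bracket e u = 0" using triv eu \<open>k \<ge> - 1\<close> by (auto simp: K_def)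
      then show ?thesis using z0 by simp
    qed
    consider "k = - 1" | "k = 0" | "k > 0" using \<open>k \<ge> - 1\<close> by linarith
    then show "bracket f u \<in> lie.span (\<Union>\<chi>\<in>?s ` K. U \<chi>)"
    proof cases
      case 1
      then obtain c where "u = c *\<^sub>C f" using k(2) Um1 by (auto simp: lie.span_singleton)
      then show ?thesis using z0 by (simp add: bracket_scaleC_right bracket_self)
    next
      case 2
      then have "u \<in> h" using uw weight_space_0 by simp
      then have "bracket f u = \<phi> u *\<^sub>C f"
        using weight_spaceD[OF ef(2)] bracket_skew[of f u] by simp
      then have "bracket f u \<in> U (?s (- 1))"
        unfolding Um1 by (simp add: lie.span_scale lie.span_base)
      then show ?thesis using inV[OF inK(3)] by blast
    next
      case 3
      show ?thesis
      proof (cases "k - 1 \<in> K")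
        case True
        then show ?thesis using inV[of "k - 1"] fu U[of "k - 1"] 3 by simp
      next
        case False
        then have "bracket f u = 0" using triv fu 3 by (auto simp: K_def)
        then show ?thesis using z0 by simp
      qed
    qed
  qed (use Usub finK in \<open>auto simp: K_def\<close>)
  then have "(\<Sum>k\<in>K. ?s k (root_dual \<phi>) * of_nat (lie.dim (U (?s k)))) = 0"
    unfolding t by (subst (asm) sum.reindex) (use root_string_inj[OF \<phi>] in \<open>auto simp: inj_on_def\<close>)
  then have "of_real (root_form \<phi> \<phi> * (\<Sum>k\<in>K. of_int k * real (lie.dim (U (?s k))))) = (0 :: complex)"
    by (simp add: root_string_def root_form(1)[OF \<phi> roots_weights[OF \<phi>]] sum_distrib_left ac_simps)
  then have sum0: "(\<Sum>k\<in>K. of_int k * real (lie.dim (U (?s k)))) = 0"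
    using root_form(2)[OF \<phi>] by (simp only: of_real_eq_0_iff) auto
  have "f \<noteq> 0" using ef(3) by auto
  then have "lie.dim (U (?s (- 1))) = 1"
    unfolding Um1 by (simp add: lie.dim_eq_card_independent)
  then have "(\<Sum>k\<in>K - {- 1}. of_int k * real (lie.dim (U (?s k)))) = 1"
    using sum0 sum.remove[OF finK inK(3), of "\<lambda>k. of_int k * real (lie.dim (U (?s k)))"] by simp
  moreover have "(\<Sum>k\<in>{1}. of_int k * real (lie.dim (U (?s k)))) \<le> (\<Sum>k\<in>K - {- 1}. of_int k * real (lie.dim (U (?s k))))"
    by (rule sum_mono2) (use finK inK in \<open>auto simp: K_def\<close>)
  ultimately have "lie.dim (\<gg> \<phi>) \<le> 1" using U[of 1] s1 by simp
  then show ?thesis using dim_weight_space_pos[OF \<phi>] by linarith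
qed

lemma root_space_line:
  assumes \<phi>: "\<phi> \<in> roots h" and e: "e \<in> \<gg> \<phi>" "e \<noteq> 0" and x: "x \<in> \<gg> \<phi>"
  shows "\<exists>c. x = c *\<^sub>C e"
proof -
  have "lie.span {e} = \<gg> \<phi>"
  proof (rule lie.subspace_dim_equal)
    show "lie.span {e} \<subseteq> \<gg> \<phi>"
      using e(1) by (intro lie.span_minimal subspace_weight_space) auto
    show "lie.dim (\<gg> \<phi>) \<le> lie.dim (lie.span {e})"
      using e(2) dim_root_space[OF \<phi>] by (simp add: lie.dim_eq_card_independent)
  qed (simp_all add: subspace_weight_space)
  then show ?thesis using x by (auto simp: lie.span_singleton)
qed

text \<open>Root spaces are lines, so a partner of \<open>e\<close> with Killing pairing 1 is a
  multiple of \<open>f\<close>, and its bracket with \<open>e\<close> is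
  \<open>root_dual \<phi>\<close>, which is nonzero.\<close>

lemma bracket_opposite_nonzero:
  assumes \<phi>: "\<phi> \<in> roots h" and e: "e \<in> \<gg> \<phi>" "e \<noteq> 0"
    and f: "f \<in> \<gg> (- \<phi>)" "f \<noteq> 0"
  shows "bracket e f \<noteq> 0"
proof -
  obtain f' where f': "f' \<in> \<gg> (- \<phi>)" "killing_form e f' = 1"
    using killing_form_pairing[OF roots_weights[OF \<phi>] e] by blast
  obtain c where c: "f' = c *\<^sub>C f" using root_space_line[OF uminus_root[OF \<phi>] f f'(1)] by blast
  have "root_dual \<phi> \<noteq> 0" using root_form[OF \<phi>] root_dual[OF \<phi>] root_nonzero[OF \<phi>] by force
  then have "bracket e f' \<noteq> 0" using bracket_root_vectors[OF \<phi> e(1) f'(1)] f'(2) by simp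
  then show ?thesis by (auto simp: c bracket_scaleC_right)
qed

text \<open>If the bracket vanished, \<open>e\<close> would annihilate the line of \<psi>; then the
  part k \<le> 0 of the string has trace zero and (\<phi>, \<psi>) \<ge> 0. Subtracting it from the
  full string leaves trace zero for k \<ge> 1, where every term is nonnegative and the term k = 1 is
  positive.\<close>

lemma bracket_root_spaces_nonzero:
  assumes \<phi>: "\<phi> \<in> roots h" and \<psi>: "\<psi> \<in> roots h" and sum: "\<phi> + \<psi> \<in> roots h"
    and e: "e \<in> \<gg> \<phi>" "e \<noteq> 0" and y: "y \<in> \<gg> \<psi>" "y \<noteq> 0"
  shows "bracket e y \<noteq> 0"
proof
  assume ey: "bracket e y = 0"
  obtain f where f: "f \<in> \<gg> (- \<phi>)" "killing_form e f = 1"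
    using killing_form_pairing[OF roots_weights[OF \<phi>] e] by blast
  let ?K = "{k. root_string \<psi> \<phi> k \<in> weights}"
  let ?t = "\<lambda>k. (root_form \<phi> \<psi> + of_int k * root_form \<phi> \<phi>) * real (lie.dim (\<gg> (root_string \<psi> \<phi> k)))"
  have "bracket e z = 0" if "z \<in> \<gg> \<psi>" for z
    using root_space_line[OF \<psi> y that] ey by (auto simp: bracket_scaleC_right)
  then have low: "(\<Sum>k\<in>{k \<in> ?K. k \<le> 0}. ?t k) = 0" and nonneg: "root_form \<phi> \<psi> \<ge> 0"
    using root_form_nonneg[OF \<phi> \<psi> e(1) f] by simp_all
  have fin: "finite ?K" by (rule finite_root_string[OF \<phi>])
  have pos: "root_form \<phi> \<phi> > 0" by (rule root_form(2)[OF \<phi>])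
  have "(\<Sum>k\<in>?K. ?t k) = 0"
    by (rule root_string_trace_real[OF \<phi> roots_weights[OF \<psi>] e(1) f]) auto
  moreover note low
  moreover have "(\<Sum>k\<in>?K. ?t k) = (\<Sum>k\<in>{k \<in> ?K. k \<le> 0}. ?t k) + (\<Sum>k\<in>?K - {k \<in> ?K. k \<le> 0}. ?t k)"
    by (rule sum.subset_diff[THEN trans[OF _ add.commute]]) (use fin in auto)
  ultimately have high: "(\<Sum>k\<in>?K - {k \<in> ?K. k \<le> 0}. ?t k) = 0" by simp
  have s1: "root_string \<psi> \<phi> 1 = \<phi> + \<psi>" using root_string_add[of \<phi> \<psi> 0] by simp
  have "(\<Sum>k\<in>?K - {k \<in> ?K. k \<le> 0}. ?t k) > 0"
  proof (rule sum_pos2[of _ 1])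
    show "1 \<in> ?K - {k \<in> ?K. k \<le> 0}" using s1 roots_weights[OF sum] by simp
    show "?t 1 > 0"
      using nonneg pos dim_weight_space_pos[OF sum] s1 by (simp del: lie.dim_eq_0)
    fix k assume k: "k \<in> ?K - {k \<in> ?K. k \<le> 0}"
    show "0 \<le> ?t k" using nonneg pos k by (intro mult_nonneg_nonneg add_nonneg_nonneg) auto
  qed (use fin in auto)
  then show False using high by simp
qed

end

section \<open>Positive systems\<close>

lemma sum_list_fun_apply: "sum_list fs x = sum_list (map (\<lambda>f. f x) fs)"
  by (induction fs) simp_all

locale positive_roots = semisimple_cartan h for h :: "'g::complex_lie_algebra set" +
  fixes P :: "('g \<Rightarrow> complex) set"
  assumes positive_system: "positive_system h P"
begin

lemma positive_root: "\<phi> \<in> P \<Longrightarrow> \<phi> \<in> roots h"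
  using positive_system by (auto simp: positive_system_def)

lemma finite_positive: "finite P"
  using finite_subset[OF _ finite_roots] positive_root by blast

lemma not_positive: "\<phi> \<in> roots h \<Longrightarrow> \<phi> \<notin> P \<longleftrightarrow> - \<phi> \<in> P"
  using positive_system by (auto simp: positive_system_def)

lemma positive_add: "\<phi> \<in> P \<Longrightarrow> \<psi> \<in> P \<Longrightarrow> \<phi> + \<psi> \<in> roots h \<Longrightarrow> \<phi> + \<psi> \<in> P"
  using positive_system by (auto simp: positive_system_def)

text \<open>Lists keep multiplicities. Pairing a vanishing sum with its first member \<phi> exposes
  a member \<psi> with (\<phi>, \<psi>) < 0; then \<phi> + \<psi> is a positive root, and merging
  the two gives a shorter list with the same sum.\<close>

lemma positive_sum_nonzero:
  assumes "set \<phi>s \<subseteq> P" "\<phi>s \<noteq> []"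
  shows "sum_list \<phi>s \<noteq> 0"
  using assms
proof (induction \<phi>s rule: length_induct)
  case (1 \<phi>s)
  show ?case
  proof
    assume zero: "sum_list \<phi>s = 0"
    obtain \<phi> \<psi>s where \<phi>s: "\<phi>s = \<phi> # \<psi>s" using "1.prems" by (cases \<phi>s) auto
    have \<phi>: "\<phi> \<in> P" "\<phi> \<in> roots h" using "1.prems" \<phi>s positive_root by auto
    have \<psi>s: "\<psi> \<in> P" "\<psi> \<in> roots h" if "\<psi> \<in> set \<psi>s" for \<psi>
      using that "1.prems" \<phi>s positive_root by auto
    have "sum_list \<phi>s (root_dual \<phi>) = 0" using zero by simp
    then have "Re (sum_list (map (\<lambda>\<psi>. \<psi> (root_dual \<phi>)) \<phi>s)) = 0"
      by (simp add: sum_list_fun_apply)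
    moreover have "Re (sum_list (map (\<lambda>\<psi>. \<psi> (root_dual \<phi>)) \<chi>s)) = sum_list (map (root_form \<phi>) \<chi>s)" for \<chi>s
      by (induction \<chi>s) (simp_all add: root_form_def)
    ultimately have "root_form \<phi> \<phi> + sum_list (map (root_form \<phi>) \<psi>s) = 0"
      by (simp add: \<phi>s root_form_def[of \<phi> \<phi>])
    then have "sum_list (map (root_form \<phi>) \<psi>s) < 0" using root_form(2)[OF \<phi>(2)] by linarith
    then obtain \<psi> where \<psi>: "\<psi> \<in> set \<psi>s" "root_form \<phi> \<psi> < 0"
      by (metis (no_types, lifting) sum_list_nonneg imageE list.set_map not_le)
    then have "\<phi> + \<psi> \<in> weights" using root_add \<phi>(2) \<psi>s by blast
    moreover have "\<phi> + \<psi> \<noteq> 0"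
    proof
      assume "\<phi> + \<psi> = 0"
      then have "- \<phi> = \<psi>" by (metis minus_unique)
      then show False using not_positive[OF \<phi>(2)] \<phi>(1) \<psi>s(1)[OF \<psi>(1)] by auto
    qed
    ultimately have "\<phi> + \<psi> \<in> P" using positive_add \<phi> \<psi>s \<psi>(1) by (auto simp: weights_def)
    moreover have "set (remove1 \<psi> \<psi>s) \<subseteq> P" using \<psi>s set_remove1_subset[of \<psi> \<psi>s] by blast
    moreover have "length (remove1 \<psi> \<psi>s) < length \<psi>s"
      using \<psi>(1) by (metis length_remove1 One_nat_def diff_less length_pos_if_in_set zero_less_one)
    ultimately have "sum_list ((\<phi> + \<psi>) # remove1 \<psi> \<psi>s) \<noteq> 0"
      using "1.IH"[rule_format, of "(\<phi> + \<psi>) # remove1 \<psi> \<psi>s"] \<phi>s by simp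
    moreover have "sum_list \<psi>s = \<psi> + sum_list (remove1 \<psi> \<psi>s)"
      by (rule sum_list_map_remove1[OF \<psi>(1), of id, simplified])
    ultimately show False using zero by (simp add: \<phi>s add.assoc)
  qed
qed

lemma positive_induct [consumes 1, case_names simple add]:
  assumes "\<phi> \<in> P"
    and simple: "\<And>\<alpha>. \<alpha> \<in> simple_of P \<Longrightarrow> Q \<alpha>"
    and add: "\<And>\<phi> \<psi>. \<phi> \<in> P \<Longrightarrow> \<psi> \<in> P \<Longrightarrow> \<phi> + \<psi> \<in> P \<Longrightarrow> Q \<phi> \<Longrightarrow> Q \<psi> \<Longrightarrow> Q (\<phi> + \<psi>)"
  shows "Q \<phi>"
proof -
  define r where "r = {(\<chi>, \<phi>). \<chi> \<in> P \<and> \<phi> \<in> P \<and> \<phi> - \<chi> \<in> P}"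
  have path: "\<exists>\<phi>s. \<phi>s \<noteq> [] \<and> set \<phi>s \<subseteq> P \<and> \<phi> = \<chi> + sum_list \<phi>s" if "(\<chi>, \<phi>) \<in> r\<^sup>+" for \<chi> \<phi>
    using that
  proof (induction rule: trancl_induct)
    case (base \<psi>)
    then show ?case by (intro exI[of _ "[\<psi> - \<chi>]"]) (simp add: r_def)
  next
    case (step \<psi> \<omega>)
    then obtain \<phi>s where "\<phi>s \<noteq> []" "set \<phi>s \<subseteq> P" "\<psi> = \<chi> + sum_list \<phi>s" by blast
    then show ?case using step.hyps(2)
      by (intro exI[of _ "\<phi>s @ [\<omega> - \<psi>]"]) (simp add: r_def algebra_simps)
  qed
  have "r \<subseteq> P \<times> P" by (auto simp: r_def)
  then have "finite r" using finite_positive finite_subset by blast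
  moreover have "acyclic r"
    unfolding acyclic_def
  proof safe
    fix \<phi> assume "(\<phi>, \<phi>) \<in> r\<^sup>+"
    then obtain \<phi>s where "\<phi>s \<noteq> []" "set \<phi>s \<subseteq> P" "\<phi> = \<phi> + sum_list \<phi>s" using path by blast
    then show False using positive_sum_nonzero[of \<phi>s] by simp
  qed
  ultimately have "wf r" by (rule finite_acyclic_wf)
  then show ?thesis using assms(1)
  proof (induction \<phi> rule: wf_induct_rule)
    case (less \<phi>)
    show ?case
    proof (cases "\<phi> \<in> simple_of P")
      case False
      then obtain \<phi>\<^sub>1 \<phi>\<^sub>2 where *: "\<phi>\<^sub>1 \<in> P" "\<phi>\<^sub>2 \<in> P" "\<phi> = \<phi>\<^sub>1 + \<phi>\<^sub>2"
        using less.prems by (auto simp: simple_of_def)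
      then have "\<phi> - \<phi>\<^sub>1 = \<phi>\<^sub>2" "\<phi> - \<phi>\<^sub>2 = \<phi>\<^sub>1" by simp_all
      then have "(\<phi>\<^sub>1, \<phi>) \<in> r" "(\<phi>\<^sub>2, \<phi>) \<in> r"
        using less.prems *(1,2) unfolding r_def by simp_all
      then show ?thesis using less.IH * less.prems add by blast
    qed (rule simple)
  qed
qed

abbreviation \<Pi> :: "('g \<Rightarrow> complex) set" where
  "\<Pi> \<equiv> simple_of P"

lemma simple_positive: "\<alpha> \<in> \<Pi> \<Longrightarrow> \<alpha> \<in> P"
  by (simp add: simple_of_def)

lemma simple_root: "\<alpha> \<in> \<Pi> \<Longrightarrow> \<alpha> \<in> roots h"
  using simple_positive positive_root by blast

lemma finite_simple: "finite \<Pi>"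
  using finite_subset[OF _ finite_positive] simple_positive by blast

lemma simple_not_sum: "\<alpha> \<in> \<Pi> \<Longrightarrow> \<phi> \<in> P \<Longrightarrow> \<psi> \<in> P \<Longrightarrow> \<alpha> \<noteq> \<phi> + \<psi>"
  by (auto simp: simple_of_def)

lemma simple_diff_positive:
  assumes \<alpha>: "\<alpha> \<in> \<Pi>" and \<phi>: "\<phi> \<in> P" and "\<phi> - \<alpha> \<in> roots h"
  shows "\<phi> - \<alpha> \<in> P"
proof (rule ccontr)
  assume "\<phi> - \<alpha> \<notin> P"
  then have "- (\<phi> - \<alpha>) \<in> P" using not_positive assms(3) by blast
  then show False using simple_not_sum[OF \<alpha> \<phi>, of "- (\<phi> - \<alpha>)"] by simp
qed

text \<open>Otherwise \<alpha> - \<beta> is a root, necessarily positive by simplicity of \<beta>,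
  and then \<alpha> is a sum of two positive roots.\<close>

lemma simple_obtuse:
  assumes \<alpha>: "\<alpha> \<in> \<Pi>" and \<beta>: "\<beta> \<in> \<Pi>" and "\<alpha> \<noteq> \<beta>"
  shows "root_form \<alpha> \<beta> \<le> 0"
proof (rule ccontr)
  assume "\<not> ?thesis"
  then have "root_form \<alpha> (- \<beta>) < 0" by (simp add: root_form_def)
  then have "\<alpha> + - \<beta> \<in> weights"
    by (rule root_add[OF simple_root[OF \<alpha>] uminus_root[OF simple_root[OF \<beta>]]])
  then have "\<alpha> - \<beta> \<in> roots h" using assms(3) by (auto simp: weights_def)
  then have "\<alpha> - \<beta> \<in> P" by (rule simple_diff_positive[OF \<beta> simple_positive[OF \<alpha>]])
  then show False using simple_not_sum[OF \<alpha> _ simple_positive[OF \<beta>], of "\<alpha> - \<beta>"] by simp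
qed

text \<open>The sum of the positive roots other than a simple root \<open>\<alpha>\<close> is orthogonal to \<open>\<alpha>\<close>, because the
  corresponding root spaces span a subspace stable under the root vectors for \<open>\<plusminus>\<alpha>\<close>.\<close>

lemma root_form_sum_positive:
  assumes \<alpha>: "\<alpha> \<in> \<Pi>"
  shows "(\<Sum>\<phi>\<in>P. root_form \<alpha> \<phi>) > 0"
proof -
  note r = simple_root[OF \<alpha>]
  obtain e f where ef: "e \<in> \<gg> \<alpha>" "f \<in> \<gg> (- \<alpha>)" "killing_form e f = 1"
    using root_pair[OF r] .
  have t: "bracket e f = root_dual \<alpha>" using bracket_root_vectors[OF r ef(1,2)] ef(3) by simp
  \<comment> \<open>Were 2 \<alpha> a root, ad f could map its space into that of \<alpha>, which is
    left out of the span below. It is not one, since a root vector commutes with itself.\<close>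
  have double: "\<alpha> + \<alpha> \<notin> roots h"
  proof
    assume "\<alpha> + \<alpha> \<in> roots h"
    moreover obtain u where "u \<in> \<gg> \<alpha>" "u \<noteq> 0" using root_vector[OF r] .
    ultimately show False using bracket_root_spaces_nonzero[OF r r, of u u] bracket_self by blast
  qed
  let ?F = "P - {\<alpha>}"
  have "(\<Sum>\<phi>\<in>?F. \<phi> (bracket e f) * of_nat (lie.dim (\<gg> \<phi>))) = 0"
  proof (rule trace_zero)
    show "?F \<subseteq> weights" using positive_root roots_weights by blast
    show "bracket e f \<in> h" using t root_dual(1)[OF r] by simp
    fix \<phi> u assume \<phi>: "\<phi> \<in> ?F" and u: "u \<in> \<gg> \<phi>"
    have V: "z \<in> lie.span (\<Union>\<phi>\<in>?F. \<gg> \<phi>)"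
      if "z \<in> \<gg> \<chi>" "\<chi> \<in> roots h \<Longrightarrow> \<chi> \<in> ?F" "\<chi> \<noteq> 0" "\<chi> \<in> dual_on h" for z \<chi>
    proof (cases "\<chi> \<in> roots h")
      case True
      then show ?thesis using that(1,2) by (intro lie.span_base) blast
    next
      case False
      then have "z = 0" using weight_space_trivial[OF that(4)] that(1,3) by (auto simp: weights_def)
      then show ?thesis by (simp add: lie.span_zero)
    qed
    have \<phi>r: "\<phi> \<in> roots h" "\<phi> \<in> P" "\<phi> \<noteq> \<alpha>" "\<phi> \<noteq> 0" using \<phi> positive_root by (auto simp: roots_def)
    have dual: "\<phi> \<in> dual_on h" "\<alpha> \<in> dual_on h" "- \<alpha> \<in> dual_on h"
      using \<phi>r(1) r uminus_root[OF r] roots_weights weights_dual by auto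
    show "bracket e u \<in> lie.span (\<Union>\<phi>\<in>?F. \<gg> \<phi>)"
    proof (rule V[OF bracket_weight_space[OF ef(1) u]])
      show "\<alpha> + \<phi> \<in> ?F" if "\<alpha> + \<phi> \<in> roots h"
        using positive_add[OF simple_positive[OF \<alpha>] \<phi>r(2) that] \<phi>r(4) by auto
      show "\<alpha> + \<phi> \<noteq> 0"
        using not_positive[OF r] simple_positive[OF \<alpha>] \<phi>r(2) minus_unique by blast
      show "\<alpha> + \<phi> \<in> dual_on h" using dual by (intro dual_on_closed)
    qed
    show "bracket f u \<in> lie.span (\<Union>\<phi>\<in>?F. \<gg> \<phi>)"
    proof (rule V[OF bracket_weight_space[OF ef(2) u]])
      show "- \<alpha> + \<phi> \<in> ?F" if "- \<alpha> + \<phi> \<in> roots h"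
      proof -
        have "\<phi> - \<alpha> \<in> P" using simple_diff_positive[OF \<alpha> \<phi>r(2)] that by simp
        moreover have "\<phi> - \<alpha> \<noteq> \<alpha>" using double \<phi>r(1) by (metis diff_add_cancel)
        ultimately show ?thesis by simp
      qed
      show "- \<alpha> + \<phi> \<noteq> 0" using \<phi>r(3) by (simp add: add_eq_0_iff)
      show "- \<alpha> + \<phi> \<in> dual_on h" using dual by (intro dual_on_closed)
    qed
  qed (use finite_positive subspace_weight_space in auto)
  moreover have "\<phi> (bracket e f) * of_nat (lie.dim (\<gg> \<phi>)) = of_real (root_form \<alpha> \<phi>)" if "\<phi> \<in> ?F" for \<phi>
    using that positive_root[of \<phi>] dim_root_space[of \<phi>] root_form(1)[OF r roots_weights, of \<phi>] t by simp
  ultimately have "of_real (\<Sum>\<phi>\<in>?F. root_form \<alpha> \<phi>) = (0 :: complex)" by simp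
  then have "(\<Sum>\<phi>\<in>?F. root_form \<alpha> \<phi>) = 0" using of_real_eq_0_iff by blast
  moreover have "(\<Sum>\<phi>\<in>P. root_form \<alpha> \<phi>) = root_form \<alpha> \<alpha> + (\<Sum>\<phi>\<in>?F. root_form \<alpha> \<phi>)"
    using finite_positive simple_positive[OF \<alpha>] by (rule sum.remove)
  ultimately show ?thesis using root_form(2)[OF r] by simp
qed

text \<open>Write r = p - n with positive part p and negative part n. Then (p, p) = (n, p), which is
  \<le> 0 because the supports are disjoint and distinct simple roots are obtuse; so p combines to
  the zero functional. Pairing with the sum of the positive roots, which is positive on each simple
  root, gives p = 0. The same for -r gives n = 0.\<close>

lemma simple_gram_nonsingular:
  fixes r :: "('g \<Rightarrow> complex) \<Rightarrow> real"
  assumes rel: "\<And>\<beta>. \<beta> \<in> \<Pi> \<Longrightarrow> (\<Sum>\<alpha>\<in>\<Pi>. r \<alpha> * root_form \<alpha> \<beta>) = 0" and \<alpha>: "\<alpha> \<in> \<Pi>"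
  shows "r \<alpha> = 0"
proof -
  have nonpos: "r \<alpha> \<le> 0" if rel: "\<And>\<beta>. \<beta> \<in> \<Pi> \<Longrightarrow> (\<Sum>\<alpha>\<in>\<Pi>. r \<alpha> * root_form \<alpha> \<beta>) = 0" and \<alpha>: "\<alpha> \<in> \<Pi>"
    for r :: "('g \<Rightarrow> complex) \<Rightarrow> real" and \<alpha>
  proof -
    define p where "p = (\<lambda>\<alpha>. max (r \<alpha>) 0)"
    define n where "n = (\<lambda>\<alpha>. max (- r \<alpha>) 0)"
    have pn: "p \<alpha> = r \<alpha> + n \<alpha>" "p \<alpha> \<ge> 0" "n \<alpha> \<ge> 0" "p \<alpha> * n \<alpha> = 0" for \<alpha>
      by (auto simp: p_def n_def max_def)
    have "(\<Sum>\<alpha>\<in>\<Pi>. \<Sum>\<beta>\<in>\<Pi>. p \<alpha> * p \<beta> * root_form \<alpha> \<beta>)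
        = (\<Sum>\<beta>\<in>\<Pi>. \<Sum>\<alpha>\<in>\<Pi>. p \<alpha> * p \<beta> * root_form \<alpha> \<beta>)"
      by (rule sum.swap)
    also have "\<dots> = (\<Sum>\<beta>\<in>\<Pi>. p \<beta> * (\<Sum>\<alpha>\<in>\<Pi>. r \<alpha> * root_form \<alpha> \<beta>) + (\<Sum>\<alpha>\<in>\<Pi>. n \<alpha> * p \<beta> * root_form \<alpha> \<beta>))"
      by (rule sum.cong) (simp_all add: pn(1) sum_distrib_left sum.distrib[symmetric] algebra_simps)
    also have "\<dots> = (\<Sum>\<beta>\<in>\<Pi>. \<Sum>\<alpha>\<in>\<Pi>. n \<alpha> * p \<beta> * root_form \<alpha> \<beta>)"
      by (rule sum.cong) (simp_all add: rel)
    also have "\<dots> \<le> 0"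
    proof (intro sum_nonpos)
      fix \<alpha> \<beta> assume "\<alpha> \<in> \<Pi>" "\<beta> \<in> \<Pi>"
      show "n \<alpha> * p \<beta> * root_form \<alpha> \<beta> \<le> 0"
      proof (cases "\<alpha> = \<beta>")
        case True
        then have "n \<alpha> * p \<beta> = 0" using pn(4)[of \<alpha>] by (simp add: mult.commute)
        then show ?thesis by (simp only: mult_zero_left order_refl)
      next
        case False
        then show ?thesis using pn simple_obtuse[OF \<open>\<alpha> \<in> \<Pi>\<close> \<open>\<beta> \<in> \<Pi>\<close>] by (intro mult_nonneg_nonpos) auto
      qed
    qed
    finally have Q: "(\<Sum>\<alpha>\<in>\<Pi>. \<Sum>\<beta>\<in>\<Pi>. p \<alpha> * p \<beta> * root_form \<alpha> \<beta>) \<le> 0" .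
    have "(\<Sum>\<alpha>\<in>\<Pi>. p \<alpha> * root_form \<alpha> \<phi>) = 0" if \<phi>: "\<phi> \<in> P" for \<phi>
    proof -
      note \<phi>r = positive_root[OF \<phi>]
      have "(\<Sum>\<alpha>\<in>\<Pi>. of_real (p \<alpha>) * \<alpha> (root_dual \<phi>)) = 0"
        by (rule root_form_definite(2)[OF finite_simple _ Q root_dual(1)[OF \<phi>r]]) (use simple_root in blast)
      moreover have "\<alpha> (root_dual \<phi>) = of_real (root_form \<alpha> \<phi>)" if "\<alpha> \<in> \<Pi>" for \<alpha>
        using root_form(1)[OF \<phi>r roots_weights] root_form_commute[OF \<phi>r] simple_root[OF that] by simp
      then have "(\<Sum>\<alpha>\<in>\<Pi>. of_real (p \<alpha>) * \<alpha> (root_dual \<phi>)) = of_real (\<Sum>\<alpha>\<in>\<Pi>. p \<alpha> * root_form \<alpha> \<phi>)"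
        by simp
      ultimately show ?thesis using of_real_eq_0_iff by metis
    qed
    then have "0 = (\<Sum>\<phi>\<in>P. \<Sum>\<alpha>\<in>\<Pi>. p \<alpha> * root_form \<alpha> \<phi>)" by simp
    also have "\<dots> = (\<Sum>\<alpha>\<in>\<Pi>. p \<alpha> * (\<Sum>\<phi>\<in>P. root_form \<alpha> \<phi>))"
      by (subst sum.swap) (simp add: sum_distrib_left)
    finally have "(\<Sum>\<alpha>\<in>\<Pi>. p \<alpha> * (\<Sum>\<phi>\<in>P. root_form \<alpha> \<phi>)) = 0" by simp
    then have "p \<alpha> * (\<Sum>\<phi>\<in>P. root_form \<alpha> \<phi>) = 0"
      using pn(2) root_form_sum_positive less_imp_le \<alpha>
      by (subst (asm) sum_nonneg_eq_0_iff[OF finite_simple]) (auto intro!: mult_nonneg_nonneg)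
    then have "p \<alpha> = 0" using root_form_sum_positive[OF \<alpha>] by simp
    then show ?thesis by (simp add: p_def max_def split: if_splits)
  qed
  have "r \<alpha> \<le> 0" using nonpos rel \<alpha> by blast
  moreover have "- r \<alpha> \<le> 0" by (rule nonpos[of "\<lambda>\<alpha>. - r \<alpha>"]) (use rel \<alpha> in \<open>auto simp: sum_negf\<close>)
  ultimately show ?thesis by simp
qed

text \<open>The Gram matrix of \<open>\<Pi>\<close> is real, so a complex relation evaluated at the
  \<open>root_dual\<close>s splits into its real and imaginary parts.\<close>

lemma simple_independent:
  assumes rel: "\<And>x. x \<in> h \<Longrightarrow> (\<Sum>\<alpha>\<in>\<Pi>. c \<alpha> * \<alpha> x) = 0" and \<alpha>: "\<alpha> \<in> \<Pi>"
  shows "c \<alpha> = 0"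
proof -
  have rel': "(\<Sum>\<alpha>\<in>\<Pi>. c \<alpha> * of_real (root_form \<alpha> \<beta>)) = 0" if \<beta>: "\<beta> \<in> \<Pi>" for \<beta>
  proof -
    note \<beta>r = simple_root[OF \<beta>]
    have "\<alpha> (root_dual \<beta>) = of_real (root_form \<alpha> \<beta>)" if "\<alpha> \<in> \<Pi>" for \<alpha>
      using root_form(1)[OF \<beta>r roots_weights] root_form_commute[OF \<beta>r] simple_root[OF that] by simp
    then have "(\<Sum>\<alpha>\<in>\<Pi>. c \<alpha> * of_real (root_form \<alpha> \<beta>)) = (\<Sum>\<alpha>\<in>\<Pi>. c \<alpha> * \<alpha> (root_dual \<beta>))"
      by simp
    then show ?thesis using rel[OF root_dual(1)[OF \<beta>r]] by simp
  qed
  have "Re (c \<alpha>) = 0"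
  proof (rule simple_gram_nonsingular[where r = "\<lambda>\<alpha>. Re (c \<alpha>)", OF _ \<alpha>])
    fix \<beta> assume "\<beta> \<in> \<Pi>"
    from arg_cong[OF rel'[OF this], of Re] show "(\<Sum>\<alpha>\<in>\<Pi>. Re (c \<alpha>) * root_form \<alpha> \<beta>) = 0"
      by simp
  qed
  moreover have "Im (c \<alpha>) = 0"
  proof (rule simple_gram_nonsingular[where r = "\<lambda>\<alpha>. Im (c \<alpha>)", OF _ \<alpha>])
    fix \<beta> assume "\<beta> \<in> \<Pi>"
    from arg_cong[OF rel'[OF this], of Im] show "(\<Sum>\<alpha>\<in>\<Pi>. Im (c \<alpha>) * root_form \<alpha> \<beta>) = 0"
      by simp
  qed
  ultimately show ?thesis by (simp add: complex_eq_iff)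
qed

lemma dual_basis:
  assumes "finite S" "S \<subseteq> dual_on h"
    and "\<And>c \<alpha>. (\<And>x. x \<in> h \<Longrightarrow> (\<Sum>\<alpha>\<in>S. c \<alpha> * \<alpha> x) = 0) \<Longrightarrow> \<alpha> \<in> S \<Longrightarrow> c \<alpha> = 0"
  shows "\<exists>X. \<forall>\<alpha>\<in>S. X \<alpha> \<in> h \<and> (\<forall>\<beta>\<in>S. \<beta> (X \<alpha>) = (if \<beta> = \<alpha> then 1 else 0))"
  using assms
proof (induction S rule: finite_induct)
  case empty
  then show ?case by simp
next
  case (insert \<gamma> S)
  have "\<exists>X. \<forall>\<alpha>\<in>S. X \<alpha> \<in> h \<and> (\<forall>\<beta>\<in>S. \<beta> (X \<alpha>) = (if \<beta> = \<alpha> then 1 else 0))"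
  proof (rule insert.IH)
    fix c \<alpha> assume c: "\<And>x. x \<in> h \<Longrightarrow> (\<Sum>\<alpha>\<in>S. c \<alpha> * \<alpha> x) = 0" and \<alpha>: "\<alpha> \<in> S"
    have "(\<Sum>\<alpha>\<in>S. (c(\<gamma> := 0)) \<alpha> * \<alpha> x) = (\<Sum>\<alpha>\<in>S. c \<alpha> * \<alpha> x)" for x
      by (rule sum.cong) (use insert.hyps in auto)
    then have "(\<Sum>\<alpha>\<in>insert \<gamma> S. (c(\<gamma> := 0)) \<alpha> * \<alpha> x) = 0" if "x \<in> h" for x
      using c[OF that] insert.hyps by simp
    then have "(c(\<gamma> := 0)) \<alpha> = 0" using insert.prems(2) \<alpha> by blast
    moreover have "\<alpha> \<noteq> \<gamma>" using \<alpha> insert.hyps by blast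
    ultimately show "c \<alpha> = 0" by simp
  qed (use insert.prems in auto)
  then obtain X where X: "\<And>\<alpha>. \<alpha> \<in> S \<Longrightarrow> X \<alpha> \<in> h"
    "\<And>\<alpha> \<beta>. \<alpha> \<in> S \<Longrightarrow> \<beta> \<in> S \<Longrightarrow> \<beta> (X \<alpha>) = (if \<beta> = \<alpha> then 1 else 0)" by blast
  have lin: "\<beta> (\<Sum>\<alpha>\<in>S. a \<alpha> *\<^sub>C X \<alpha>) = (\<Sum>\<alpha>\<in>S. a \<alpha> * \<beta> (X \<alpha>)) \<and> (\<Sum>\<alpha>\<in>S. a \<alpha> *\<^sub>C X \<alpha>) \<in> h"
    if "\<beta> \<in> dual_on h" for \<beta> a
    using that X(1) subspace_h
    by (simp add: dual_on_sum dual_on_scale lie.subspace_scale lie.subspace_sum)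
  have dual: "\<beta> \<in> dual_on h" if "\<beta> \<in> insert \<gamma> S" for \<beta> using insert.prems(1) that by blast
  \<comment> \<open>By independence, \<gamma> is not the combination of \<open>S\<close> that agrees
    with it on the vectors \<open>X \<beta>\<close>, so the two differ at some
    \<open>z\<close>.\<close>
  obtain z where z: "z \<in> h" "\<gamma> z \<noteq> (\<Sum>\<beta>\<in>S. \<gamma> (X \<beta>) * \<beta> z)"
  proof (rule ccontr)
    assume "\<not> thesis"
    then have eq: "\<And>x. x \<in> h \<Longrightarrow> \<gamma> x = (\<Sum>\<beta>\<in>S. \<gamma> (X \<beta>) * \<beta> x)" using that by blast
    let ?c = "\<lambda>\<beta>. if \<beta> = \<gamma> then - 1 else \<gamma> (X \<beta>)"
    have "(\<Sum>\<beta>\<in>S. ?c \<beta> * \<beta> x) = (\<Sum>\<beta>\<in>S. \<gamma> (X \<beta>) * \<beta> x)" for x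
      by (rule sum.cong) (use insert.hyps in auto)
    then have "(\<Sum>\<beta>\<in>insert \<gamma> S. ?c \<beta> * \<beta> x) = 0" if "x \<in> h" for x
      using insert.hyps eq[OF that] by simp
    then have "?c \<gamma> = 0" using insert.prems(2)[of ?c \<gamma>] by blast
    then show False by simp
  qed
  \<comment> \<open>Subtracting the part of \<open>z\<close> seen by \<open>S\<close> makes
    \<open>z'\<close> a common zero of \<open>S\<close>, with \<gamma>(z') still nonzero. Rescaled
    to \<open>Z\<close>, it is dual to \<gamma> and serves to clear the value of \<gamma> from the
    other vectors.\<close>
  define z' where "z' = z - (\<Sum>\<beta>\<in>S. \<beta> z *\<^sub>C X \<beta>)"
  have z'h: "z' \<in> h"
    unfolding z'_def using lin[of \<gamma> "\<lambda>\<beta>. \<beta> z"] dual z(1) subspace_h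
    by (intro lie.subspace_diff) auto
  have z'eq: "\<beta> z' = \<beta> z - (\<Sum>\<alpha>\<in>S. \<alpha> z * \<beta> (X \<alpha>))" if "\<beta> \<in> insert \<gamma> S" for \<beta>
  proof -
    have "\<beta> z = \<beta> (z' + (\<Sum>\<beta>\<in>S. \<beta> z *\<^sub>C X \<beta>))" by (simp add: z'_def)
    also have "\<dots> = \<beta> z' + (\<Sum>\<alpha>\<in>S. \<alpha> z * \<beta> (X \<alpha>))"
      using lin[OF dual[OF that], of "\<lambda>\<beta>. \<beta> z"] dual[OF that] z'h
      by (simp add: dual_on_add)
    finally show ?thesis by simp
  qed
  have z'S: "\<beta> z' = 0" if "\<beta> \<in> S" for \<beta>
  proof -
    have "(\<Sum>\<alpha>\<in>S. \<alpha> z * \<beta> (X \<alpha>)) = (\<Sum>\<alpha>\<in>S. if \<alpha> = \<beta> then \<alpha> z else 0)"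
      by (rule sum.cong) (use X(2)[OF _ that] in auto)
    then show ?thesis using z'eq[of \<beta>] that insert.hyps(1) by simp
  qed
  have z'\<gamma>: "\<gamma> z' \<noteq> 0" using z'eq[of \<gamma>] z(2) by (simp add: mult.commute)
  define Z where "Z = inverse (\<gamma> z') *\<^sub>C z'"
  have Z: "Z \<in> h" "\<gamma> Z = 1" "\<And>\<beta>. \<beta> \<in> S \<Longrightarrow> \<beta> Z = 0"
    unfolding Z_def using z'h z'\<gamma> z'S dual subspace_h by (auto simp: lie.subspace_scale dual_on_scale)
  let ?X = "\<lambda>\<alpha>. if \<alpha> = \<gamma> then Z else X \<alpha> + (- \<gamma> (X \<alpha>)) *\<^sub>C Z"
  have "?X \<alpha> \<in> h \<and> (\<forall>\<beta>\<in>insert \<gamma> S. \<beta> (?X \<alpha>) = (if \<beta> = \<alpha> then 1 else 0))" if \<alpha>: "\<alpha> \<in> insert \<gamma> S" for \<alpha>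
  proof (cases "\<alpha> = \<gamma>")
    case True
    then show ?thesis using Z insert.hyps by auto
  next
    case False
    then have \<alpha>S: "\<alpha> \<in> S" using \<alpha> by simp
    have h: "X \<alpha> \<in> h" "(- \<gamma> (X \<alpha>)) *\<^sub>C Z \<in> h"
      by (rule X(1)[OF \<alpha>S]) (rule lie.subspace_scale[OF subspace_h Z(1)])
    have eq: "\<beta> (?X \<alpha>) = \<beta> (X \<alpha>) - \<gamma> (X \<alpha>) * \<beta> Z" if "\<beta> \<in> insert \<gamma> S" for \<beta>
      using False dual_on_add[OF dual[OF that] h] dual_on_scale[OF dual[OF that] Z(1), of "- \<gamma> (X \<alpha>)"] by simp
    have "?X \<alpha> \<in> h" using False lie.subspace_add[OF subspace_h h] by simp
    moreover have "\<gamma> (?X \<alpha>) = 0" using eq[of \<gamma>] Z(2) by simp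
    moreover have "\<beta> (?X \<alpha>) = (if \<beta> = \<alpha> then 1 else 0)" if "\<beta> \<in> S" for \<beta>
      using eq[of \<beta>] Z(3)[OF that] X(2)[OF \<alpha>S that] that by simp
    ultimately show ?thesis using False by auto
  qed
  then show ?case by (intro exI[of _ ?X] ballI)
qed

text \<open>The fundamental coweights. Those attached to simple roots outside the Levi factor will
  form a basis of its centre.\<close>

lemma simple_dual_basis:
  "\<exists>X. \<forall>\<alpha>\<in>\<Pi>. X \<alpha> \<in> h \<and> (\<forall>\<beta>\<in>\<Pi>. \<beta> (X \<alpha>) = (if \<beta> = \<alpha> then 1 else 0))"
proof (rule dual_basis[OF finite_simple])
  show "\<Pi> \<subseteq> dual_on h" using simple_root roots_weights weights_dual by blast
  fix c \<alpha> assume "\<And>x. x \<in> h \<Longrightarrow> (\<Sum>\<alpha>\<in>\<Pi>. c \<alpha> * \<alpha> x) = 0" "\<alpha> \<in> \<Pi>"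
  then show "c \<alpha> = 0" by (rule simple_independent)
qed

text \<open>The predicate under the definite description in \<open>root_coeff\<close>; vanishing off
  \<open>\<Pi>\<close> makes the coefficient function unique.\<close>

definition expansion :: "(('g \<Rightarrow> complex) \<Rightarrow> int) \<Rightarrow> ('g \<Rightarrow> complex) \<Rightarrow> bool" where
  "expansion c \<phi> \<longleftrightarrow> (\<forall>\<alpha>. \<alpha> \<notin> \<Pi> \<longrightarrow> c \<alpha> = 0) \<and> \<phi> = (\<lambda>x. \<Sum>\<alpha>\<in>\<Pi>. of_int (c \<alpha>) * \<alpha> x)"

lemma expansion_unique:
  assumes "expansion c \<phi>" "expansion d \<phi>"
  shows "c = d"
proof
  fix \<alpha>
  show "c \<alpha> = d \<alpha>"
  proof (cases "\<alpha> \<in> \<Pi>")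
    case True
    have eq: "(\<Sum>\<alpha>\<in>\<Pi>. of_int (c \<alpha>) * \<alpha> x) = (\<Sum>\<alpha>\<in>\<Pi>. of_int (d \<alpha>) * \<alpha> x)" for x
      using assms unfolding expansion_def by (metis (no_types, lifting))
    have "of_int (c \<alpha>) - of_int (d \<alpha>) = (0 :: complex)"
      by (rule simple_independent[where c = "\<lambda>\<alpha>. of_int (c \<alpha>) - of_int (d \<alpha>)", OF _ True])
        (simp add: left_diff_distrib sum_subtractf eq)
    then show ?thesis by simp
  qed (use assms in \<open>simp add: expansion_def\<close>)
qed

lemma root_coeff_eqI: "expansion c \<phi> \<Longrightarrow> root_coeff P \<phi> = c"
  unfolding root_coeff_def
  by (rule the_equality) (use expansion_unique in \<open>auto simp: expansion_def\<close>)

lemma expansion_simple: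
  assumes \<alpha>: "\<alpha> \<in> \<Pi>"
  shows "expansion (\<lambda>\<beta>. if \<beta> = \<alpha> then 1 else 0) \<alpha>"
proof -
  have "(\<Sum>\<beta>\<in>\<Pi>. of_int (if \<beta> = \<alpha> then 1 else 0) * \<beta> x) = (\<Sum>\<beta>\<in>\<Pi>. if \<beta> = \<alpha> then \<alpha> x else 0)" for x
    by (rule sum.cong) auto
  then show ?thesis using \<alpha> finite_simple by (auto simp: expansion_def)
qed

lemma expansion_add: "expansion c \<phi> \<Longrightarrow> expansion d \<psi> \<Longrightarrow> expansion (\<lambda>\<alpha>. c \<alpha> + d \<alpha>) (\<phi> + \<psi>)"
  by (auto simp: expansion_def fun_eq_iff distrib_right sum.distrib)

lemma expansion_uminus: "expansion c \<phi> \<Longrightarrow> expansion (\<lambda>\<alpha>. - c \<alpha>) (- \<phi>)"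
  by (auto simp: expansion_def fun_eq_iff sum_negf)

lemma positive_expansion:
  assumes "\<phi> \<in> P"
  shows "expansion (root_coeff P \<phi>) \<phi> \<and> (\<forall>\<alpha>. root_coeff P \<phi> \<alpha> \<ge> 0)"
  using assms
proof (induction \<phi> rule: positive_induct)
  case (simple \<alpha>)
  then show ?case using expansion_simple root_coeff_eqI[OF expansion_simple] by auto
next
  case (add \<phi> \<psi>)
  then have e: "expansion (\<lambda>\<alpha>. root_coeff P \<phi> \<alpha> + root_coeff P \<psi> \<alpha>) (\<phi> + \<psi>)"
    using expansion_add by blast
  show ?case
  proof (intro conjI allI)
    show "expansion (root_coeff P (\<phi> + \<psi>)) (\<phi> + \<psi>)" unfolding root_coeff_eqI[OF e] by (rule e)
    show "root_coeff P (\<phi> + \<psi>) \<alpha> \<ge> 0" for \<alpha>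
      unfolding root_coeff_eqI[OF e] using add.IH by simp
  qed
qed

lemma root_coeff_expansion:
  assumes "\<phi> \<in> roots h"
  shows "expansion (root_coeff P \<phi>) \<phi>"
proof (cases "\<phi> \<in> P")
  case False
  then have "- \<phi> \<in> P" using not_positive[OF assms] by blast
  then have "expansion (\<lambda>\<alpha>. - root_coeff P (- \<phi>) \<alpha>) (- (- \<phi>))"
    using positive_expansion expansion_uminus by blast
  then show ?thesis using root_coeff_eqI[of _ \<phi>] by simp
qed (use positive_expansion in blast)

lemma root_coeff_uminus: "\<phi> \<in> roots h \<Longrightarrow> root_coeff P (- \<phi>) \<alpha> = - root_coeff P \<phi> \<alpha>"
  using root_coeff_eqI[OF expansion_uminus[OF root_coeff_expansion]] by simp

lemma root_coeff_add:
  "\<phi> \<in> roots h \<Longrightarrow> \<psi> \<in> roots h \<Longrightarrow> root_coeff P (\<phi> + \<psi>) \<alpha> = root_coeff P \<phi> \<alpha> + root_coeff P \<psi> \<alpha>"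
  using root_coeff_eqI[OF expansion_add[OF root_coeff_expansion root_coeff_expansion]] by simp

lemma root_coeff_simple: "\<alpha> \<in> \<Pi> \<Longrightarrow> root_coeff P \<alpha> \<beta> = (if \<beta> = \<alpha> then 1 else 0)"
  using root_coeff_eqI[OF expansion_simple] by simp

end

section \<open>Obtuse systems\<close>

text \<open>The inverse of a positive definite symmetric matrix with nonpositive off-diagonal
  entries (a Stieltjes matrix) is entrywise nonnegative. One index \<open>k\<close> is eliminated at
  a time, by solving on \<open>S\<close> for the right-hand sides \<open>b\<close> and
  \<open>B k\<close>.\<close>

lemma obtuse_system_solution_nonpos:
  fixes B :: "'i \<Rightarrow> 'i \<Rightarrow> real"
  assumes "finite S"
    and "\<And>i j. i \<in> S \<Longrightarrow> j \<in> S \<Longrightarrow> B i j = B j i"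
    and "\<And>i j. i \<in> S \<Longrightarrow> j \<in> S \<Longrightarrow> i \<noteq> j \<Longrightarrow> B i j \<le> 0"
    and "\<And>c i. (\<Sum>i\<in>S. \<Sum>j\<in>S. c i * c j * B i j) \<le> 0 \<Longrightarrow> i \<in> S \<Longrightarrow> c i = 0"
    and "\<And>i. i \<in> S \<Longrightarrow> b i \<le> 0"
  shows "\<exists>c. \<forall>i\<in>S. c i \<le> 0 \<and> (\<Sum>j\<in>S. c j * B j i) = b i"
  using assms
proof (induction S arbitrary: b rule: finite_induct)
  case empty
  then show ?case by simp
next
  case (insert k S)
  have notin: "i \<noteq> k" if "i \<in> S" for i using that insert.hyps by blast
  have pd: "c i = 0" if Q: "(\<Sum>i\<in>S. \<Sum>j\<in>S. c i * c j * B i j) \<le> 0" and i: "i \<in> S" for c i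
  proof -
    let ?c = "c(k := 0)"
    have "(\<Sum>j\<in>insert k S. ?c i * ?c j * B i j) = (\<Sum>j\<in>S. c i * c j * B i j)" if "i \<in> S" for i
      using insert.hyps notin[OF that] notin by (auto intro!: sum.cong)
    then have "(\<Sum>i\<in>insert k S. \<Sum>j\<in>insert k S. ?c i * ?c j * B i j) = (\<Sum>i\<in>S. \<Sum>j\<in>S. c i * c j * B i j)"
      using insert.hyps by simp
    then have "?c i = 0" using insert.prems(3)[of ?c i] Q i by simp
    then show ?thesis using notin[OF i] by simp
  qed
  have IH: "\<exists>c. \<forall>i\<in>S. c i \<le> 0 \<and> (\<Sum>j\<in>S. c j * B j i) = b i" if "\<And>i. i \<in> S \<Longrightarrow> b i \<le> 0" for b
    by (rule insert.IH) (use insert.prems(1,2) pd that in auto)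
  obtain u where u: "\<And>i. i \<in> S \<Longrightarrow> u i \<le> 0" "\<And>i. i \<in> S \<Longrightarrow> (\<Sum>j\<in>S. u j * B j i) = b i"
    using IH[of b] insert.prems(4) by auto
  have Bk: "B k i \<le> 0" "B i k \<le> 0" if "i \<in> S" for i
    using insert.prems(2)[of k i] insert.prems(2)[of i k] notin[OF that] that by auto
  obtain w where w: "\<And>i. i \<in> S \<Longrightarrow> w i \<le> 0" "\<And>i. i \<in> S \<Longrightarrow> (\<Sum>j\<in>S. w j * B j i) = B k i"
    using IH[of "B k"] Bk by auto
  \<comment> \<open>The Schur complement of the block \<open>S\<close>. It is the value of the form
    at the vector with entry 1 at \<open>k\<close> and entries -w on \<open>S\<close>, hence
    positive.\<close>
  define \<sigma> where "\<sigma> = B k k - (\<Sum>j\<in>S. w j * B j k)"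
  have "\<sigma> > 0"
  proof (rule ccontr)
    assume "\<not> \<sigma> > 0"
    let ?v = "\<lambda>i. if i = k then 1 else - w i"
    have col: "(\<Sum>j\<in>insert k S. ?v j * B j i) = B k i - (\<Sum>j\<in>S. w j * B j i)" for i
    proof -
      have "(\<Sum>j\<in>S. ?v j * B j i) = (\<Sum>j\<in>S. - (w j * B j i))"
        by (rule sum.cong) (use notin in auto)
      then show ?thesis using insert.hyps by (simp add: sum_negf)
    qed
    have "(\<Sum>i\<in>insert k S. \<Sum>j\<in>insert k S. ?v i * ?v j * B i j)
        = (\<Sum>i\<in>insert k S. ?v i * (\<Sum>j\<in>insert k S. ?v j * B j i))"
      unfolding sum_distrib_left using insert.prems(1) by (intro sum.cong) auto
    also have "\<dots> = (\<Sum>i\<in>insert k S. if i = k then \<sigma> else 0)"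
      unfolding col by (rule sum.cong) (use w(2) in \<open>auto simp: \<sigma>_def\<close>)
    also have "\<dots> = \<sigma>" using insert.hyps(1) by simp
    finally have "?v k = 0"
      using insert.prems(3)[of ?v k] \<open>\<not> \<sigma> > 0\<close> by simp
    then show False by simp
  qed
  \<comment> \<open>The entry of the solution at \<open>k\<close>, from the one equation left after
    elimination. It is nonpositive because \<open>b k\<close> is and the subtracted sum, of products
    of nonpositive numbers, is nonnegative.\<close>
  define s where "s = (b k - (\<Sum>j\<in>S. u j * B j k)) / \<sigma>"
  have s\<sigma>: "s * \<sigma> = b k - (\<Sum>j\<in>S. u j * B j k)" using \<open>\<sigma> > 0\<close> by (simp add: s_def)
  have "(\<Sum>j\<in>S. u j * B j k) \<ge> 0"
    using u(1) Bk(2) by (intro sum_nonneg mult_nonpos_nonpos)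
  then have "s \<le> 0"
    unfolding s_def using insert.prems(4)[of k] \<open>\<sigma> > 0\<close> by (intro divide_nonpos_pos) auto
  let ?c = "\<lambda>i. if i = k then s else u i - s * w i"
  have col: "(\<Sum>j\<in>insert k S. ?c j * B j i) = s * B k i + (\<Sum>j\<in>S. u j * B j i) - s * (\<Sum>j\<in>S. w j * B j i)" for i
  proof -
    have "(\<Sum>j\<in>S. ?c j * B j i) = (\<Sum>j\<in>S. u j * B j i - s * (w j * B j i))"
      by (rule sum.cong) (use notin in \<open>auto simp: left_diff_distrib\<close>)
    then show ?thesis using insert.hyps by (simp add: sum_subtractf sum_distrib_left)
  qed
  have "?c i \<le> 0 \<and> (\<Sum>j\<in>insert k S. ?c j * B j i) = b i" if "i \<in> insert k S" for i
  proof (cases "i = k")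
    case True
    have "s * B k k - s * (\<Sum>j\<in>S. w j * B j k) = s * \<sigma>" by (simp add: \<sigma>_def right_diff_distrib)
    then show ?thesis using True \<open>s \<le> 0\<close> s\<sigma> unfolding col by simp
  next
    case False
    then have i: "i \<in> S" using that by blast
    have "s * w i \<ge> 0" using \<open>s \<le> 0\<close> w(1)[OF i] by (rule mult_nonpos_nonpos)
    then have "u i - s * w i \<le> 0" using u(1)[OF i] by linarith
    then show ?thesis using False u(2)[OF i] w(2)[OF i] unfolding col by simp
  qed
  then show ?case by (intro exI[of _ ?c] ballI)
qed

section \<open>Parabolic subalgebras\<close>

lemma lie_ideal_nilradical:
  assumes "lie.subspace q"
  shows "lie_ideal (nilradical q) q"
  unfolding lie_ideal_def
proof (intro conjI ballI)
  show "lie.subspace (nilradical q)" by (simp add: nilradical_def)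
  show "nilradical q \<subseteq> q"
    unfolding nilradical_def using assms by (intro lie.span_minimal) (auto simp: lie_ideal_def)
  fix x y assume x: "x \<in> q" and y: "y \<in> nilradical q"
  show "bracket x y \<in> nilradical q"
    unfolding nilradical_def
  proof (rule bracket_span_right[OF lie.subspace_span _ y[unfolded nilradical_def]])
    fix a assume "a \<in> \<Union> {I. lie_ideal I q \<and> lie_nilpotent I}"
    then obtain I where I: "lie_ideal I q" "lie_nilpotent I" "a \<in> I" by blast
    then have "bracket x a \<in> I" using x by (simp add: lie_ideal_def)
    then show "bracket x a \<in> lie.span (\<Union> {I. lie_ideal I q \<and> lie_nilpotent I})"
      using I by (intro lie.span_base) blast
  qed
qed

context cartan
begin

lemma stable_weight_space:
  assumes "t \<subseteq> h" "x \<in> h" "z \<in> weight_space t \<nu>"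
  shows "bracket x z \<in> weight_space t \<nu>"
  unfolding weight_space_def
proof safe
  fix s assume s: "s \<in> t"
  have "bracket s (bracket x z) = bracket (bracket s x) z + bracket x (bracket s z)"
    by (simp add: bracket_bracket_left)
  then show "bracket s (bracket x z) = \<nu> s *\<^sub>C bracket x z"
    using s assms bracket_h_h[of s x] weight_spaceD[OF assms(3) s]
    by (auto simp: bracket_scaleC_right)
qed

end

context semisimple_cartan
begin

text \<open>Root spaces are lines, so a subspace cannot contain just a part of one.\<close>

lemma root_space_subset:
  assumes "\<phi> \<in> roots h" "lie.subspace W" "z \<in> \<gg> \<phi>" "z \<in> W" "z \<noteq> 0"
  shows "\<gg> \<phi> \<subseteq> W"
  using root_space_line[OF assms(1,3,5)] assms(2,4) lie.subspace_scale by blast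

end

locale parabolic = positive_roots h P for h :: "'g::complex_lie_algebra set" and P +
  fixes q m :: "'g set"
  assumes standard_parabolic: "standard_parabolic h P q"
    and levi_factor: "levi_factor m q"
    and h_subset_m: "h \<subseteq> m"
begin

abbreviation n :: "'g set" where "n \<equiv> nilradical q"

definition t :: "'g set" where "t = lie_center m"

lemma subspaces: "lie.subspace q" "lie.subspace m" "lie.subspace n"
  using standard_parabolic levi_factor
  by (simp_all add: standard_parabolic_def levi_factor_def lie_subalgebra_def nilradical_def)

lemma closed_m: "x \<in> m \<Longrightarrow> y \<in> m \<Longrightarrow> bracket x y \<in> m"
  using levi_factor by (simp add: levi_factor_def lie_subalgebra_def)

lemma closed_n: "x \<in> q \<Longrightarrow> y \<in> n \<Longrightarrow> bracket x y \<in> n"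
  using lie_ideal_nilradical[OF subspaces(1)] by (simp add: lie_ideal_def)

lemma m_inter_n: "x \<in> m \<Longrightarrow> x \<in> n \<Longrightarrow> x = 0"
  using levi_factor by (auto simp: levi_factor_def)

lemma q_decomposition:
  assumes "x \<in> q" shows "\<exists>y\<in>m. \<exists>z\<in>n. x = y + z"
proof -
  have "q = {x + y | x y. x \<in> m \<and> y \<in> n}" using levi_factor by (simp add: levi_factor_def)
  then have "x \<in> {x + y | x y. x \<in> m \<and> y \<in> n}" using assms by simp
  then show ?thesis by blast
qed

lemma m_subset_q: "m \<subseteq> q"
proof
  fix x assume "x \<in> m"
  moreover have "0 \<in> n" using subspaces(3) by (rule lie.subspace_0)
  moreover have "q = {x + y | x y. x \<in> m \<and> y \<in> n}" using levi_factor by (simp add: levi_factor_def)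
  ultimately have "x + 0 \<in> q" by blast
  then show "x \<in> q" by simp
qed

lemma positive_root_space_q: "\<phi> \<in> P \<Longrightarrow> \<gg> \<phi> \<subseteq> q"
  using standard_parabolic lie.span_superset[of "h \<union> (\<Union>\<phi>\<in>P. \<gg> \<phi>)"]
  unfolding standard_parabolic_def borel_def by blast

text \<open>Phrased by inclusion where \<open>roots_in\<close> asks for a nonzero intersection; the
  two agree because root spaces are lines.\<close>

definition levi_roots :: "('g \<Rightarrow> complex) set" where
  "levi_roots = {\<phi> \<in> roots h. \<gg> \<phi> \<subseteq> m}"

lemma levi_rootI: "\<phi> \<in> roots h \<Longrightarrow> z \<in> \<gg> \<phi> \<Longrightarrow> z \<in> m \<Longrightarrow> z \<noteq> 0 \<Longrightarrow> \<phi> \<in> levi_roots"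
  using root_space_subset[of \<phi> m z] subspaces by (simp add: levi_roots_def)

lemma levi_roots: "\<phi> \<in> levi_roots \<Longrightarrow> \<phi> \<in> roots h"
  by (simp add: levi_roots_def)

lemma roots_in_eq: "roots_in h m = levi_roots"
proof safe
  fix \<phi> assume "\<phi> \<in> roots_in h m"
  then show "\<phi> \<in> levi_roots"
    using levi_rootI lie.subspace_0[OF subspace_weight_space, of h \<phi>] lie.subspace_0[OF subspaces(2)]
    unfolding roots_in_def by blast
next
  fix \<phi> assume "\<phi> \<in> levi_roots"
  then show "\<phi> \<in> roots_in h m"
    using root_vector[of \<phi>] unfolding roots_in_def levi_roots_def by blast
qed

lemma levi_root_not_n:
  assumes "\<phi> \<in> levi_roots" shows "\<not> \<gg> \<phi> \<subseteq> n"
proof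
  assume "\<gg> \<phi> \<subseteq> n"
  moreover obtain e where "e \<in> \<gg> \<phi>" "e \<noteq> 0" using root_vector levi_roots[OF assms] .
  ultimately show False using assms m_inter_n[of e] by (auto simp: levi_roots_def)
qed

text \<open>Split a root vector as e = x + y with x in \<open>m\<close> and y in \<open>n\<close>,
  both stable under \<open>h\<close>, and compare components of weight \<phi>: the one in
  \<open>m\<close> must vanish, so e lies in \<open>n\<close>.\<close>

lemma positive_not_levi:
  assumes \<phi>: "\<phi> \<in> P" and not: "\<phi> \<notin> levi_roots"
  shows "\<gg> \<phi> \<subseteq> n"
proof -
  note r = positive_root[OF \<phi>]
  obtain e where e: "e \<in> \<gg> \<phi>" "e \<noteq> 0" using root_vector[OF r] .
  then obtain x y where xy: "x \<in> m" "y \<in> n" "e = x + y"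
    using q_decomposition positive_root_space_q[OF \<phi>] by blast
  have st: "bracket v z \<in> m" if "v \<in> h" "z \<in> m" for v z using that closed_m h_subset_m by blast
  have st': "bracket v z \<in> n" if "v \<in> h" "z \<in> n" for v z using that closed_n h_subset_m m_subset_q by blast
  obtain a where a: "\<And>\<psi>. \<psi> \<in> weights \<Longrightarrow> a \<psi> \<in> \<gg> \<psi> \<inter> m" "x = (\<Sum>\<psi>\<in>weights. a \<psi>)"
    using weight_decomposition_stable[OF subspaces(2) st xy(1)] by blast
  obtain b where b: "\<And>\<psi>. \<psi> \<in> weights \<Longrightarrow> b \<psi> \<in> \<gg> \<psi> \<inter> n" "y = (\<Sum>\<psi>\<in>weights. b \<psi>)"
    using weight_decomposition_stable[OF subspaces(3) st' xy(2)] by blast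
  let ?w = "\<lambda>\<psi>. a \<psi> + b \<psi> - (if \<psi> = \<phi> then e else 0)"
  have "?w \<phi> = 0"
  proof (rule weight_vectors_independent[OF finite_weights subset_refl, where w = ?w])
    show "?w \<psi> \<in> \<gg> \<psi>" if "\<psi> \<in> weights" for \<psi>
      using a(1)[OF that] b(1)[OF that] e(1)
      by (auto intro!: lie.subspace_diff lie.subspace_add subspace_weight_space)
    show "(\<Sum>\<psi>\<in>weights. ?w \<psi>) = 0"
      using xy(3) a(2) b(2) finite_weights roots_weights[OF r] by (simp add: sum.distrib sum_subtractf)
  qed (rule roots_weights[OF r])
  then have "e = a \<phi> + b \<phi>" by simp
  moreover have "a \<phi> = 0" using levi_rootI[OF r, of "a \<phi>"] a(1)[OF roots_weights[OF r]] not by auto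
  ultimately have "e \<in> n" using b(1)[OF roots_weights[OF r]] by simp
  then show ?thesis using root_space_subset[OF r subspaces(3) e(1)] e(2) by blast
qed

text \<open>Otherwise the space of -\<phi> lies in \<open>q\<close>, and its bracket with that of
  \<phi> gives a nonzero element of \<open>h\<close> inside the ideal \<open>n\<close>, although
  \<open>m\<close> and \<open>n\<close> meet in 0.\<close>

lemma n_root_positive:
  assumes \<phi>: "\<phi> \<in> roots h" and n: "\<gg> \<phi> \<subseteq> n"
  shows "\<phi> \<in> P"
proof (rule ccontr)
  assume "\<phi> \<notin> P"
  then have q: "\<gg> (- \<phi>) \<subseteq> q" using not_positive[OF \<phi>] positive_root_space_q by blast
  obtain e where e: "e \<in> \<gg> \<phi>" "e \<noteq> 0" using root_vector[OF \<phi>] .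
  obtain f where f: "f \<in> \<gg> (- \<phi>)" "f \<noteq> 0" using root_vector[OF uminus_root[OF \<phi>]] .
  have "bracket f e \<in> n" using closed_n e f n q by blast
  then have "bracket e f \<in> n" using bracket_skew[of e f] lie.subspace_neg[OF subspaces(3)] by simp
  moreover have "bracket e f \<in> m" using bracket_opposite[OF e(1) f(1)] h_subset_m by blast
  ultimately show False using m_inter_n bracket_opposite_nonzero[OF \<phi> e f] by blast
qed

text \<open>The radical of the Killing form restricted to the Levi factor is an ideal; complete
  reducibility forces it to vanish, which makes the set of its roots symmetric.\<close>

lemma levi_roots_uminus:
  assumes \<phi>: "\<phi> \<in> levi_roots"
  shows "- \<phi> \<in> levi_roots"
proof (rule ccontr)
  assume not: "- \<phi> \<notin> levi_roots"
  note r = levi_roots[OF \<phi>]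
  define I where "I = {x \<in> m. \<forall>y\<in>m. killing_form x y = 0}"
  have "lie_ideal I m"
    unfolding lie_ideal_def
  proof (intro conjI ballI)
    show "lie.subspace I"
      using subspaces(2)
      by (auto simp: I_def lie.subspace_def killing_form_add_left killing_form_scale_left)
    fix x y assume x: "x \<in> m" and y: "y \<in> I"
    have "killing_form (bracket x y) z = 0" if z: "z \<in> m" for z
      using killing_form_invariant[of y x z] bracket_skew[of x y] killing_form_diff_left[of 0 "bracket y x" z]
        closed_m[OF x z] y by (simp add: I_def)
    then show "bracket x y \<in> I" using closed_m x y by (simp add: I_def)
  qed (auto simp: I_def)
  moreover have "lie_reductive m" using levi_factor by (simp add: levi_factor_def)
  ultimately have "\<exists>J. lie_ideal J m \<and> I \<inter> J = {0} \<and> m = {x + y | x y. x \<in> I \<and> y \<in> J}"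
    unfolding lie_reductive_def by simp
  then obtain J where J: "lie_ideal J m" "I \<inter> J = {0}" "m = {x + y | x y. x \<in> I \<and> y \<in> J}"
    by (elim exE conjE)
  have ideals: "\<And>x y. x \<in> m \<Longrightarrow> y \<in> I \<Longrightarrow> bracket x y \<in> I" "\<And>x y. x \<in> m \<Longrightarrow> y \<in> J \<Longrightarrow> bracket x y \<in> J"
    "lie.subspace I" "lie.subspace J" "I \<subseteq> m" "J \<subseteq> m"
    using \<open>lie_ideal I m\<close> J(1) by (auto simp: lie_ideal_def)
  obtain e where e: "e \<in> \<gg> \<phi>" "e \<noteq> 0" using root_vector[OF r] .
  have em: "e \<in> m" using e \<phi> by (auto simp: levi_roots_def)
  have "e \<in> I"
    unfolding I_def
  proof (safe intro!: em)
    fix y assume "y \<in> m"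
    moreover have "bracket v z \<in> m" if "v \<in> h" "z \<in> m" for v z using that closed_m h_subset_m by blast
    ultimately obtain w where w: "\<And>\<psi>. \<psi> \<in> weights \<Longrightarrow> w \<psi> \<in> \<gg> \<psi> \<inter> m" "y = (\<Sum>\<psi>\<in>weights. w \<psi>)"
      using weight_decomposition_stable[OF subspaces(2)] by blast
    have "killing_form e (w \<psi>) = 0" if \<psi>: "\<psi> \<in> weights" for \<psi>
    proof (cases "\<psi> = - \<phi>")
      case True
      then have "w \<psi> = 0" using levi_rootI[OF uminus_root[OF r], of "w \<psi>"] w(1)[OF \<psi>] not by auto
      then show ?thesis by simp
    next
      case False
      then show ?thesis
        using killing_form_weight_orthogonal[of \<phi> \<psi> e "w \<psi>"] w(1)[OF \<psi>] e(1) weights_dual \<psi> roots_weights[OF r]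
        by blast
    qed
    then show "killing_form e y = 0" by (simp add: w(2) killing_form_sum_right)
  qed
  obtain x where x: "x \<in> h" "\<phi> x \<noteq> 0" using root_nonzero[OF r] by blast
  have "x \<in> {x + y | x y. x \<in> I \<and> y \<in> J}" using x(1) h_subset_m unfolding J(3)[symmetric] by blast
  then obtain i j where ij: "i \<in> I" "j \<in> J" "x = i + j" by blast
  \<comment> \<open>For y in \<open>h\<close> the bracket [y, i] = -[y, j] lies in both ideals and
    vanishes, so i centralizes \<open>h\<close> and thus belongs to it; being orthogonal to
    \<open>h\<close>, it is 0. Then x lies in \<open>J\<close>, and [x, e], a nonzero multiple of e,
    would lie in both ideals.\<close>
  have "i = 0"
  proof (rule killing_form_h_nondegenerate)
    show "i \<in> h"
    proof (rule centralizer_h)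
      fix y assume y: "y \<in> h"
      then have ym: "y \<in> m" using h_subset_m by blast
      have "bracket y i + bracket y j = 0" using bracket_h_h[OF y x(1)] ij(3) by (simp add: bracket_add_right)
      then have "bracket y i = - bracket y j" by (simp only: eq_neg_iff_add_eq_0)
      then have "bracket y i \<in> J" using ideals(2)[OF ym ij(2)] lie.subspace_neg[OF ideals(4)] by simp
      then show "bracket y i = 0" using ideals(1)[OF ym ij(1)] J(2) by blast
    qed
    show "killing_form i y = 0" if "y \<in> h" for y using ij(1) that h_subset_m by (auto simp: I_def)
  qed
  then have "x \<in> J" using ij by simp
  then have "bracket e x \<in> J" using ideals(2) em by blast
  then have "bracket x e \<in> J" using bracket_skew[of x e] lie.subspace_neg[OF ideals(4)] by simp
  moreover have "bracket x e \<in> I" using ideals(1) \<open>e \<in> I\<close> x(1) h_subset_m by blast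
  ultimately have "bracket x e = 0" using J(2) by blast
  then show False using weight_spaceD[OF e(1) x(1)] x(2) e(2) by simp
qed

lemma levi_roots_add:
  assumes "\<phi> \<in> levi_roots" "\<psi> \<in> levi_roots" "\<phi> + \<psi> \<in> roots h"
  shows "\<phi> + \<psi> \<in> levi_roots"
proof -
  obtain e where e: "e \<in> \<gg> \<phi>" "e \<noteq> 0" using root_vector levi_roots[OF assms(1)] .
  obtain y where y: "y \<in> \<gg> \<psi>" "y \<noteq> 0" using root_vector levi_roots[OF assms(2)] .
  show ?thesis
  proof (rule levi_rootI[OF assms(3)])
    show "bracket e y \<in> \<gg> (\<phi> + \<psi>)" using bracket_weight_space e y by blast
    show "bracket e y \<in> m" using closed_m e y assms by (auto simp: levi_roots_def)
    show "bracket e y \<noteq> 0"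
      using bracket_root_spaces_nonzero levi_roots assms e y by blast
  qed
qed

text \<open>If \<phi> is not Levi, its space lies in the ideal \<open>n\<close>; bracketing with the
  space of \<psi> gives a nonzero vector of \<open>n\<close> of weight \<phi> + \<psi>, which is
  impossible for a root of \<open>m\<close>.\<close>

lemma levi_root_summand:
  assumes \<phi>: "\<phi> \<in> P" and \<psi>: "\<psi> \<in> P" and sum: "\<phi> + \<psi> \<in> levi_roots"
  shows "\<phi> \<in> levi_roots"
proof (rule ccontr)
  assume not: "\<phi> \<notin> levi_roots"
  obtain e where e: "e \<in> \<gg> \<phi>" "e \<noteq> 0" using root_vector positive_root[OF \<phi>] .
  obtain y where y: "y \<in> \<gg> \<psi>" "y \<noteq> 0" using root_vector positive_root[OF \<psi>] .
  have "bracket y e \<in> n" using closed_n positive_not_levi[OF \<phi> not] positive_root_space_q[OF \<psi>] e y by blast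
  then have "bracket e y \<in> n" using bracket_skew[of e y] lie.subspace_neg[OF subspaces(3)] by simp
  moreover have "bracket e y \<in> \<gg> (\<phi> + \<psi>)" using bracket_weight_space e y by blast
  moreover have "bracket e y \<noteq> 0"
    using bracket_root_spaces_nonzero positive_root \<phi> \<psi> levi_roots[OF sum] e y by blast
  ultimately show False
    using root_space_subset[OF levi_roots[OF sum] subspaces(3)] levi_root_not_n[OF sum] by blast
qed

abbreviation A :: "('g \<Rightarrow> complex) set" where "A \<equiv> \<Pi> - levi_roots"

text \<open>Both conditions hold for a sum of positive roots exactly when they hold for both
  summands: the left one by closure of \<open>m\<close> and the ideal property of \<open>n\<close>,
  the right one because coefficients are nonnegative. So simple roots suffice.\<close>

lemma positive_levi_iff:
  assumes "\<phi> \<in> P"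
  shows "\<phi> \<in> levi_roots \<longleftrightarrow> (\<forall>\<alpha>\<in>A. root_coeff P \<phi> \<alpha> = 0)"
  using assms
proof (induction \<phi> rule: positive_induct)
  case (simple \<alpha>)
  then show ?case by (auto simp: root_coeff_simple)
next
  case (add \<phi> \<psi>)
  have "\<phi> + \<psi> \<in> levi_roots \<longleftrightarrow> \<phi> \<in> levi_roots \<and> \<psi> \<in> levi_roots"
    using levi_roots_add positive_root[OF add.hyps(3)] levi_root_summand[OF add.hyps(1,2)]
      levi_root_summand[OF add.hyps(2,1)] add.commute[of \<phi> \<psi>] by metis
  moreover have "root_coeff P (\<phi> + \<psi>) \<alpha> = 0 \<longleftrightarrow> root_coeff P \<phi> \<alpha> = 0 \<and> root_coeff P \<psi> \<alpha> = 0" for \<alpha>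
    using positive_expansion[OF add.hyps(1)] positive_expansion[OF add.hyps(2)]
    by (simp add: root_coeff_add positive_root add.hyps add_nonneg_eq_0_iff)
  ultimately show ?case using add.IH by blast
qed

lemma levi_iff:
  assumes "\<phi> \<in> roots h"
  shows "\<phi> \<in> levi_roots \<longleftrightarrow> (\<forall>\<alpha>\<in>A. root_coeff P \<phi> \<alpha> = 0)"
proof (cases "\<phi> \<in> P")
  case False
  then have "- \<phi> \<in> P" using not_positive[OF assms] by blast
  moreover have "\<phi> \<in> levi_roots \<longleftrightarrow> - \<phi> \<in> levi_roots"
    using levi_roots_uminus[of \<phi>] levi_roots_uminus[of "- \<phi>"] by auto
  ultimately show ?thesis using positive_levi_iff[of "- \<phi>"] root_coeff_uminus[OF assms] by simp
qed (rule positive_levi_iff)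

section \<open>The centre of the Levi factor as a subspace of the Cartan subalgebra\<close>

lemma t_subset_h: "t \<subseteq> h"
proof
  fix x assume x: "x \<in> t"
  show "x \<in> h"
  proof (rule centralizer_h)
    fix y assume "y \<in> h"
    then have "bracket x y = 0" using x h_subset_m by (auto simp: t_def lie_center_def)
    then show "bracket y x = 0" using bracket_skew[of y x] by simp
  qed
qed

lemma t_iff_levi: "x \<in> t \<longleftrightarrow> x \<in> h \<and> (\<forall>\<phi>\<in>levi_roots. \<phi> x = 0)"
proof safe
  assume x: "x \<in> t"
  then show "x \<in> h" using t_subset_h by blast
  fix \<phi> assume \<phi>: "\<phi> \<in> levi_roots"
  obtain e where e: "e \<in> \<gg> \<phi>" "e \<noteq> 0" using root_vector levi_roots[OF \<phi>] .
  then have "bracket x e = 0" using x \<phi> by (auto simp: t_def lie_center_def levi_roots_def)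
  then show "\<phi> x = 0" using weight_spaceD[OF e(1)] e(2) \<open>x \<in> h\<close> by simp
next
  assume x: "x \<in> h" "\<forall>\<phi>\<in>levi_roots. \<phi> x = 0"
  have "bracket x y = 0" if y: "y \<in> m" for y
  proof -
    have "bracket v z \<in> m" if "v \<in> h" "z \<in> m" for v z using that closed_m h_subset_m by blast
    then obtain w where w: "\<And>\<psi>. \<psi> \<in> weights \<Longrightarrow> w \<psi> \<in> \<gg> \<psi> \<inter> m" "y = (\<Sum>\<psi>\<in>weights. w \<psi>)"
      using weight_decomposition_stable[OF subspaces(2) _ y] by blast
    have "bracket x (w \<psi>) = 0" if \<psi>: "\<psi> \<in> weights" for \<psi>
    proof (cases "\<psi> = 0 \<or> w \<psi> = 0")
      case True
      then show ?thesis using w(1)[OF \<psi>] weight_space_0 bracket_h_h[OF x(1)] by auto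
    next
      case False
      then have "\<psi> \<in> levi_roots" using levi_rootI[of \<psi> "w \<psi>"] w(1)[OF \<psi>] \<psi> by (auto simp: weights_def)
      then show ?thesis using weight_spaceD[of "w \<psi>" h \<psi> x] w(1)[OF \<psi>] x by simp
    qed
    then show ?thesis by (simp add: w(2) bracket_sum_right)
  qed
  then show "x \<in> t" using x h_subset_m by (auto simp: t_def lie_center_def)
qed

lemma root_on_h: "\<phi> \<in> roots h \<Longrightarrow> \<phi> x = (\<Sum>\<alpha>\<in>\<Pi>. of_int (root_coeff P \<phi> \<alpha>) * \<alpha> x)"
  using root_coeff_expansion[of \<phi>] unfolding expansion_def by metis

lemma t_iff: "x \<in> t \<longleftrightarrow> x \<in> h \<and> (\<forall>\<alpha>\<in>\<Pi> \<inter> levi_roots. \<alpha> x = 0)"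
proof
  assume x: "x \<in> h \<and> (\<forall>\<alpha>\<in>\<Pi> \<inter> levi_roots. \<alpha> x = 0)"
  have "\<phi> x = 0" if \<phi>: "\<phi> \<in> levi_roots" for \<phi>
  proof -
    have "of_int (root_coeff P \<phi> \<alpha>) * \<alpha> x = 0" if "\<alpha> \<in> \<Pi>" for \<alpha>
      using x that \<phi> levi_iff[OF levi_roots[OF \<phi>]] by (cases "\<alpha> \<in> levi_roots") auto
    then have "(\<Sum>\<alpha>\<in>\<Pi>. of_int (root_coeff P \<phi> \<alpha>) * \<alpha> x) = 0" by (intro sum.neutral ballI)
    then show ?thesis by (rule trans[OF root_on_h[OF levi_roots[OF \<phi>]]])
  qed
  then show "x \<in> t" using x t_iff_levi by blast
qed (use t_iff_levi in blast)

lemma subspace_t: "lie.subspace t"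
proof (rule lie.subspaceI)
  have z: "\<phi> 0 = 0" if "\<phi> \<in> levi_roots" for \<phi>
    using dual_on_scale[OF weights_dual[OF roots_weights[OF levi_roots[OF that]]], of 0 0] lie.subspace_0[OF subspace_h]
    by simp
  show "0 \<in> t" using z t_iff_levi lie.subspace_0[OF subspace_h] by blast
  fix x assume x: "x \<in> t"
  have d: "\<phi> \<in> dual_on h" if "\<phi> \<in> levi_roots" for \<phi>
    using weights_dual roots_weights levi_roots that by blast
  show "x + y \<in> t" if y: "y \<in> t" for y
  proof -
    have "\<phi> (x + y) = 0" if "\<phi> \<in> levi_roots" for \<phi>
    proof -
      have "\<phi> x = 0" "\<phi> y = 0" using x y that t_iff_levi by blast+
      moreover have "x \<in> h" "y \<in> h" using x y t_subset_h by blast+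
      ultimately show ?thesis by (simp add: dual_on_add[OF d[OF that]])
    qed
    moreover have "x + y \<in> h" using x y t_subset_h by (intro lie.subspace_add subspace_h) auto
    ultimately show ?thesis using t_iff_levi by blast
  qed
  show "c *\<^sub>C x \<in> t" for c
  proof -
    have "\<phi> (c *\<^sub>C x) = 0" if "\<phi> \<in> levi_roots" for \<phi>
    proof -
      have "\<phi> x = 0" using x that t_iff_levi by blast
      moreover have "x \<in> h" using x t_subset_h by blast
      ultimately show ?thesis by (simp add: dual_on_scale[OF d[OF that]])
    qed
    moreover have "c *\<^sub>C x \<in> h" using x t_subset_h by (intro lie.subspace_scale subspace_h) auto
    ultimately show ?thesis using t_iff_levi by blast
  qed
qed

lemma root_on_t:
  assumes "\<phi> \<in> roots h" "x \<in> t"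
  shows "\<phi> x = (\<Sum>\<alpha>\<in>A. of_int (root_coeff P \<phi> \<alpha>) * \<alpha> x)"
  by (rule trans[OF root_on_h[OF assms(1)] sum.mono_neutral_right])
    (use finite_simple assms(2) t_iff in auto)

lemma finite_A: "finite A"
  using finite_simple by simp

lemma A_root: "\<alpha> \<in> A \<Longrightarrow> \<alpha> \<in> roots h"
  using simple_root by blast

text \<open>The coweight dual to a member \<alpha> of \<open>A\<close> is annihilated by the simple
  roots of \<open>m\<close>, so it lies in \<open>t\<close>; evaluation there isolates the
  coefficient of \<alpha>.\<close>

lemma A_independent_on_t:
  assumes "\<And>x. x \<in> t \<Longrightarrow> (\<Sum>\<alpha>\<in>A. c \<alpha> * \<alpha> x) = 0" "\<alpha> \<in> A"
  shows "c \<alpha> = 0"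
proof -
  obtain X where X: "\<And>\<alpha>. \<alpha> \<in> \<Pi> \<Longrightarrow> X \<alpha> \<in> h"
    "\<And>\<alpha> \<beta>. \<alpha> \<in> \<Pi> \<Longrightarrow> \<beta> \<in> \<Pi> \<Longrightarrow> \<beta> (X \<alpha>) = (if \<beta> = \<alpha> then 1 else 0)"
    using simple_dual_basis by blast
  have "\<beta> (X \<alpha>) = 0" if "\<beta> \<in> \<Pi> \<inter> levi_roots" for \<beta>
    using X(2)[of \<alpha> \<beta>] that assms(2) by auto
  then have "X \<alpha> \<in> t" using X(1) assms(2) by (simp add: t_iff)
  then have "0 = (\<Sum>\<beta>\<in>A. c \<beta> * \<beta> (X \<alpha>))" using assms(1) by simp
  also have "\<dots> = (\<Sum>\<beta>\<in>A. if \<beta> = \<alpha> then c \<beta> else 0)"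
  proof (rule sum.cong[OF refl])
    fix \<beta> assume "\<beta> \<in> A"
    then show "c \<beta> * \<beta> (X \<alpha>) = (if \<beta> = \<alpha> then c \<beta> else 0)"
      using X(2)[of \<alpha> \<beta>] assms(2) by simp
  qed
  also have "\<dots> = c \<alpha>" using assms(2) finite_A by simp
  finally show ?thesis by simp
qed

text \<open>The coweights of the members of \<open>A\<close> form a basis of \<open>t\<close>. An
  element y has coordinates \<alpha>(y), because its difference from that combination is annihilated
  by all simple roots and hence by all roots.\<close>

lemma dim_t: "lie.dim t = card A"
proof -
  obtain X where X: "\<And>\<alpha>. \<alpha> \<in> \<Pi> \<Longrightarrow> X \<alpha> \<in> h"
    "\<And>\<alpha> \<beta>. \<alpha> \<in> \<Pi> \<Longrightarrow> \<beta> \<in> \<Pi> \<Longrightarrow> \<beta> (X \<alpha>) = (if \<beta> = \<alpha> then 1 else 0)"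
    using simple_dual_basis by blast
  have Xt: "X \<alpha> \<in> t" if \<alpha>: "\<alpha> \<in> A" for \<alpha>
  proof -
    have "\<beta> (X \<alpha>) = 0" if "\<beta> \<in> \<Pi> \<inter> levi_roots" for \<beta>
      using X(2)[of \<alpha> \<beta>] that \<alpha> by auto
    then show ?thesis using X(1) \<alpha> by (simp add: t_iff)
  qed
  have inj: "inj_on X A"
  proof (rule inj_onI)
    fix \<alpha> \<beta> assume "\<alpha> \<in> A" "\<beta> \<in> A" "X \<alpha> = X \<beta>"
    then show "\<alpha> = \<beta>" using X(2)[of \<alpha> \<alpha>] X(2)[of \<beta> \<alpha>] by (auto split: if_splits)
  qed
  have lin: "\<beta> (\<Sum>\<alpha>\<in>A. c \<alpha> *\<^sub>C X \<alpha>) = (if \<beta> \<in> A then c \<beta> else 0)" if \<beta>: "\<beta> \<in> \<Pi>" for \<beta> c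
  proof -
    have d: "\<beta> \<in> dual_on h" using weights_dual roots_weights simple_root \<beta> by blast
    have "\<beta> (\<Sum>\<alpha>\<in>A. c \<alpha> *\<^sub>C X \<alpha>) = (\<Sum>\<alpha>\<in>A. \<beta> (c \<alpha> *\<^sub>C X \<alpha>))"
      by (rule dual_on_sum[OF d]) (use X(1) lie.subspace_scale[OF subspace_h] in blast)
    also have "\<dots> = (\<Sum>\<alpha>\<in>A. c \<alpha> * \<beta> (X \<alpha>))"
      by (rule sum.cong[OF refl], rule dual_on_scale[OF d]) (use X(1) in blast)
    also have "\<dots> = (\<Sum>\<alpha>\<in>A. if \<alpha> = \<beta> then c \<alpha> else 0)"
      by (rule sum.cong) (use X(2)[OF _ \<beta>] in auto)
    finally show ?thesis using finite_A by simp
  qed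
  show ?thesis
  proof (rule lie.dim_unique)
    show "X ` A \<subseteq> t" using Xt by blast
    show "card (X ` A) = card A" using inj by (rule card_image)
    show "lie.independent (X ` A)"
    proof (rule lie.independent_if_scalars_zero)
      fix c x assume c: "(\<Sum>x\<in>X ` A. c x *\<^sub>C x) = 0" and "x \<in> X ` A"
      then obtain \<alpha> where \<alpha>: "\<alpha> \<in> A" "x = X \<alpha>" by blast
      have "(\<Sum>\<alpha>\<in>A. c (X \<alpha>) *\<^sub>C X \<alpha>) = 0" using c by (simp add: sum.reindex[OF inj])
      then have "c (X \<alpha>) = \<alpha> 0" using lin[of \<alpha> "\<lambda>\<alpha>. c (X \<alpha>)"] \<alpha>(1) by simp
      also have "\<alpha> 0 = 0"
        using lin[of \<alpha> "\<lambda>\<alpha>. 0"] \<alpha>(1) by simp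
      finally show "c x = 0" using \<alpha>(2) by simp
    qed (use finite_A in simp)
    show "t \<subseteq> lie.span (X ` A)"
    proof
      fix y assume y: "y \<in> t"
      let ?s = "\<Sum>\<alpha>\<in>A. \<alpha> y *\<^sub>C X \<alpha>"
      have sh: "?s \<in> h" using X(1) subspace_h by (intro lie.subspace_sum lie.subspace_scale) auto
      have yh: "y \<in> h" using y t_subset_h by blast
      have "y - ?s = 0"
      proof (rule h_eq_0I)
        show d: "y - ?s \<in> h" using lie.subspace_diff[OF subspace_h yh sh] .
        fix \<phi> assume \<phi>: "\<phi> \<in> roots h"
        have "of_int (root_coeff P \<phi> \<alpha>) * \<alpha> (y - ?s) = 0" if \<alpha>: "\<alpha> \<in> \<Pi>" for \<alpha>
        proof -
          have "\<alpha> ((y - ?s) + ?s) = \<alpha> (y - ?s) + \<alpha> ?s"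
            using weights_dual roots_weights simple_root \<alpha> d sh dual_on_add by blast
          then have "\<alpha> y = \<alpha> (y - ?s) + (if \<alpha> \<in> A then \<alpha> y else 0)" using lin[OF \<alpha>] by simp
          moreover have "\<alpha> y = 0" if "\<alpha> \<in> levi_roots" using y \<alpha> that t_iff by blast
          ultimately have "\<alpha> (y - ?s) = 0" using \<alpha> by (cases "\<alpha> \<in> levi_roots") auto
          then show ?thesis by simp
        qed
        then have "(\<Sum>\<alpha>\<in>\<Pi>. of_int (root_coeff P \<phi> \<alpha>) * \<alpha> (y - ?s)) = 0" by (intro sum.neutral ballI)
        then show "\<phi> (y - ?s) = 0" by (rule trans[OF root_on_h[OF \<phi>]])
      qed
      then have "y = ?s" by simp
      also have "?s \<in> lie.span (X ` A)" by (intro lie.span_sum lie.span_scale lie.span_base) blast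
      finally show "y \<in> lie.span (X ` A)" .
    qed
  qed
qed

end

section \<open>Restricted roots\<close>

context parabolic
begin

abbreviation res :: "('g \<Rightarrow> complex) \<Rightarrow> 'g \<Rightarrow> complex" where
  "res \<phi> \<equiv> restrict_to t \<phi>"

lemma res_expansion:
  assumes "\<phi> \<in> roots h"
  shows "res \<phi> = (\<lambda>x. \<Sum>\<alpha>\<in>A. of_int (root_coeff P \<phi> \<alpha>) * res \<alpha> x)"
proof
  fix x show "res \<phi> x = (\<Sum>\<alpha>\<in>A. of_int (root_coeff P \<phi> \<alpha>) * res \<alpha> x)"
    using root_on_t[OF assms, of x] by (cases "x \<in> t") (simp_all add: restrict_to_def)
qed

lemma res_add: "res (\<phi> + \<psi>) = res \<phi> + res \<psi>"
  by (auto simp: restrict_to_def fun_eq_iff)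

lemma res_zero [simp]: "res 0 = 0"
  by (auto simp: restrict_to_def fun_eq_iff)

lemma res_coeff_unique:
  assumes eq: "\<And>x. x \<in> t \<Longrightarrow> (\<Sum>\<alpha>\<in>A. of_int (c \<alpha>) * \<alpha> x) = (\<Sum>\<alpha>\<in>A. of_int (d \<alpha>) * \<alpha> x)"
    and "\<alpha> \<in> A"
  shows "c \<alpha> = (d \<alpha> :: int)"
proof -
  have "of_int (c \<alpha>) - of_int (d \<alpha>) = (0 :: complex)"
    by (rule A_independent_on_t[where c = "\<lambda>\<alpha>. of_int (c \<alpha>) - of_int (d \<alpha>)", OF _ assms(2)])
      (simp add: left_diff_distrib sum_subtractf eq)
  then show ?thesis by simp
qed

text \<open>Restriction forgets the coefficients at simple roots of \<open>m\<close> but keeps those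
  at \<open>A\<close>, which stay independent on \<open>t\<close>. This is why
  \<open>restricted_coeff\<close> is well defined.\<close>

lemma res_eq_coeff:
  assumes "\<phi> \<in> roots h" "\<psi> \<in> roots h" "res \<phi> = res \<psi>" "\<alpha> \<in> A"
  shows "root_coeff P \<phi> \<alpha> = root_coeff P \<psi> \<alpha>"
proof (rule res_coeff_unique[OF _ assms(4)])
  fix x assume x: "x \<in> t"
  have "\<phi> x = \<psi> x" using fun_cong[OF assms(3), of x] x by (simp add: restrict_to_def)
  then show "(\<Sum>\<alpha>\<in>A. of_int (root_coeff P \<phi> \<alpha>) * \<alpha> x) = (\<Sum>\<alpha>\<in>A. of_int (root_coeff P \<psi> \<alpha>) * \<alpha> x)"
    unfolding root_on_t[OF assms(1) x, symmetric] root_on_t[OF assms(2) x, symmetric] .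
qed

lemma res_eq_0_iff:
  assumes "\<phi> \<in> roots h"
  shows "res \<phi> = 0 \<longleftrightarrow> \<phi> \<in> levi_roots"
proof
  assume \<phi>: "\<phi> \<in> levi_roots"
  show "res \<phi> = 0"
  proof
    fix x show "res \<phi> x = 0 x"
      using \<phi> t_iff_levi[of x] by (cases "x \<in> t") (simp_all add: restrict_to_def)
  qed
next
  assume z: "res \<phi> = 0"
  have "root_coeff P \<phi> \<alpha> = 0" if "\<alpha> \<in> A" for \<alpha>
  proof (rule res_coeff_unique[where d = "\<lambda>_. 0", OF _ that])
    fix x assume x: "x \<in> t"
    then have "\<phi> x = 0" using fun_cong[OF z, of x] by (simp add: restrict_to_def)
    then show "(\<Sum>\<alpha>\<in>A. of_int (root_coeff P \<phi> \<alpha>) * \<alpha> x) = (\<Sum>\<alpha>\<in>A. of_int 0 * \<alpha> x)"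
      unfolding root_on_t[OF assms x, symmetric] by simp
  qed
  then show "\<phi> \<in> levi_roots" using levi_iff[OF assms] by blast
qed

lemma weight_space_res: "\<gg> \<phi> \<subseteq> weight_space t (res \<phi>)"
  using t_subset_h by (auto simp: weight_space_def restrict_to_def)

lemma res_dual: "\<phi> \<in> dual_on h \<Longrightarrow> res \<phi> \<in> dual_on t"
  unfolding dual_on_def[of t]
proof safe
  fix x y assume \<phi>: "\<phi> \<in> dual_on h" and "x \<in> t" "y \<in> t"
  moreover from this have "x + y \<in> t" using lie.subspace_add[OF subspace_t] by blast
  ultimately show "res \<phi> (x + y) = res \<phi> x + res \<phi> y"
    using dual_on_add[OF \<phi>, of x y] t_subset_h by (simp add: restrict_to_def subset_eq)
next
  fix c x assume \<phi>: "\<phi> \<in> dual_on h" and "x \<in> t"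
  moreover from this have "c *\<^sub>C x \<in> t" using lie.subspace_scale[OF subspace_t] by blast
  ultimately show "res \<phi> (c *\<^sub>C x) = c * res \<phi> x"
    using dual_on_scale[OF \<phi>, of x c] t_subset_h by (simp add: restrict_to_def subset_eq)
qed (simp add: restrict_to_def)

text \<open>A \<open>t\<close>-weight space is stable under \<open>h\<close>, so it is the sum of
  its parts in the weight spaces of \<open>h\<close>; a nonzero part of weight \<psi> has \<psi>
  restricting to \<nu>.\<close>

lemma weight_space_t_decomposition:
  assumes "z \<in> weight_space t \<nu>" "\<nu> \<in> dual_on t"
  shows "\<exists>w. z = (\<Sum>\<psi>\<in>weights. w \<psi>) \<and>
    (\<forall>\<psi>\<in>weights. w \<psi> \<in> \<gg> \<psi> \<and> (w \<psi> \<noteq> 0 \<longrightarrow> res \<psi> = \<nu>))"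
proof -
  obtain w where w: "\<And>\<psi>. \<psi> \<in> weights \<Longrightarrow> w \<psi> \<in> \<gg> \<psi> \<inter> weight_space t \<nu>" "z = (\<Sum>\<psi>\<in>weights. w \<psi>)"
    using weight_decomposition_stable[OF subspace_weight_space stable_weight_space[OF t_subset_h] assms(1)]
    by blast
  have "res \<psi> = \<nu>" if \<psi>: "\<psi> \<in> weights" and nz: "w \<psi> \<noteq> 0" for \<psi>
  proof
    fix x show "res \<psi> x = \<nu> x"
    proof (cases "x \<in> t")
      case True
      have "bracket x (w \<psi>) = \<psi> x *\<^sub>C w \<psi>" "bracket x (w \<psi>) = \<nu> x *\<^sub>C w \<psi>"
        using weight_spaceD[of "w \<psi>" h \<psi> x] weight_spaceD[of "w \<psi>" t \<nu> x] w(1)[OF \<psi>] True t_subset_h by blast+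
      then show ?thesis using nz True by (simp add: restrict_to_def)
    next
      case False
      then show ?thesis using assms(2) by (simp add: restrict_to_def dual_on_def)
    qed
  qed
  then show ?thesis using w by blast
qed

lemma roots_t: "roots t = res ` (roots h - levi_roots)"
proof safe
  fix \<nu> assume \<nu>: "\<nu> \<in> roots t"
  then obtain z where z: "z \<in> weight_space t \<nu>" "z \<noteq> 0"
    using lie.subspace_0[OF subspace_weight_space, of t \<nu>] by (auto simp: roots_def)
  have "\<nu> \<in> dual_on t" "\<nu> \<noteq> 0" using \<nu> by (auto simp: roots_def)
  obtain w where w: "z = (\<Sum>\<psi>\<in>weights. w \<psi>)"
    "\<And>\<psi>. \<psi> \<in> weights \<Longrightarrow> w \<psi> \<in> \<gg> \<psi> \<and> (w \<psi> \<noteq> 0 \<longrightarrow> res \<psi> = \<nu>)"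
    using weight_space_t_decomposition[OF z(1) \<open>\<nu> \<in> dual_on t\<close>] by blast
  obtain \<psi> where \<psi>: "\<psi> \<in> weights" "w \<psi> \<noteq> 0"
  proof (rule ccontr)
    assume "\<not> thesis"
    then have "\<And>\<psi>. \<psi> \<in> weights \<Longrightarrow> w \<psi> = 0" using that by blast
    then show False using z(2) w(1) by simp
  qed
  then have res: "res \<psi> = \<nu>" using w(2) by blast
  have "\<psi> \<noteq> 0" using res \<open>\<nu> \<noteq> 0\<close> by fastforce
  then have r: "\<psi> \<in> roots h" using \<psi>(1) by (simp add: weights_def)
  then have "\<psi> \<notin> levi_roots" using res_eq_0_iff[OF r] res \<open>\<nu> \<noteq> 0\<close> by blast
  then show "\<nu> \<in> res ` (roots h - levi_roots)" using r res by blast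
next
  fix \<phi> assume \<phi>: "\<phi> \<in> roots h" "\<phi> \<notin> levi_roots"
  obtain e where "e \<in> \<gg> \<phi>" "e \<noteq> 0" using root_vector[OF \<phi>(1)] .
  then have "weight_space t (res \<phi>) \<noteq> {0}" using weight_space_res by blast
  then show "res \<phi> \<in> roots t"
    using res_dual weights_dual roots_weights[OF \<phi>(1)] res_eq_0_iff[OF \<phi>(1)] \<phi>(2) by (simp add: roots_def)
qed

definition R\<^sub>p :: "('g \<Rightarrow> complex) set" where
  "R\<^sub>p = {\<nu> \<in> roots t. weight_space t \<nu> \<subseteq> n}"

lemma positive_coeff:
  assumes "\<phi> \<in> P - levi_roots"
  shows "\<exists>\<alpha>\<in>A. root_coeff P \<phi> \<alpha> > 0"
  using assms positive_levi_iff[of \<phi>] positive_expansion[of \<phi>] by (metis DiffE order_le_less)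

text \<open>Some coefficient of \<phi> at \<open>A\<close> is positive, and \<psi> shares it,
  whereas a negative root has no positive coefficient. So the \<open>t\<close>-weight space of the
  restriction involves positive roots only.\<close>

lemma same_res_positive:
  assumes \<phi>: "\<phi> \<in> P - levi_roots" and \<psi>: "\<psi> \<in> roots h" "res \<psi> = res \<phi>"
  shows "\<psi> \<in> P - levi_roots"
proof -
  have \<phi>r: "\<phi> \<in> roots h" using \<phi> positive_root by blast
  obtain \<alpha> where \<alpha>: "\<alpha> \<in> A" "root_coeff P \<phi> \<alpha> > 0" using positive_coeff[OF \<phi>] by blast
  then have "root_coeff P \<psi> \<alpha> > 0" using res_eq_coeff[OF \<psi>(1) \<phi>r \<psi>(2)] by simp
  then have "root_coeff P (- \<psi>) \<alpha> < 0" using root_coeff_uminus[OF \<psi>(1)] by simp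
  then have "- \<psi> \<notin> P" using positive_expansion[of "- \<psi>"] by (meson not_le)
  then have "\<psi> \<in> P" using not_positive[OF \<psi>(1)] by blast
  moreover have "\<psi> \<notin> levi_roots"
    using res_eq_0_iff[OF \<psi>(1)] res_eq_0_iff[OF \<phi>r] \<psi>(2) \<phi> by auto
  ultimately show ?thesis by blast
qed

lemma R\<^sub>p_eq: "R\<^sub>p = res ` (P - levi_roots)"
proof (intro set_eqI iffI)
  fix \<nu> assume "\<nu> \<in> R\<^sub>p"
  then obtain \<phi> where \<phi>: "\<phi> \<in> roots h" "\<phi> \<notin> levi_roots" "\<nu> = res \<phi>" and n: "weight_space t \<nu> \<subseteq> n"
    by (auto simp: R\<^sub>p_def roots_t)
  then have "\<gg> \<phi> \<subseteq> n" using weight_space_res by blast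
  then show "\<nu> \<in> res ` (P - levi_roots)" using n_root_positive \<phi> by blast
next
  fix \<nu> assume "\<nu> \<in> res ` (P - levi_roots)"
  then obtain \<phi> where \<phi>: "\<phi> \<in> P - levi_roots" "\<nu> = res \<phi>" by blast
  then have \<phi>r: "\<phi> \<in> roots h" using positive_root by blast
  then have \<nu>: "\<nu> \<in> roots t" using \<phi> by (auto simp: roots_t)
  have "z \<in> n" if z: "z \<in> weight_space t \<nu>" for z
  proof -
    have dual: "\<nu> \<in> dual_on t" using \<nu> by (simp add: roots_def)
    obtain w where w: "z = (\<Sum>\<psi>\<in>weights. w \<psi>)"
      "\<And>\<psi>. \<psi> \<in> weights \<Longrightarrow> w \<psi> \<in> \<gg> \<psi> \<and> (w \<psi> \<noteq> 0 \<longrightarrow> res \<psi> = \<nu>)"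
      using weight_space_t_decomposition[OF z dual] by blast
    \<comment> \<open>A nonzero part belongs to a root with the same restriction as \<phi>, hence to
      a positive root outside \<open>m\<close>, whose space lies in \<open>n\<close>.\<close>
    have "w \<psi> \<in> n" if \<psi>: "\<psi> \<in> weights" for \<psi>
    proof (cases "w \<psi> = 0")
      case True
      then show ?thesis using lie.subspace_0[OF subspaces(3)] by simp
    next
      case False
      then have res: "res \<psi> = res \<phi>" using w(2)[OF \<psi>] \<phi>(2) by simp
      moreover have "\<psi> \<noteq> 0"
      proof
        assume "\<psi> = 0"
        then have "res \<phi> = 0" using res by simp
        then show False using res_eq_0_iff[OF \<phi>r] \<phi>(1) by blast
      qed
      ultimately have "\<psi> \<in> P - levi_roots"
        using same_res_positive[OF \<phi>(1)] \<psi> by (simp add: weights_def)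
      then show ?thesis using positive_not_levi w(2)[OF \<psi>] by blast
    qed
    then show ?thesis unfolding w(1) by (rule lie.subspace_sum[OF subspaces(3)])
  qed
  then show "\<nu> \<in> R\<^sub>p" using \<nu> by (auto simp: R\<^sub>p_def)
qed

lemma A_positive: "\<alpha> \<in> A \<Longrightarrow> \<alpha> \<in> P - levi_roots"
  using simple_positive by blast

text \<open>Conversely to the splitting argument, suppose that the restriction of \<alpha> in
  \<open>A\<close> is the sum of those of \<phi> and \<psi>. Their coefficients at \<open>A\<close>
  are two nonnegative integer vectors, neither of them zero, adding up to the unit vector at
  \<alpha>; both then have a positive entry at \<alpha>, which exceeds the total 1.\<close>

lemma simple_restricted: "simple_of R\<^sub>p = res ` A"
proof (intro set_eqI iffI)
  fix \<nu> assume \<nu>: "\<nu> \<in> simple_of R\<^sub>p"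
  have "\<phi> \<notin> levi_roots \<longrightarrow> res \<phi> \<in> res ` A \<or> (\<exists>\<nu>\<^sub>1\<in>R\<^sub>p. \<exists>\<nu>\<^sub>2\<in>R\<^sub>p. res \<phi> = \<nu>\<^sub>1 + \<nu>\<^sub>2)" if "\<phi> \<in> P" for \<phi>
    using that
  proof (induction \<phi> rule: positive_induct)
    case (simple \<alpha>)
    then show ?case by blast
  next
    case (add \<phi> \<psi>)
    show ?case
    proof (cases "\<phi> \<in> levi_roots \<or> \<psi> \<in> levi_roots")
      case False
      then have "res \<phi> \<in> R\<^sub>p" "res \<psi> \<in> R\<^sub>p" using add.hyps R\<^sub>p_eq by blast+
      then show ?thesis using res_add by blast
    next
      case True
      then consider "res (\<phi> + \<psi>) = res \<psi>" "\<phi> \<in> levi_roots" | "res (\<phi> + \<psi>) = res \<phi>" "\<psi> \<in> levi_roots"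
        using res_add res_eq_0_iff levi_roots by (metis add.left_neutral add.right_neutral)
      then show ?thesis
        using add.IH res_eq_0_iff positive_root add.hyps by cases metis+
    qed
  qed
  moreover obtain \<phi> where "\<phi> \<in> P" "\<phi> \<notin> levi_roots" "\<nu> = res \<phi>"
    using \<nu> R\<^sub>p_eq by (auto simp: simple_of_def)
  ultimately show "\<nu> \<in> res ` A" using \<nu> by (auto simp: simple_of_def)
next
  fix \<nu> assume "\<nu> \<in> res ` A"
  then obtain \<alpha> where \<alpha>: "\<alpha> \<in> A" "\<nu> = res \<alpha>" by blast
  have "\<nu> \<in> R\<^sub>p" using A_positive[OF \<alpha>(1)] \<alpha>(2) R\<^sub>p_eq by blast
  moreover have False if dec: "\<nu>\<^sub>1 \<in> R\<^sub>p" "\<nu>\<^sub>2 \<in> R\<^sub>p" "\<nu> = \<nu>\<^sub>1 + \<nu>\<^sub>2" for \<nu>\<^sub>1 \<nu>\<^sub>2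
  proof -
    obtain \<phi> where \<phi>: "\<phi> \<in> P - levi_roots" "\<nu>\<^sub>1 = res \<phi>" using dec(1) R\<^sub>p_eq by blast
    obtain \<psi> where \<psi>: "\<psi> \<in> P - levi_roots" "\<nu>\<^sub>2 = res \<psi>" using dec(2) R\<^sub>p_eq by blast
    have roots: "\<phi> \<in> roots h" "\<psi> \<in> roots h" using \<phi> \<psi> positive_root by auto
    have coeff: "root_coeff P \<alpha> \<beta> = root_coeff P \<phi> \<beta> + root_coeff P \<psi> \<beta>" if "\<beta> \<in> A" for \<beta>
    proof (rule res_coeff_unique[OF _ that])
      fix x assume x: "x \<in> t"
      have "\<alpha> x = \<phi> x + \<psi> x"
      proof -
        have "res \<alpha> = res (\<phi> + \<psi>)" using dec(3) \<alpha>(2) \<phi>(2) \<psi>(2) by (simp add: res_add)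
        from fun_cong[OF this, of x] show ?thesis using x by (simp add: restrict_to_def)
      qed
      then show "(\<Sum>\<beta>\<in>A. of_int (root_coeff P \<alpha> \<beta>) * \<beta> x)
          = (\<Sum>\<beta>\<in>A. of_int (root_coeff P \<phi> \<beta> + root_coeff P \<psi> \<beta>) * \<beta> x)"
        using root_on_t[OF A_root[OF \<alpha>(1)] x] root_on_t[OF roots(1) x] root_on_t[OF roots(2) x]
        by (simp add: distrib_right sum.distrib)
    qed
    have nonneg: "root_coeff P \<phi> \<beta> \<ge> 0" "root_coeff P \<psi> \<beta> \<ge> 0" for \<beta>
      using positive_expansion \<phi>(1) \<psi>(1) by blast+
    have \<alpha>\<Pi>: "\<alpha> \<in> \<Pi>" using \<alpha>(1) by blast
    have at\<alpha>: "root_coeff P \<chi> \<alpha> > 0" if \<chi>: "\<chi> \<in> P - levi_roots" "\<chi> = \<phi> \<or> \<chi> = \<psi>" for \<chi>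
    proof -
      obtain \<beta> where \<beta>: "\<beta> \<in> A" "root_coeff P \<chi> \<beta> > 0" using positive_coeff[OF \<chi>(1)] by blast
      then have "root_coeff P \<alpha> \<beta> > 0"
        using coeff[OF \<beta>(1)] nonneg[of \<beta>] \<chi>(2) by auto
      then have "\<beta> = \<alpha>" using root_coeff_simple[OF \<alpha>\<Pi>, of \<beta>] by (auto split: if_splits)
      then show ?thesis using \<beta> by simp
    qed
    have "root_coeff P \<phi> \<alpha> + root_coeff P \<psi> \<alpha> = 1"
      using coeff[OF \<alpha>(1)] root_coeff_simple[OF \<alpha>\<Pi>, of \<alpha>] by simp
    then show False using at\<alpha>[OF \<phi>(1)] at\<alpha>[OF \<psi>(1)] by simp
  qed
  ultimately show "\<nu> \<in> simple_of R\<^sub>p" by (auto simp: simple_of_def)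
qed

section \<open>The basis property and the coefficients of restricted roots\<close>

lemma inj_on_res: "inj_on res A"
proof (rule inj_onI)
  fix \<alpha> \<beta> assume *: "\<alpha> \<in> A" "\<beta> \<in> A" "res \<alpha> = res \<beta>"
  then have "root_coeff P \<alpha> \<alpha> = root_coeff P \<beta> \<alpha>" using res_eq_coeff A_root by blast
  moreover have "\<alpha> \<in> \<Pi>" "\<beta> \<in> \<Pi>" using * by auto
  ultimately show "\<alpha> = \<beta>" by (auto simp: root_coeff_simple split: if_splits)
qed

lemma sum_fun_apply: "(\<Sum>i\<in>I. f i) x = (\<Sum>i\<in>I. f i x)"
  by (induction I rule: infinite_finite_induct) simp_all

lemma independent_restricted: "dual_real.independent (res ` A)"
proof (rule dual_real.independent_if_scalars_zero)
  show "finite (res ` A)" using finite_A by blast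
  fix c \<nu> assume c: "(\<Sum>\<nu>\<in>res ` A. real_scale (c \<nu>) \<nu>) = 0" and "\<nu> \<in> res ` A"
  then obtain \<alpha> where \<alpha>: "\<alpha> \<in> A" "\<nu> = res \<alpha>" by blast
  have "complex_of_real (c (res \<alpha>)) = 0"
  proof (rule A_independent_on_t[where c = "\<lambda>\<alpha>. complex_of_real (c (res \<alpha>))", OF _ \<alpha>(1)])
    fix x assume x: "x \<in> t"
    have "(\<Sum>\<alpha>\<in>A. real_scale (c (res \<alpha>)) (res \<alpha>)) x = 0"
      using c by (simp add: sum.reindex[OF inj_on_res])
    then show "(\<Sum>\<alpha>\<in>A. complex_of_real (c (res \<alpha>)) * \<alpha> x) = 0"
      using x by (simp add: sum_fun_apply real_scale_def restrict_to_def)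
  qed
  then show "c \<nu> = 0" using \<alpha>(2) by simp
qed

lemma span_restricted: "dual_real.span (res ` A) = dual_real.span (roots t)"
proof (rule subset_antisym)
  have "res ` A \<subseteq> roots t" using A_root by (auto simp: roots_t)
  then show "dual_real.span (res ` A) \<subseteq> dual_real.span (roots t)" by (rule dual_real.span_mono)
  have "res \<phi> \<in> dual_real.span (res ` A)" if \<phi>: "\<phi> \<in> roots h" for \<phi>
  proof -
    have "res \<phi> = (\<Sum>\<alpha>\<in>A. real_scale (of_int (root_coeff P \<phi> \<alpha>)) (res \<alpha>))"
    proof
      fix x show "res \<phi> x = (\<Sum>\<alpha>\<in>A. real_scale (of_int (root_coeff P \<phi> \<alpha>)) (res \<alpha>)) x"
        using fun_cong[OF res_expansion[OF \<phi>], of x] by (simp add: sum_fun_apply real_scale_def)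
    qed
    also have "\<dots> \<in> dual_real.span (res ` A)"
      by (intro dual_real.span_sum dual_real.span_scale dual_real.span_base) blast
    finally show ?thesis .
  qed
  then show "dual_real.span (roots t) \<subseteq> dual_real.span (res ` A)"
    by (intro dual_real.span_minimal dual_real.subspace_span) (auto simp: roots_t)
qed

lemma restricted_coeff_eq:
  assumes "\<phi> \<in> roots h" "\<alpha> \<in> A"
  shows "restricted_coeff h P t \<alpha> (res \<phi>) = root_coeff P \<phi> \<alpha>"
  unfolding restricted_coeff_def
proof (rule the_equality)
  show "\<exists>\<psi>\<in>roots h. res \<psi> = res \<phi> \<and> root_coeff P \<phi> \<alpha> = root_coeff P \<psi> \<alpha>" using assms(1) by blast
  fix k assume "\<exists>\<psi>\<in>roots h. res \<psi> = res \<phi> \<and> k = root_coeff P \<psi> \<alpha>"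
  then obtain \<psi> where "\<psi> \<in> roots h" "res \<psi> = res \<phi>" "k = root_coeff P \<psi> \<alpha>" by blast
  then show "k = root_coeff P \<phi> \<alpha>" using res_eq_coeff[OF _ assms(1) _ assms(2)] by simp
qed

lemma restricted_expansion:
  assumes "\<nu> \<in> R\<^sub>p"
  shows "\<nu> = (\<lambda>x. \<Sum>\<alpha>\<in>A. of_int (restricted_coeff h P t \<alpha> \<nu>) * res \<alpha> x)"
proof -
  obtain \<phi> where \<phi>: "\<phi> \<in> roots h" "\<nu> = res \<phi>" using assms by (auto simp: R\<^sub>p_def roots_t)
  have "\<nu> = (\<lambda>x. \<Sum>\<alpha>\<in>A. of_int (root_coeff P \<phi> \<alpha>) * res \<alpha> x)"
    unfolding \<phi>(2) by (rule res_expansion[OF \<phi>(1)])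
  also have "\<dots> = (\<lambda>x. \<Sum>\<alpha>\<in>A. of_int (restricted_coeff h P t \<alpha> \<nu>) * res \<alpha> x)"
    unfolding \<phi>(2) by (intro ext sum.cong refl) (simp only: restricted_coeff_eq[OF \<phi>(1)])
  finally show ?thesis .
qed

text \<open>The representative of \<open>res \<alpha>\<close> is the orthogonal projection of that of \<open>\<alpha>\<close> along the
  span of the simple roots of the Levi factor; the coefficients of the subtracted part are
  nonpositive because the simple roots form an obtuse system.\<close>

lemma restricted_vector:
  assumes \<alpha>: "\<alpha> \<in> A"
  shows "\<exists>c y. (\<forall>\<gamma>\<in>\<Pi> \<inter> levi_roots. c \<gamma> \<le> (0 :: real)) \<and>
    y = root_dual \<alpha> - (\<Sum>\<gamma>\<in>\<Pi> \<inter> levi_roots. of_real (c \<gamma>) *\<^sub>C root_dual \<gamma>) \<and>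
    y \<in> t \<and> (\<forall>x\<in>t. killing_form y x = \<alpha> x)"
proof -
  let ?M = "\<Pi> \<inter> levi_roots"
  have fin: "finite ?M" using finite_simple by blast
  have \<alpha>\<Pi>: "\<alpha> \<in> \<Pi>" "\<alpha> \<notin> levi_roots" using \<alpha> by auto
  note \<alpha>r = A_root[OF \<alpha>]
  have "\<exists>c. \<forall>\<gamma>\<in>?M. c \<gamma> \<le> 0 \<and> (\<Sum>\<beta>\<in>?M. c \<beta> * root_form \<beta> \<gamma>) = root_form \<alpha> \<gamma>"
  proof (rule obtuse_system_solution_nonpos[OF fin])
    show "root_form \<beta> \<gamma> = root_form \<gamma> \<beta>" if "\<beta> \<in> ?M" "\<gamma> \<in> ?M" for \<beta> \<gamma>
      using root_form_commute simple_root that by blast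
    show "root_form \<beta> \<gamma> \<le> 0" if "\<beta> \<in> ?M" "\<gamma> \<in> ?M" "\<beta> \<noteq> \<gamma>" for \<beta> \<gamma>
      using simple_obtuse that by blast
    show "root_form \<alpha> \<gamma> \<le> 0" if "\<gamma> \<in> ?M" for \<gamma>
      using simple_obtuse[OF \<alpha>\<Pi>(1), of \<gamma>] \<alpha>\<Pi>(2) that by blast
    fix c :: "('g \<Rightarrow> complex) \<Rightarrow> real" and \<gamma>
    assume Q: "(\<Sum>\<beta>\<in>?M. \<Sum>\<gamma>\<in>?M. c \<beta> * c \<gamma> * root_form \<beta> \<gamma>) \<le> 0" and \<gamma>: "\<gamma> \<in> ?M"
    \<comment> \<open>Extension by zero to all of \<open>\<Pi>\<close>: independence of the simple
      roots then upgrades \<open>root_form_definite\<close> to vanishing of the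
      coefficients.\<close>
    let ?c = "\<lambda>\<beta>. if \<beta> \<in> ?M then complex_of_real (c \<beta>) else 0"
    have "?c \<gamma> = 0"
    proof (rule simple_independent[where c = ?c])
      fix x assume x: "x \<in> h"
      have "(\<Sum>\<beta>\<in>\<Pi>. ?c \<beta> * \<beta> x) = (\<Sum>\<beta>\<in>?M. ?c \<beta> * \<beta> x)"
        by (rule sum.mono_neutral_right) (use finite_simple in auto)
      also have "\<dots> = (\<Sum>\<beta>\<in>?M. of_real (c \<beta>) * \<beta> x)" by (rule sum.cong) auto
      also have "\<dots> = 0"
        by (rule root_form_definite(2)[OF fin _ Q x]) (use simple_root in blast)
      finally show "(\<Sum>\<beta>\<in>\<Pi>. ?c \<beta> * \<beta> x) = 0" .
    qed (use \<gamma> in blast)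
    then show "c \<gamma> = 0" using \<gamma> by simp
  qed
  then obtain c where c: "\<And>\<gamma>. \<gamma> \<in> ?M \<Longrightarrow> c \<gamma> \<le> 0"
    "\<And>\<gamma>. \<gamma> \<in> ?M \<Longrightarrow> (\<Sum>\<beta>\<in>?M. c \<beta> * root_form \<beta> \<gamma>) = root_form \<alpha> \<gamma>" by blast
  define s where "s = (\<Sum>\<gamma>\<in>?M. of_real (c \<gamma>) *\<^sub>C root_dual \<gamma>)"
  have Mr: "?M \<subseteq> roots h" using simple_root by blast
  have sh: "s \<in> h" unfolding s_def by (rule root_dual_sum(1)[OF Mr])
  have yh: "root_dual \<alpha> - s \<in> h" using root_dual(1)[OF \<alpha>r] sh by (rule lie.subspace_diff[OF subspace_h])
  have yt: "root_dual \<alpha> - s \<in> t"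
  proof -
    have "\<gamma> (root_dual \<alpha> - s) = 0" if \<gamma>: "\<gamma> \<in> ?M" for \<gamma>
    proof -
      have \<gamma>w: "\<gamma> \<in> weights" using roots_weights simple_root \<gamma> by blast
      note d = weights_dual[OF \<gamma>w]
      have "\<gamma> s = of_real (root_form \<alpha> \<gamma>)"
        unfolding s_def root_dual_sum(2)[OF Mr \<gamma>w] c(2)[OF \<gamma>] ..
      also have "\<dots> = \<gamma> (root_dual \<alpha>)" using root_form(1)[OF \<alpha>r \<gamma>w] by simp
      finally have "\<gamma> (root_dual \<alpha> - s + s) = \<gamma> (root_dual \<alpha> - s) + \<gamma> (root_dual \<alpha>)"
        using dual_on_add[OF d yh sh] by simp
      then show ?thesis by simp
    qed
    then show ?thesis using yh t_iff by blast
  qed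
  have ky: "killing_form (root_dual \<alpha> - s) x = \<alpha> x" if x: "x \<in> t" for x
  proof -
    have xh: "x \<in> h" using x t_subset_h by blast
    have "killing_form s x = (\<Sum>\<gamma>\<in>?M. killing_form (of_real (c \<gamma>) *\<^sub>C root_dual \<gamma>) x)"
      unfolding s_def by (rule killing_form_sum_left)
    also have "\<dots> = 0"
    proof (intro sum.neutral ballI)
      fix \<gamma> assume \<gamma>: "\<gamma> \<in> ?M"
      then have "killing_form (root_dual \<gamma>) x = \<gamma> x" using root_dual(2)[OF _ xh] simple_root by blast
      also have "\<gamma> x = 0" using \<gamma> x t_iff by blast
      finally show "killing_form (of_real (c \<gamma>) *\<^sub>C root_dual \<gamma>) x = 0" by (simp add: killing_form_scale_left)
    qed
    finally show ?thesis using root_dual(2)[OF \<alpha>r xh] by (simp add: killing_form_diff_left)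
  qed
  show ?thesis
    by (intro exI[of _ c] exI[of _ "root_dual \<alpha> - s"]) (use c(1) yt ky s_def in auto)
qed

text \<open>Restrictions of members of \<open>A\<close> are represented by elements of
  \<open>t\<close>, so an element orthogonal to \<open>t\<close> is annihilated by \<open>A\<close>,
  and on \<open>t\<close> every root is a combination of \<open>A\<close>.\<close>

lemma killing_form_t_nondegenerate:
  assumes x: "x \<in> t" and "\<And>y. y \<in> t \<Longrightarrow> killing_form x y = 0"
  shows "x = 0"
proof (rule h_eq_0I)
  show "x \<in> h" using x t_subset_h by blast
  fix \<phi> assume \<phi>: "\<phi> \<in> roots h"
  have "of_int (root_coeff P \<phi> \<alpha>) * \<alpha> x = 0" if \<alpha>: "\<alpha> \<in> A" for \<alpha>
  proof -
    obtain y where "y \<in> t" "\<forall>x\<in>t. killing_form y x = \<alpha> x" using restricted_vector[OF \<alpha>] by blast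
    then have "\<alpha> x = 0" using assms killing_form_commute[of x y] by simp
    then show ?thesis by simp
  qed
  then have "(\<Sum>\<alpha>\<in>A. of_int (root_coeff P \<phi> \<alpha>) * \<alpha> x) = 0" by (intro sum.neutral ballI)
  then show "\<phi> x = 0" by (rule trans[OF root_on_t[OF \<phi> x]])
qed

lemma killing_representative_eq:
  assumes y: "y \<in> t" "\<forall>x\<in>t. killing_form y x = \<alpha> x"
  shows "killing_representative t (res \<alpha>) = y"
  unfolding killing_representative_def
proof (rule the_equality)
  show "y \<in> t \<and> (\<forall>x\<in>t. killing_form y x = res \<alpha> x)" using y by (simp add: restrict_to_def)
  fix z assume z: "z \<in> t \<and> (\<forall>x\<in>t. killing_form z x = res \<alpha> x)"
  have "z - y = 0"
  proof (rule killing_form_t_nondegenerate)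
    show "z - y \<in> t" using z y by (intro lie.subspace_diff subspace_t) auto
    show "killing_form (z - y) x = 0" if "x \<in> t" for x
      using that z y by (simp add: killing_form_diff_left restrict_to_def)
  qed
  then show "z = y" by simp
qed

text \<open>With z representing the restriction of \<beta>, the form equals \<alpha>(z), which is
  (\<beta>, \<alpha>) minus the sum of c(\<gamma>) (\<gamma>, \<alpha>) over the simple roots
  \<gamma> of \<open>m\<close>. Both c(\<gamma>) and (\<gamma>, \<alpha>) are nonpositive, so the
  projection can only lower the value.\<close>

lemma dual_form_restricted_nonpos:
  assumes \<alpha>: "\<alpha> \<in> A" and \<beta>: "\<beta> \<in> A" and "\<alpha> \<noteq> \<beta>"
  shows "dual_form t (res \<alpha>) (res \<beta>) \<in> \<real> \<and> Re (dual_form t (res \<alpha>) (res \<beta>)) \<le> 0"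
proof -
  let ?M = "\<Pi> \<inter> levi_roots"
  obtain y where y: "y \<in> t" "\<forall>x\<in>t. killing_form y x = \<alpha> x"
    using restricted_vector[OF \<alpha>] by blast
  obtain c z where c: "\<forall>\<gamma>\<in>?M. c \<gamma> \<le> (0 :: real)"
    and z: "z = root_dual \<beta> - (\<Sum>\<gamma>\<in>?M. of_real (c \<gamma>) *\<^sub>C root_dual \<gamma>)" "z \<in> t"
      "\<forall>x\<in>t. killing_form z x = \<beta> x"
    using restricted_vector[OF \<beta>] by blast
  have \<alpha>w: "\<alpha> \<in> weights" using A_root[OF \<alpha>] roots_weights by blast
  note d = weights_dual[OF \<alpha>w]
  have Mr: "?M \<subseteq> roots h" using simple_root by blast
  define s where "s = (\<Sum>\<gamma>\<in>?M. of_real (c \<gamma>) *\<^sub>C root_dual \<gamma>)"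
  have sh: "s \<in> h" unfolding s_def by (rule root_dual_sum(1)[OF Mr])
  have s: "\<alpha> s = of_real (\<Sum>\<gamma>\<in>?M. c \<gamma> * root_form \<gamma> \<alpha>)"
    unfolding s_def by (rule root_dual_sum(2)[OF Mr \<alpha>w])
  have "\<alpha> (root_dual \<beta>) = \<alpha> (z + s)" by (simp add: z(1) s_def)
  also have "\<dots> = \<alpha> z + \<alpha> s" using dual_on_add[OF d _ sh] z(2) t_subset_h by blast
  finally have "\<alpha> z = of_real (root_form \<beta> \<alpha> - (\<Sum>\<gamma>\<in>?M. c \<gamma> * root_form \<gamma> \<alpha>))"
    unfolding s using root_form(1)[OF A_root[OF \<beta>] \<alpha>w] by simp
  moreover have "dual_form t (res \<alpha>) (res \<beta>) = \<alpha> z"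
    unfolding dual_form_def killing_representative_eq[OF y] killing_representative_eq[OF z(2,3)]
    using y z by blast
  moreover have "root_form \<beta> \<alpha> \<le> 0" using simple_obtuse \<alpha> \<beta> assms(3) by blast
  moreover have "(\<Sum>\<gamma>\<in>?M. c \<gamma> * root_form \<gamma> \<alpha>) \<ge> 0"
  proof (rule sum_nonneg)
    fix \<gamma> assume m: "\<gamma> \<in> ?M"
    then have "root_form \<gamma> \<alpha> \<le> 0" using simple_obtuse[of \<gamma> \<alpha>] \<alpha> by blast
    then show "c \<gamma> * root_form \<gamma> \<alpha> \<ge> 0" using c m by (intro mult_nonpos_nonpos) auto
  qed
  ultimately show ?thesis by simp
qed

end

text \<open>The form is complex valued, so its sign is expressed by realness together with the real
  part. Injectivity of \<open>\<beta>\<close> appears separately because independence of the set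
  \<open>R\<^sub>s\<close> would not exclude coincidences among the restrictions. The number
  \<open>l\<close> counts the simple roots outside \<open>m\<close>, and its equality with the
  dimension of \<open>t\<close> is part of the conclusion.\<close>

theorem theorem2p7:
  fixes h q m n t :: "'g::complex_lie_algebra set"
    and \<Delta>\<^sub>p R R\<^sub>p R\<^sub>s :: "('g \<Rightarrow> complex) set"
    and \<alpha> \<beta> :: "nat \<Rightarrow> 'g \<Rightarrow> complex"
    and l :: nat
  assumes "lie_semisimple (UNIV :: 'g set)"
    and "cartan_subalgebra h"
    and "positive_system h \<Delta>\<^sub>p"
    and "standard_parabolic h \<Delta>\<^sub>p q"
    and "q \<noteq> UNIV"
    and "levi_factor m q"
    and "h \<subseteq> m"
    and "n = nilradical q"
    and "t = lie_center m"
    and "bij_betw \<alpha> {1..l} (simple_of \<Delta>\<^sub>p - roots_in h m)"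
    and "\<forall>j\<in>{1..l}. \<beta> j = restrict_to t (\<alpha> j)"
    and "R = roots t"
    and "R\<^sub>p = {\<nu> \<in> R. weight_space t \<nu> \<subseteq> n}"
    and "R\<^sub>s = simple_of R\<^sub>p"
  shows "l = lie.dim t \<and>
    R\<^sub>s = \<beta> ` {1..l} \<and> inj_on \<beta> {1..l} \<and>
    dual_real.independent R\<^sub>s \<and> dual_real.span R\<^sub>s = dual_real.span R \<and>
    (\<forall>i\<in>{1..l}. \<forall>j\<in>{1..l}. i \<noteq> j \<longrightarrow>
       dual_form t (\<beta> i) (\<beta> j) \<in> \<real> \<and> Re (dual_form t (\<beta> i) (\<beta> j)) \<le> 0) \<and>
    (\<forall>\<nu>\<in>R\<^sub>p. \<nu> = (\<lambda>x. \<Sum>j=1..l. of_int (restricted_coeff h \<Delta>\<^sub>p t (\<alpha> j) \<nu>) * \<beta> j x))"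
proof -
  interpret p: parabolic h \<Delta>\<^sub>p q m
    by unfold_locales (use assms in auto)
  let ?A = "simple_of \<Delta>\<^sub>p - p.levi_roots"
  have t: "t = p.t" using assms(9) by (simp add: p.t_def)
  have bij: "bij_betw \<alpha> {1..l} ?A" using assms(10) by (simp add: p.roots_in_eq)
  have \<alpha>A: "\<alpha> j \<in> ?A" if "j \<in> {1..l}" for j using bij that by (auto simp: bij_betw_def)
  have inj: "inj_on \<alpha> {1..l}" and img: "\<alpha> ` {1..l} = ?A" using bij by (auto simp: bij_betw_def)
  have \<beta>: "\<beta> j = restrict_to p.t (\<alpha> j)" if "j \<in> {1..l}" for j using assms(11) that t by simp
  have R\<^sub>p: "R\<^sub>p = p.R\<^sub>p" using assms(8,12,13) by (simp add: p.R\<^sub>p_def t)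
  have \<beta>_img: "\<beta> ` {1..l} = restrict_to p.t ` ?A"
    unfolding img[symmetric] image_image using \<beta> by (intro image_cong) auto
  have R\<^sub>s: "R\<^sub>s = restrict_to p.t ` ?A" using assms(14) by (simp add: R\<^sub>p p.simple_restricted)
  have "l = lie.dim t" using bij_betw_same_card[OF bij] by (simp add: t p.dim_t)
  moreover have "inj_on \<beta> {1..l}"
  proof (rule inj_onI)
    fix i j assume ij: "i \<in> {1..l}" "j \<in> {1..l}" "\<beta> i = \<beta> j"
    then have "\<alpha> i = \<alpha> j" using inj_onD[OF p.inj_on_res] \<alpha>A \<beta> by metis
    then show "i = j" using inj_onD[OF inj] ij by blast
  qed
  moreover have "dual_real.independent R\<^sub>s" unfolding R\<^sub>s by (rule p.independent_restricted)
  moreover have "dual_real.span R\<^sub>s = dual_real.span R"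
    unfolding R\<^sub>s assms(12) t by (rule p.span_restricted)
  moreover have "dual_form t (\<beta> i) (\<beta> j) \<in> \<real> \<and> Re (dual_form t (\<beta> i) (\<beta> j)) \<le> 0"
    if ij: "i \<in> {1..l}" "j \<in> {1..l}" "i \<noteq> j" for i j
  proof -
    have "\<alpha> i \<noteq> \<alpha> j" using inj_onD[OF inj] ij by blast
    then show ?thesis unfolding \<beta>[OF ij(1)] \<beta>[OF ij(2)] t
      by (rule p.dual_form_restricted_nonpos[OF \<alpha>A[OF ij(1)] \<alpha>A[OF ij(2)]])
  qed
  moreover have "\<nu> = (\<lambda>x. \<Sum>j=1..l. of_int (restricted_coeff h \<Delta>\<^sub>p t (\<alpha> j) \<nu>) * \<beta> j x)" if "\<nu> \<in> R\<^sub>p" for \<nu>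
  proof -
    have "(\<Sum>a\<in>?A. of_int (restricted_coeff h \<Delta>\<^sub>p p.t a \<nu>) * restrict_to p.t a x)
        = (\<Sum>j=1..l. of_int (restricted_coeff h \<Delta>\<^sub>p t (\<alpha> j) \<nu>) * \<beta> j x)" for x
    proof -
      have "(\<Sum>a\<in>?A. of_int (restricted_coeff h \<Delta>\<^sub>p p.t a \<nu>) * restrict_to p.t a x)
          = (\<Sum>j=1..l. of_int (restricted_coeff h \<Delta>\<^sub>p p.t (\<alpha> j) \<nu>) * restrict_to p.t (\<alpha> j) x)"
        by (rule sum.reindex_bij_betw[OF bij, symmetric])
      also have "\<dots> = (\<Sum>j=1..l. of_int (restricted_coeff h \<Delta>\<^sub>p t (\<alpha> j) \<nu>) * \<beta> j x)"
        by (rule sum.cong[OF refl]) (simp only: \<beta> t)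
      finally show ?thesis .
    qed
    then show ?thesis using p.restricted_expansion[of \<nu>] that unfolding R\<^sub>p by simp
  qed
  ultimately show ?thesis using R\<^sub>s \<beta>_img by blast
qed

end
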